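(* Let $q$ be a prime power and let $G_2=\mathrm{Aut}(NU(3,q^2))$ be the automorphism group of the graph $NU(3,q^2)$. Then: (1) if $q\neq 2$, then $G_2\cong P\Gamma U(3,q)$, the semilinear collineation group stabilizing the Hermitian variety $H(2,q^2)$; (2) if $q=2$, then $G_2\cong S_3\wr S_4\cong S_3^4\rtimes S_4$.
   Context: Let $PG(2,q^2)$ be the projective plane over the finite field $\mathbb{F}_{q^2}$ with homogeneous coordinates $(X_0,X_1,X_2)$. The non-degenerate Hermitian curve $H(2,q^2)$ is the set of isotropic points of a unitary polarity (induced by a non-degenerate Hermitian form on $\mathbb{F}_{q^2}^3$); up to projectivity it is $X_0^{q+1}+X_1^{q+1}+X_2^{q+1}=0$, and it has $q^3+1$ points. Every line meets $H(2,q^2)$ in either $1$ point (a tangent line) or $q+1$ points (a secant line). $NU(3,q^2)$ is the simple graph whose vertices are the points of $PG(2,q^2)\setminus H(2,q^2)$, two distinct vertices being adjacent if and only if the line joining them is tangent to $H(2,q^2)$. $P\Gamma U(3,q)$ is the subgroup of $P\Gamma L(3,q^2)$ consisting of all semilinear collineations of $PG(2,q^2)$ that stabilize $H(2,q^2)$. $S_m$ is the symmetric group of degree $m$, and in $S_3\wr S_4=S_3^4\rtimes S_4$ the group $S_4$ acts by permuting the four factors. *)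

theory Defs
  imports
    "HOL-Analysis.Cartesian_Space"
    "HOL-Algebra.Bij"
    "HOL-Algebra.Product_Groups"
    "HOL-Algebra.Sym_Groups"
    "HOL-Number_Theory.Prime_Powers"
begin

section \<open>Projective geometry\<close>

text \<open>
  Projective subspaces are identified with the linear subspaces of the underlying vector space,
  so a point lies on a line iff it is a subset of it.  For \<open>'n = 3\<close> this is the projective plane
  over \<open>'a\<close>.
\<close>

definition proj_points :: "('a::field ^ 'n) set set" where
  "proj_points = {P. vec.subspace P \<and> vec.dim P = 1}"

definition proj_lines :: "('a::field ^ 'n) set set" where
  "proj_lines = {L. vec.subspace L \<and> vec.dim L = 2}"

definition line_join :: "('a::field ^ 'n) set \<Rightarrow> ('a ^ 'n) set \<Rightarrow> ('a ^ 'n) set" where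
  "line_join P Q = vec.span (P \<union> Q)"

definition field_automorphism :: "('a::field \<Rightarrow> 'a) \<Rightarrow> bool" where
  "field_automorphism \<sigma> \<longleftrightarrow>
     bij \<sigma> \<and> (\<forall>a b. \<sigma> (a + b) = \<sigma> a + \<sigma> b) \<and> (\<forall>a b. \<sigma> (a * b) = \<sigma> a * \<sigma> b)"

definition semilinear_bij :: "('a::field \<Rightarrow> 'a) \<Rightarrow> ('a ^ 'n \<Rightarrow> 'a ^ 'n) \<Rightarrow> bool" where
  "semilinear_bij \<sigma> T \<longleftrightarrow>
     field_automorphism \<sigma> \<and> bij T \<and>
     (\<forall>x y. T (x + y) = T x + T y) \<and> (\<forall>c x. T (c *s x) = \<sigma> c *s T x)"

definition PGammaL :: "(('a::field ^ 'n) set \<Rightarrow> ('a ^ 'n) set) monoid" where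
  "PGammaL = BijGroup proj_points
     \<lparr>carrier := {f \<in> Bij proj_points. \<exists>\<sigma> T. semilinear_bij \<sigma> T \<and> (\<forall>P\<in>proj_points. f P = T ` P)}\<rparr>"


section \<open>Hermitian curves\<close>

text \<open>
  For a field with \<open>q\<^sup>2\<close> elements the involution of a Hermitian form is \<open>c \<mapsto> c ^ q\<close>.
  Additivity and semilinearity in the second argument follow from the symmetry law.
\<close>

definition nondegenerate_hermitian_form ::
    "nat \<Rightarrow> ('a::field ^ 'n \<Rightarrow> 'a ^ 'n \<Rightarrow> 'a) \<Rightarrow> bool" where
  "nondegenerate_hermitian_form q h \<longleftrightarrow>
     (\<forall>x x' y. h (x + x') y = h x y + h x' y) \<and>
     (\<forall>c x y. h (c *s x) y = c * h x y) \<and>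
     (\<forall>x y. h y x = (h x y) ^ q) \<and>
     (\<forall>x. (\<forall>y. h x y = 0) \<longrightarrow> x = 0)"

definition polar :: "('a::field ^ 'n \<Rightarrow> 'a ^ 'n \<Rightarrow> 'a) \<Rightarrow> ('a ^ 'n) set \<Rightarrow> ('a ^ 'n) set" where
  "polar h S = {y. \<forall>x\<in>S. h x y = 0}"

definition hermitian_variety :: "('a::field ^ 'n \<Rightarrow> 'a ^ 'n \<Rightarrow> 'a) \<Rightarrow> ('a ^ 'n) set set" where
  "hermitian_variety h = {P \<in> proj_points. P \<subseteq> polar h P}"

definition tangent_line :: "('a::field ^ 'n \<Rightarrow> 'a ^ 'n \<Rightarrow> 'a) \<Rightarrow> ('a ^ 'n) set \<Rightarrow> bool" where
  "tangent_line h L \<longleftrightarrow> L \<in> proj_lines \<and> card {P \<in> hermitian_variety h. P \<subseteq> L} = 1"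

definition PGammaU ::
    "('a::field ^ 'n \<Rightarrow> 'a ^ 'n \<Rightarrow> 'a) \<Rightarrow> (('a ^ 'n) set \<Rightarrow> ('a ^ 'n) set) monoid" where
  "PGammaU h = PGammaL
     \<lparr>carrier := {f \<in> carrier PGammaL. f ` hermitian_variety h = hermitian_variety h}\<rparr>"


section \<open>Simple graphs and their automorphism groups\<close>

text \<open>A simple graph is a vertex set together with a set of two-element subsets of it.\<close>

type_synonym 'v simple_graph = "'v set \<times> 'v set set"

definition graph_AutGroup :: "'v simple_graph \<Rightarrow> ('v \<Rightarrow> 'v) monoid" where
  "graph_AutGroup G = (case G of (V, E) \<Rightarrow> BijGroup V
     \<lparr>carrier := {f \<in> Bij V. \<forall>u\<in>V. \<forall>v\<in>V. {f u, f v} \<in> E \<longleftrightarrow> {u, v} \<in> E}\<rparr>)"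

definition NU3 :: "('a::field ^ 3 \<Rightarrow> 'a ^ 3 \<Rightarrow> 'a) \<Rightarrow> ('a ^ 3) set simple_graph" where
  "NU3 h = (let V = proj_points - hermitian_variety h
     in (V, {{P, Q} | P Q. P \<in> V \<and> Q \<in> V \<and> P \<noteq> Q \<and> tangent_line h (line_join P Q)}))"


section \<open>Wreath products\<close>

definition semidirect_product ::
    "('n, 'x) monoid_scheme \<Rightarrow> ('h, 'y) monoid_scheme \<Rightarrow> ('h \<Rightarrow> 'n \<Rightarrow> 'n) \<Rightarrow> ('n \<times> 'h) monoid" where
  "semidirect_product N H \<phi> =
     \<lparr>carrier = carrier N \<times> carrier H,
      monoid.mult = (\<lambda>(n, h) (n', h'). (n \<otimes>\<^bsub>N\<^esub> \<phi> h n', h \<otimes>\<^bsub>H\<^esub> h')),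
      one = (\<one>\<^bsub>N\<^esub>, \<one>\<^bsub>H\<^esub>)\<rparr>"

text \<open>
  The wreath product of \<open>G\<close> with the symmetric group of degree \<open>m\<close>.  The permutation \<open>\<pi>\<close>
  moves the factor with index \<open>i\<close> to index \<open>\<pi> i\<close>; the inverse makes this a left action.
\<close>

definition wreath_sym :: "('g, 'x) monoid_scheme \<Rightarrow> nat \<Rightarrow> ((nat \<Rightarrow> 'g) \<times> (nat \<Rightarrow> nat)) monoid" where
  "wreath_sym G m =
     semidirect_product (product_group {1..m} (\<lambda>_. G)) (sym_group m)
       (\<lambda>\<pi> f. \<lambda>i\<in>{1..m}. f (inv' \<pi> i))"

end

theory Submission
  imports
    Defs
    "HOL-Number_Theory.Residues"
    "HOL-Computational_Algebra.Polynomial"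
begin

text \<open>
  Points are handled through representing vectors: with \<open>pt x\<close> for the span of \<open>x\<close>, a vertex is \<open>pt u\<close> with
  \<open>h u u \<noteq> 0\<close>, and two vertices \<open>pt u \<noteq> pt v\<close> are adjacent iff the Gram determinant of \<open>u, v\<close> vanishes
  (\<open>adj_pt_iff\<close>).  An isotropic vector \<open>x\<close> gives a clique \<open>tangent_verts x\<close> of \<open>q\<^sup>2\<close> vertices, namely the
  tangent line at \<open>pt x\<close> without \<open>pt x\<close> itself.

  Let \<open>q \<noteq> 2\<close>.  The graph determines the tangent lines, then orthogonality, and then the whole plane.
  Among four pairwise adjacent vertices, three lie on a common tangent (\<open>no_onan\<close>); this is the dual
  form of the theorem that a Hermitian unital contains no O'Nan configuration.  Hence a clique that is
  not contained in a tangent line has at most \<open>q + 2 < q\<^sup>2\<close> vertices, so the cliques with \<open>q\<^sup>2\<close> vertices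
  are exactly the sets \<open>tangent_verts x\<close> (\<open>big_clique_is_tangent_verts\<close>).

  If the tangent line at \<open>pt x\<close> without \<open>pt x\<close> is identified with the field, the neighbours on it of
  a vertex \<open>pt l\<close> off the line form a circle, the set of all \<open>a\<close> such that \<open>a + c\<close> has a fixed norm.
  Its centre is the point of the tangent line that is orthogonal to \<open>l\<close>, so that two vertices with
  the same neighbours on the line are collinear with \<open>pt x\<close>.  Therefore, if \<open>l\<close> and some other vertex
  have the same neighbours on each of two tangent lines through \<open>pt r\<close>, then all these points lie on
  the polar line of \<open>pt r\<close>, and \<open>l\<close> is orthogonal to \<open>r\<close>.  Conversely, every vertex orthogonal to \<open>r\<close>
  has such a partner, by an explicit choice of coordinates on the polar line.  This expresses
  orthogonality of vertices in terms of the graph alone (\<open>perp_iff\<close>).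

  Since isotropic points correspond to their tangent lines, every graph automorphism extends to a
  permutation of all points that preserves orthogonality (\<open>extend_orthogonal\<close>).  Such a permutation is
  induced by a semilinear map (\<open>semilinear\<close>), by the coordinate argument of the fundamental theorem of
  projective geometry, carried out in a basis that is orthogonal for \<open>h\<close>.  So restriction to the
  vertices is an isomorphism from the group of semilinear collineations stabilizing the curve onto the
  automorphism group of the graph.

  Let \<open>q = 2\<close>.  Every non-zero scalar has norm 1, and distinct vertices are non-adjacent iff they are
  orthogonal.  The 12 vertices fall into 4 orthogonal triangles, so that the graph is complete
  multipartite with 4 parts of size 3, and its automorphism group permutes the parts and the vertices
  within each part independently (\<open>graph_AutGroup_complete_multipartite\<close>).
\<close>

section \<open>Hermitian forms over a field of square order\<close>

locale hermitian_plane =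
  fixes q :: nat and h :: "'a::{field,finite} ^ 3 \<Rightarrow> 'a ^ 3 \<Rightarrow> 'a"
  assumes primepow_q: "primepow q"
    and card_field: "CARD('a) = q ^ 2"
    and form: "nondegenerate_hermitian_form q h"
begin

text \<open>
  The involution of the field with \<open>q\<^sup>2\<close> elements; its fixed elements are the trace and norm values.
\<close>

definition bar :: "'a \<Rightarrow> 'a" where
  "bar c = c ^ q"

lemma q_ge_2: "2 \<le> q"
  using primepow_gt_Suc_0[OF primepow_q] by simp

lemma h_add_left [simp]: "h (x + y) z = h x z + h y z"
  and h_scale_left [simp]: "h (c *s x) z = c * h x z"
  and bar_h [simp]: "bar (h x y) = h y x"
  using form unfolding nondegenerate_hermitian_form_def bar_def by metis+

lemma nondegenerate: "(\<And>y. h x y = 0) \<Longrightarrow> x = 0"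
  using form unfolding nondegenerate_hermitian_form_def by metis

lemma h_zero_left [simp]: "h 0 z = 0"
  using h_scale_left[of 0 0 z] by (simp del: h_scale_left)

lemma h_minus_left [simp]: "h (- x) z = - h x z"
  by (metis add.right_inverse add_eq_0_iff h_add_left h_zero_left)

lemma h_diff_left [simp]: "h (x - y) z = h x z - h y z"
  using h_add_left[of x "- y" z] by (simp del: h_add_left)

lemma bar_mult [simp]: "bar (c * d) = bar c * bar d"
  and bar_0 [simp]: "bar 0 = 0"
  and bar_1 [simp]: "bar 1 = 1"
  and bar_eq_0_iff [simp]: "bar c = 0 \<longleftrightarrow> c = 0"
  and bar_divide [simp]: "bar (c / d) = bar c / bar d"
  using q_ge_2 by (simp_all add: bar_def power_mult_distrib power_divide)

text \<open>
  The prime below \<open>q\<close> is the characteristic, because the characteristic divides the number of elements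
  of the field.  So \<open>bar\<close> is a power of the Frobenius map.
\<close>

lemma bar_add [simp]: "bar (c + d) = bar c + bar d"
proof -
  obtain p k where p: "prime p" "k > 0" "q = p ^ k"
    using primepow_q by (auto simp: primepow_def)
  have "prime CHAR('a)"
    using finite_imp_CHAR_pos[where ?'a = 'a] prime_CHAR_semidom[where ?'a = 'a] finite_class.finite_UNIV
    by blast
  moreover from this have "CHAR('a) = p"
  proof -
    have "CHAR('a) dvd p ^ (k * 2)"
      using CHAR_dvd_CARD[where ?'a = 'a] card_field p(3) by (simp add: power_mult)
    then have "CHAR('a) dvd p"
      using \<open>prime CHAR('a)\<close> prime_dvd_power by blast
    then show ?thesis
      using p(1) \<open>prime CHAR('a)\<close> primes_dvd_imp_eq by blast
  qed
  ultimately show ?thesis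
    unfolding bar_def using freshmans_dream' p(3) by blast
qed

lemma bar_minus [simp]: "bar (- c) = - bar c"
  by (metis add.right_inverse add_eq_0_iff bar_0 bar_add)

lemma bar_diff [simp]: "bar (c - d) = bar c - bar d"
  using bar_add[of c "- d"] by (simp del: bar_add)

text \<open>
  Every scalar is a value \<open>h x y\<close>, and the symmetry law of the form applied twice is \<open>bar\<close> applied twice.
\<close>

lemma bar_bar [simp]: "bar (bar c) = c"
proof -
  obtain x :: "'a ^ 3" where "x \<noteq> 0"
    using exI[of "\<lambda>x :: 'a ^ 3. x \<noteq> 0" "axis 1 1"] by (auto simp: axis_eq_0_iff)
  then obtain y where y: "h x y \<noteq> 0"
    using nondegenerate by blast
  have "h ((c / h x y) *s x) y = c"
    using y by simp
  then show ?thesis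
    by (metis bar_h)
qed

lemma bar_eq_iff [simp]: "bar c = bar d \<longleftrightarrow> c = d"
  by (metis bar_bar)

lemma h_eq_0_sym: "h x y = 0 \<longleftrightarrow> h y x = 0"
  by (metis bar_eq_0_iff bar_h)

lemma h_add_right [simp]: "h z (x + y) = h z x + h z y"
  and h_scale_right [simp]: "h z (c *s x) = bar c * h z x"
  and h_zero_right [simp]: "h z 0 = 0"
  and h_minus_right [simp]: "h z (- x) = - h z x"
  and h_diff_right [simp]: "h z (x - y) = h z x - h z y"
  by (metis bar_h h_add_left bar_add, metis bar_h h_scale_left bar_mult,
      metis bar_h h_zero_left bar_0, metis bar_h h_minus_left bar_minus,
      metis bar_h h_diff_left bar_diff)

lemma card_poly_eq_le:
  fixes f :: "'a poly"
  assumes "degree f = n" "f \<noteq> 0" "\<And>x. x \<in> A \<Longrightarrow> poly f x = 0"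
  shows "card A \<le> n"
proof -
  have "card A \<le> card {x. poly f x = 0}"
    using assms by (intro card_mono) auto
  then show ?thesis
    using card_poly_roots_bound[of f] assms by simp
qed

lemma card_fixed: "card {c. bar c = c} \<le> q"
proof (rule card_poly_eq_le[of "monom 1 q + [:0, -1:]"])
  show "degree (monom (1::'a) q + [:0, -1:]) = q"
    using q_ge_2 by (subst degree_add_eq_left) (auto simp: degree_monom_eq)
  then show "monom (1::'a) q + [:0, -1:] \<noteq> 0"
    using q_ge_2 by (metis degree_0 not_numeral_le_zero)
qed (auto simp: poly_monom bar_def)

lemma exists_not_fixed: "\<exists>c. bar c \<noteq> c"
proof (rule ccontr)
  assume "\<nexists>c. bar c \<noteq> c"
  then have "{c. bar c = c} = UNIV"
    by auto
  then have "q ^ 2 \<le> q"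
    using card_fixed card_field by simp
  then show False
    using q_ge_2 by (simp add: power2_eq_square)
qed

text \<open>
  Otherwise \<open>bar c = - c\<close> for all \<open>c\<close>; taking \<open>c = 1\<close> shows that the characteristic is 2, and then
  \<open>bar\<close> would be the identity.
\<close>

lemma exists_trace_nonzero: "\<exists>c. c + bar c \<noteq> 0"
proof (rule ccontr)
  assume *: "\<nexists>c. c + bar c \<noteq> 0"
  then have "bar c = - c" for c
    by (metis add_eq_0_iff)
  moreover from * have "(1::'a) + 1 = 0"
    by (metis bar_1)
  then have "- c = c" for c :: 'a
    by (metis add_eq_0_iff minus_unique mult_1 mult_minus_left)
  ultimately show False
    using exists_not_fixed by metis
qed

text \<open>
  The elements of norm \<open>c\<close> are roots of a polynomial of degree \<open>q + 1\<close>.  The injection \<open>f\<close> allows for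
  counting a set of parameters instead of the scalars themselves.
\<close>

lemma card_norm_le: 
  assumes "inj_on f A" "\<And>a. a \<in> A \<Longrightarrow> f a * bar (f a) = c"
  shows "card A \<le> q + 1"
proof -
  have "card (f ` A) \<le> q + 1"
  proof (rule card_poly_eq_le[of "monom 1 (q + 1) + [:- c:]"])
    show "degree (monom (1::'a) (q + 1) + [:- c:]) = q + 1"
      by (subst degree_add_eq_left) (auto simp: degree_monom_eq)
    then show "monom (1::'a) (q + 1) + [:- c:] \<noteq> 0"
      by (metis Suc_eq_plus1 degree_0 nat.distinct(1))
  qed (use assms in \<open>auto simp: poly_monom bar_def\<close>)
  then show ?thesis
    using assms by (simp add: card_image)
qed

text \<open>
  The norm maps the \<open>(q - 1) (q + 1)\<close> non-zero scalars to at most \<open>q - 1\<close> non-zero fixed elements, and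
  no fibre has more than \<open>q + 1\<close> elements.  So every fibre has exactly \<open>q + 1\<close> elements.
\<close>

lemma card_norm_eq:
  assumes "bar c = c" "c \<noteq> 0"
  shows "card {b. b * bar b = c} = q + 1"
proof -
  let ?F = "{c. bar c = c} - {0}" and ?N = "\<lambda>c. {b. b * bar b = c}"
  have "card (\<Union> (?N ` ?F)) = (\<Sum>c\<in>?F. card (?N c))"
    by (subst card_UN_disjoint) auto
  moreover have "\<Union> (?N ` ?F) = UNIV - {0}"
    by (auto simp: mult.commute)
  moreover have "card (UNIV - {0::'a}) = (q - 1) * (q + 1)"
    using q_ge_2 by (simp add: card_field card_Diff_singleton power2_eq_square algebra_simps)
  ultimately have sum: "(\<Sum>c\<in>?F. card (?N c)) = (q - 1) * (q + 1)"
    by simp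
  have le: "card (?N c) \<le> q + 1" for c
    by (rule card_norm_le[of id]) auto
  have F: "card ?F \<le> q - 1"
    using card_fixed by (subst card_Diff_singleton) auto
  show ?thesis
  proof (rule ccontr)
    assume "card (?N c) \<noteq> q + 1"
    then have "card (?N c) < q + 1"
      using le[of c] by simp
    then have "(\<Sum>c\<in>?F. card (?N c)) < (\<Sum>c\<in>?F. q + 1)"
      using assms le by (intro sum_strict_mono_ex1) auto
    also have "\<dots> \<le> (q - 1) * (q + 1)"
      using F by (simp only: sum_constant mult_le_mono1 of_nat_id)
    finally show False
      using sum by simp
  qed
qed

lemma exists_norm_two:
  assumes "bar c = c" "c \<noteq> 0"
  shows "\<exists>a b. a \<noteq> b \<and> a * bar a = c \<and> b * bar b = c"
proof -
  have "\<not> card {b. b * bar b = c} \<le> 1"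
    using card_norm_eq[OF assms] q_ge_2 by simp
  then show ?thesis
    by (subst (asm) card_le_Suc0_iff_eq[unfolded One_nat_def[symmetric]]) auto
qed

end

section \<open>Points and lines in terms of vectors\<close>

abbreviation pt :: "'a::field ^ 'n \<Rightarrow> ('a ^ 'n) set" where
  "pt x \<equiv> vec.span {x}"

lemma mem_pt: "y \<in> pt x \<longleftrightarrow> (\<exists>c. y = c *s x)"
  by (auto simp: vec.span_singleton)

lemma pt_scale [simp]:
  assumes "c \<noteq> 0"
  shows "pt (c *s x) = pt x"
proof (intro Set.set_eqI iffI)
  fix y assume "y \<in> pt x"
  then obtain d where "y = d *s x"
    by (auto simp: mem_pt)
  then have "y = (d / c) *s (c *s x)"
    using assms by simp
  then show "y \<in> pt (c *s x)"
    unfolding mem_pt by blast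
qed (auto simp: mem_pt)

lemma pt_eq_iff:
  assumes "x \<noteq> 0"
  shows "pt x = pt y \<longleftrightarrow> (\<exists>c. c \<noteq> 0 \<and> x = c *s y)"
proof
  assume "pt x = pt y"
  then have "x \<in> pt y"
    using vec.span_base[of x "{x}"] by simp
  then show "\<exists>c. c \<noteq> 0 \<and> x = c *s y"
    using assms by (auto simp: mem_pt)
qed auto

lemma pt_eqI:
  assumes "x \<noteq> 0" "x = c *s y"
  shows "pt x = pt y"
  using assms by (cases "c = 0") auto

lemma proj_points_eq: "proj_points = {pt x | x. x \<noteq> 0}"
proof (intro equalityI subsetI)
  fix P :: "('a ^ 'n) set" assume P: "P \<in> proj_points"
  then obtain B where B: "B \<subseteq> P" "vec.independent B" "P \<subseteq> vec.span B" "card B = 1"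
    using vec.basis_exists[of P] by (auto simp: proj_points_def)
  then obtain x where "B = {x}"
    by (auto simp: card_1_singleton_iff)
  moreover have "vec.span B = P"
    using B P by (simp add: proj_points_def vec.span_subspace)
  moreover have "x \<noteq> 0"
    using B(2) \<open>B = {x}\<close> by auto
  ultimately show "P \<in> {pt x | x. x \<noteq> 0}"
    by blast
qed (auto simp: proj_points_def)

lemma pt_in_proj_points [simp]: "x \<noteq> 0 \<Longrightarrow> pt x \<in> proj_points"
  by (auto simp: proj_points_eq)

lemma line_join_pt: "line_join (pt u) (pt v) = vec.span {u, v}"
proof -
  have "vec.span (pt u \<union> pt v) = vec.span ({u} \<union> {v})"
    by (simp only: vec.span_Un vec.span_span)
  then show ?thesis
    by (simp add: line_join_def insert_commute)
qed

lemma mem_span_pair: "y \<in> vec.span {u, v} \<longleftrightarrow> (\<exists>a b. y = a *s u + b *s v)"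
  by (simp add: vec.span_breakdown_eq mem_pt diff_eq_eq add.commute)

lemma line_join_in_proj_lines:
  assumes "u \<noteq> 0" "v \<noteq> 0" "pt u \<noteq> pt v"
  shows "line_join (pt u) (pt v) \<in> proj_lines"
proof -
  have "u \<notin> pt v"
    using assms pt_eqI by (metis mem_pt)
  then show ?thesis
    using assms by (auto simp: proj_lines_def line_join_pt vec.dim_insert)
qed

lemma pt_subset_span_pair: "pt y \<subseteq> vec.span {u, v} \<longleftrightarrow> y \<in> vec.span {u, v}"
  using vec.span_base[of y "{y}"] vec.span_minimal[of "{y}" "vec.span {u, v}"] by auto

context hermitian_plane
begin

section \<open>Orthogonality in the plane\<close>

text \<open>
  The map to the two inner products cannot be injective, because it goes from \<open>q\<^sup>6\<close> vectors to \<open>q\<^sup>4\<close>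
  pairs of scalars.
\<close>

lemma exists_orthogonal: "\<exists>w. w \<noteq> 0 \<and> h w u = 0 \<and> h w v = 0"
proof -
  let ?f = "\<lambda>w. (h w u, h w v)"
  have "\<not> inj ?f"
  proof
    assume "inj ?f"
    then have "CARD('a ^ 3) \<le> CARD('a \<times> 'a)"
      by (intro card_inj_on_le[of ?f]) auto
    moreover have "CARD('a \<times> 'a) = (q ^ 2) ^ 2" "CARD('a ^ 3) = (q ^ 2) ^ 3"
      by (simp_all add: card_field power2_eq_square)
    ultimately have "(q ^ 2) ^ 3 \<le> (q ^ 2) ^ 2"
      by simp
    moreover have "1 < q ^ 2"
      using q_ge_2 by (intro one_less_power) auto
    ultimately show False
      using power_strict_increasing[of 2 3 "q ^ 2"] by simp
  qed
  then obtain x y where "x \<noteq> y" "h x u = h y u" "h x v = h y v"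
    by (auto simp: inj_def)
  then show ?thesis
    by (intro exI[of _ "x - y"]) simp
qed

text \<open>
  Linear combinations of the three vectors stay in a proper subset of the space.  So the linear map
  with these columns is not surjective, and on a finite set not injective either.
\<close>

lemma dependent_if_common_orthogonal:
  assumes "w \<noteq> 0" "h a w = 0" "h b w = 0" "h c w = 0"
  shows "\<exists>i j k. (i \<noteq> 0 \<or> j \<noteq> 0 \<or> k \<noteq> 0) \<and> i *s a + j *s b + k *s c = 0"
proof -
  let ?f = "\<lambda>x :: 'a ^ 3. x $ 1 *s a + x $ 2 *s b + x $ 3 *s c"
  have "\<not> surj ?f"
  proof
    assume "surj ?f"
    have "h y w = 0" for y
    proof -
      obtain x where "y = ?f x"
        using \<open>surj ?f\<close> by blast
      then show ?thesis
        using assms by simp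
    qed
    then have "h w y = 0" for y
      using h_eq_0_sym by blast
    then show False
      using assms nondegenerate by blast
  qed
  then have "\<not> inj ?f"
    using finite_UNIV_inj_surj[OF finite_class.finite_UNIV, of ?f] by blast
  then obtain x y where *: "x \<noteq> y" "?f x = ?f y"
    by (auto simp: inj_def)
  then have "?f (x - y) = 0"
    by (simp add: vec.scale_left_diff_distrib algebra_simps)
  moreover have "(x - y) $ 1 \<noteq> 0 \<or> (x - y) $ 2 \<noteq> 0 \<or> (x - y) $ 3 \<noteq> 0"
    using * by (auto simp: vec_eq_iff forall_3)
  ultimately show ?thesis
    by blast
qed

lemma span_if_common_orthogonal:
  assumes "a \<noteq> 0" "b \<noteq> 0" "pt a \<noteq> pt b" "w \<noteq> 0" "h a w = 0" "h b w = 0" "h e w = 0"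
  shows "\<exists>i j. e = i *s a + j *s b"
proof -
  obtain i j k where *: "i \<noteq> 0 \<or> j \<noteq> 0 \<or> k \<noteq> 0" "i *s a + j *s b + k *s e = 0"
    using dependent_if_common_orthogonal assms by blast
  have "k \<noteq> 0"
  proof
    assume "k = 0"
    then have eq: "i *s a = (- j) *s b"
      using * by (simp add: add_eq_0_iff vec.scale_minus_left add.commute)
    then have "i \<noteq> 0"
      using * \<open>k = 0\<close> assms by auto
    then have "a = (- j / i) *s b"
      using eq by (metis vec.scale_scale vec.scale_one divide_inverse_commute left_inverse)
    then show False
      using assms pt_eqI by blast
  qed
  have "e = (1 / k) *s (k *s e)"
    using \<open>k \<noteq> 0\<close> by simp
  also have "k *s e = (- i) *s a + (- j) *s b"
    using *(2) by (simp add: vec.scale_minus_left add_eq_0_iff)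
  finally have "e = (1 / k * - i) *s a + (1 / k * - j) *s b"
    by (simp only: vec.scale_right_distrib vec.scale_scale)
  then show ?thesis
    by blast
qed

text \<open>
  Two distinct points span a line, and a line has only one pole.
\<close>

lemma orthogonal_to_pair_unique:
  assumes "a \<noteq> 0" "b \<noteq> 0" "pt a \<noteq> pt b" "w \<noteq> 0" "h w a = 0" "h w b = 0" "h w' a = 0" "h w' b = 0"
  shows "\<exists>c. w' = c *s w"
proof -
  obtain z where z: "h w z \<noteq> 0"
    using assms nondegenerate by blast
  have "h (w' - (h w' z / h w z) *s w) e = 0" for e
  proof -
    define e' where "e' = e - bar (h w e / h w z) *s z"
    have "h w e' = 0"
      using z by (simp add: e'_def)
    then have "h e' w = 0" "h a w = 0" "h b w = 0"
      using assms h_eq_0_sym by auto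
    then obtain i j where "e' = i *s a + j *s b"
      using span_if_common_orthogonal assms by blast
    then have "h w' e' = 0"
      using assms by simp
    then have "h w' e = h w e / h w z * h w' z"
      by (simp add: e'_def)
    then show ?thesis
      by simp
  qed
  then have "w' - (h w' z / h w z) *s w = 0"
    using nondegenerate by blast
  then show ?thesis
    by auto
qed

text \<open>
  The unitary plane contains no totally isotropic line.
\<close>

lemma isotropic_orthogonal_imp_eq:
  assumes "x \<noteq> 0" "y \<noteq> 0" "h x x = 0" "h y y = 0" "h x y = 0"
  shows "pt x = pt y"
proof (rule ccontr)
  assume ne: "pt x \<noteq> pt y"
  have "h y x = 0"
    using assms h_eq_0_sym by blast
  then obtain c where "y = c *s x"
    using orthogonal_to_pair_unique[OF assms(1,2) ne assms(1), of y] assms by blast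
  then show False
    using ne assms pt_eqI by metis
qed

lemma orthogonal_nonisotropic_ne:
  assumes "h r s = 0" "h r r \<noteq> 0" "s \<noteq> 0"
  shows "pt r \<noteq> pt s"
proof
  assume "pt r = pt s"
  then obtain c where "s = c *s r"
    using assms pt_eq_iff by metis
  then show False
    using assms by simp
qed

lemma nonisotropic_ne_0: "h r r \<noteq> 0 \<Longrightarrow> r \<noteq> 0"
  by auto

lemma orthogonal_basis_expansion:
  assumes "h r r \<noteq> 0" "h s s \<noteq> 0" "h t t \<noteq> 0" "h r s = 0" "h r t = 0" "h s t = 0"
  shows "e = (h e r / h r r) *s r + (h e s / h s s) *s s + (h e t / h t t) *s t"
proof -
  have sym: "h s r = 0" "h t r = 0" "h t s = 0"
    using assms h_eq_0_sym by auto
  define e' where "e' = e - (h e r / h r r) *s r - (h e s / h s s) *s s - (h e t / h t t) *s t"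
  have "h e' r = 0" "h e' s = 0" "h e' t = 0"
    using assms sym by (simp_all add: e'_def)
  moreover have "r \<noteq> 0" "s \<noteq> 0" "t \<noteq> 0" "pt r \<noteq> pt s"
    using assms nonisotropic_ne_0 orthogonal_nonisotropic_ne by auto
  ultimately obtain c where "e' = c *s t"
    using orthogonal_to_pair_unique[of r s t e'] sym by blast
  then have "e' = 0"
    using \<open>h e' t = 0\<close> assms by auto
  then show ?thesis
    by (simp add: e'_def algebra_simps)
qed

text \<open>
  Two isotropic vectors \<open>x, y\<close> of the polar line with \<open>h x y \<noteq> 0\<close> have a combination whose norm is a
  prescribed trace, and not every trace is zero.
\<close>

lemma exists_orthogonal_nonisotropic:
  assumes "h r r \<noteq> 0"
  shows "\<exists>s. h s s \<noteq> 0 \<and> h r s = 0"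
proof -
  obtain x where x: "x \<noteq> 0" "h x r = 0"
    using exists_orthogonal by blast
  obtain y0 where y0: "h x y0 \<noteq> 0"
    using x nondegenerate by blast
  define y where "y = y0 - (h y0 r / h r r) *s r"
  have y: "h x y \<noteq> 0" "h y r = 0"
    using y0 x assms by (simp_all add: y_def)
  show ?thesis
  proof (cases "h x x = 0 \<and> h y y = 0")
    case False
    then show ?thesis
      using x y h_eq_0_sym by metis
  next
    case True
    obtain c where c: "c + bar c \<noteq> 0"
      using exists_trace_nonzero by blast
    let ?s = "(c / h x y) *s x + y"
    have "h ?s ?s = c + bar c"
      using True y h_eq_0_sym[of x y] by simp
    moreover have "h ?s r = 0"
      using x y by simp
    ultimately show ?thesis
      using c h_eq_0_sym by metis
  qed
qed

lemma exists_orthogonal_basis: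
  assumes "h r r \<noteq> 0"
  obtains s t where "h s s \<noteq> 0" "h t t \<noteq> 0" "h r s = 0" "h r t = 0" "h s t = 0"
proof -
  obtain s where s: "h s s \<noteq> 0" "h r s = 0"
    using exists_orthogonal_nonisotropic assms by blast
  obtain t where t: "t \<noteq> 0" "h t r = 0" "h t s = 0"
    using exists_orthogonal by blast
  have "h t t \<noteq> 0"
  proof
    assume tt: "h t t = 0"
    have "h t e = 0" for e
    proof -
      define e' where "e' = e - (h e r / h r r) *s r - (h e s / h s s) *s s"
      have "h s r = 0"
        using s h_eq_0_sym by blast
      then have "h e' r = 0" "h e' s = 0"
        using s assms by (simp_all add: e'_def)
      moreover have "r \<noteq> 0" "s \<noteq> 0" "pt r \<noteq> pt s"
        using s assms nonisotropic_ne_0 orthogonal_nonisotropic_ne by auto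
      ultimately obtain c where "e' = c *s t"
        using orthogonal_to_pair_unique[of r s t e'] t by blast
      then have "h t e' = 0"
        using tt by simp
      then show ?thesis
        using t by (simp add: e'_def)
    qed
    then show False
      using nondegenerate t by blast
  qed
  then show ?thesis
    using that s t h_eq_0_sym by metis
qed

text \<open>
  Every other point of the tangent line is non-isotropic, and spans the line together with the isotropic
  point.
\<close>

lemma tangent_complement:
  assumes "x \<noteq> 0" "h x x = 0"
  obtains v where "h v v \<noteq> 0" "h v x = 0" "\<And>z. h z x = 0 \<Longrightarrow> \<exists>i j. z = i *s v + j *s x"
proof -
  obtain y where y: "h x y \<noteq> 0"
    using assms nondegenerate by blast
  obtain v where v: "v \<noteq> 0" "h v x = 0" "h v y = 0"
    using exists_orthogonal by blast
  have ne: "pt v \<noteq> pt x"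
  proof
    assume "pt v = pt x"
    then obtain c where "x = c *s v"
      using assms by (metis pt_eq_iff)
    then show False
      using v y by simp
  qed
  have "h v v \<noteq> 0"
    using isotropic_orthogonal_imp_eq v assms ne by blast
  moreover have "\<exists>i j. z = i *s v + j *s x" if "h z x = 0" for z
    using span_if_common_orthogonal[of v x x z] v assms ne that by blast
  ultimately show ?thesis
    using that v by blast
qed

section \<open>Adjacency as a Gram determinant\<close>

lemma pt_in_hermitian_variety:
  assumes "x \<noteq> 0"
  shows "pt x \<in> hermitian_variety h \<longleftrightarrow> h x x = 0"
proof -
  have "pt x \<subseteq> polar h (pt x) \<longleftrightarrow> (\<forall>c d. h (c *s x) (d *s x) = 0)"
    unfolding polar_def vec.span_singleton by blast
  also have "\<dots> \<longleftrightarrow> h x x = 0"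
    by (auto dest: spec[of _ 1])
  finally show ?thesis
    using assms by (simp add: hermitian_variety_def)
qed

definition verts :: "('a ^ 3) set set" where
  "verts = proj_points - hermitian_variety h"

definition adj :: "('a ^ 3) set \<Rightarrow> ('a ^ 3) set \<Rightarrow> bool" where
  "adj P Q \<longleftrightarrow> {P, Q} \<in> snd (NU3 h)"

lemma verts_eq: "verts = {pt u | u. h u u \<noteq> 0}"
proof -
  have "P \<in> verts \<longleftrightarrow> (\<exists>u. P = pt u \<and> h u u \<noteq> 0)" for P
    unfolding verts_def proj_points_eq Diff_iff
    using pt_in_hermitian_variety nonisotropic_ne_0 by blast
  then show ?thesis
    by blast
qed

lemma pt_in_verts [simp]: "h u u \<noteq> 0 \<Longrightarrow> pt u \<in> verts"
  by (auto simp: verts_eq)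

text \<open>
  The edges are unordered pairs; the join is symmetric, so adjacency can be read off in either order.
\<close>

lemma adj_iff_line: "adj P Q \<longleftrightarrow> P \<in> verts \<and> Q \<in> verts \<and> P \<noteq> Q \<and> tangent_line h (line_join P Q)"
proof -
  have "line_join P Q = line_join Q P"
    by (simp add: line_join_def Un_commute)
  then show ?thesis
    by (auto simp: adj_def NU3_def verts_def Let_def doubleton_eq_iff)
qed

text \<open>
  The Gram determinant of \<open>u, v\<close> vanishes.
\<close>

definition gram_zero :: "'a ^ 3 \<Rightarrow> 'a ^ 3 \<Rightarrow> bool" where
  "gram_zero u v \<longleftrightarrow> h u v * h v u = h u u * h v v"

text \<open>
  The combination of \<open>u\<close> and \<open>v\<close> that is orthogonal to \<open>u\<close>.  When the Gram determinant vanishes it is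
  also orthogonal to \<open>v\<close>, hence isotropic: the point where the line meets the curve.
\<close>

definition tangency_point :: "'a ^ 3 \<Rightarrow> 'a ^ 3 \<Rightarrow> 'a ^ 3" where
  "tangency_point u v = h v u *s u - h u u *s v"

lemma tangency_point_orthogonal:
  assumes "gram_zero u v" "h u u \<noteq> 0" "h v v \<noteq> 0" "pt u \<noteq> pt v"
  shows "h u (tangency_point u v) = 0" "h v (tangency_point u v) = 0"
    "h (tangency_point u v) (tangency_point u v) = 0" "tangency_point u v \<noteq> 0"
proof -
  have "h u v * h v u = h u u * h v v" "h v u * h u v = h u u * h v v"
    using assms(1) by (simp_all only: gram_zero_def mult.commute[of "h v u" "h u v"])
  then show *: "h u (tangency_point u v) = 0" "h v (tangency_point u v) = 0"
    by (simp_all add: tangency_point_def)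
  have "h (tangency_point u v) w = h v u * h u w - h u u * h v w" for w
    by (simp add: tangency_point_def)
  then show "h (tangency_point u v) (tangency_point u v) = 0"
    using * by simp
  show "tangency_point u v \<noteq> 0"
  proof
    assume "tangency_point u v = 0"
    then have "h v u *s u = h u u *s v"
      by (simp add: tangency_point_def)
    then have "v = (h v u / h u u) *s u"
      using assms by (metis vec.scale_scale vec.scale_one divide_inverse_commute left_inverse)
    then show False
      using assms pt_eqI nonisotropic_ne_0 by metis
  qed
qed

lemma exists_norm_other:
  assumes "d \<noteq> 0"
  shows "\<exists>d'. d' \<noteq> d \<and> d' * bar d' = d * bar d"
  using exists_norm_two[of "d * bar d"] assms by (simp add: mult.commute) metis

text \<open>
  If the Gram determinant vanishes, every isotropic point of the line is orthogonal to the isotropic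
  point \<open>tangency_point u v\<close>, hence equal to it.  Otherwise write an isotropic vector of the line as
  \<open>u' + d v\<close> with \<open>u'\<close> orthogonal to \<open>v\<close>; then \<open>d \<noteq> 0\<close>, and another scalar with the norm of \<open>d\<close> gives a
  second isotropic point.
\<close>

lemma tangent_line_iff:
  assumes "h u u \<noteq> 0" "h v v \<noteq> 0" "pt u \<noteq> pt v"
  shows "tangent_line h (line_join (pt u) (pt v)) \<longleftrightarrow> gram_zero u v"
proof -
  have ne: "u \<noteq> 0" "v \<noteq> 0"
    using assms by auto
  let ?S = "{P \<in> hermitian_variety h. P \<subseteq> vec.span {u, v}}"
  have S: "P \<in> ?S \<longleftrightarrow> (\<exists>x. P = pt x \<and> x \<noteq> 0 \<and> h x x = 0 \<and> (\<exists>a b. x = a *s u + b *s v))" for P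
  proof -
    have "P \<in> ?S \<longleftrightarrow> (\<exists>x. x \<noteq> 0 \<and> P = pt x \<and> P \<in> ?S)"
      by (auto simp: hermitian_variety_def proj_points_eq)
    also have "\<dots> \<longleftrightarrow> (\<exists>x. x \<noteq> 0 \<and> P = pt x \<and> h x x = 0 \<and> x \<in> vec.span {u, v})"
      by (intro ex_cong1) (simp add: pt_in_hermitian_variety pt_subset_span_pair cong: conj_cong)
    finally show ?thesis
      unfolding mem_span_pair by blast
  qed
  have "card ?S = 1 \<longleftrightarrow> gram_zero u v"
  proof
    assume "gram_zero u v"
    note t = tangency_point_orthogonal[OF this assms]
    have "?S = {pt (tangency_point u v)}"
    proof (intro equalityI subsetI)
      fix P assume "P \<in> ?S"
      then obtain x a b where x: "P = pt x" "x \<noteq> 0" "h x x = 0" "x = a *s u + b *s v"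
        unfolding S by blast
      then have "h x (tangency_point u v) = 0"
        using t by simp
      from isotropic_orthogonal_imp_eq[OF x(2) t(4) x(3) t(3) this] show "P \<in> {pt (tangency_point u v)}"
        using x(1) by blast
    next
      fix P assume "P \<in> {pt (tangency_point u v)}"
      moreover have "tangency_point u v = h v u *s u + (- h u u) *s v"
        by (simp add: tangency_point_def)
      ultimately show "P \<in> ?S"
        unfolding S using t by blast
    qed
    then show "card ?S = 1"
      by simp
  next
    assume "card ?S = 1"
    then obtain P where P: "?S = {P}"
      by (auto simp: card_1_singleton_iff)
    then have "P \<in> ?S"
      by blast
    then obtain x a b where x: "P = pt x" "x \<noteq> 0" "h x x = 0" "x = a *s u + b *s v"
      unfolding S by blast
    show "gram_zero u v"
    proof (rule ccontr)
      assume nt: "\<not> gram_zero u v"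
      have "a \<noteq> 0"
        using x assms by auto
      define c where "c = h u v / h v v"
      define u' where "u' = u - c *s v"
      define d where "d = b / a + c"
      have u'v: "h u' v = 0" "h v u' = 0"
        using assms h_eq_0_sym[of u' v] by (simp_all add: u'_def c_def)
      have x': "x = a *s (u' + d *s v)"
        using \<open>a \<noteq> 0\<close> x by (simp add: u'_def d_def vec.scale_right_distrib vec.scale_left_distrib
            vec.scale_right_diff_distrib)
      have "h u' u' = h u u - h u v * h v u / h v v"
        using u'v assms unfolding u'_def by (simp add: c_def)
      then have "h u' u' \<noteq> 0"
        using nt assms by (auto simp: gram_zero_def field_simps)
      have iso: "h (u' + d' *s v) (u' + d' *s v) = h u' u' + d' * bar d' * h v v" for d'
        using u'v by simp
      have "h (u' + d *s v) (u' + d *s v) = 0"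
        using x(3) \<open>a \<noteq> 0\<close> unfolding x' h_scale_left h_scale_right by simp
      then have z: "h u' u' + d * bar d * h v v = 0"
        unfolding iso .
      then have "d \<noteq> 0"
        using \<open>h u' u' \<noteq> 0\<close> by auto
      then obtain d' where d': "d' \<noteq> d" "d' * bar d' = d * bar d"
        using exists_norm_other by blast
      define x2 where "x2 = u' + d' *s v"
      have "h x2 x2 = 0"
        unfolding x2_def iso d'(2) by (rule z)
      moreover have "x2 = 1 *s u + (d' - c) *s v"
        by (simp add: x2_def u'_def vec.scale_left_diff_distrib)
      moreover have "x2 \<noteq> 0"
      proof
        assume "x2 = 0"
        then have "h x2 u' = 0" by simp
        then show False
          using \<open>h u' u' \<noteq> 0\<close> u'v by (simp add: x2_def)
      qed
      ultimately have "pt x2 \<in> ?S"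
        unfolding S by blast
      then have "pt x2 = pt x"
        using P x by simp
      then obtain k where k: "x2 = k *s x" "k \<noteq> 0"
        using pt_eq_iff \<open>x2 \<noteq> 0\<close> by blast
      have "h x2 u' = k * h x u'" "h x2 v = k * h x v"
        using k by simp_all
      then have "k * a = 1" "d' = k * a * d"
        using u'v \<open>h u' u' \<noteq> 0\<close> assms unfolding x' x2_def by simp_all
      then show False
        using d' by simp
    qed
  qed
  then show ?thesis
    using line_join_in_proj_lines[OF ne assms(3)] by (simp add: tangent_line_def line_join_pt)
qed

lemma adj_pt_iff:
  assumes "h u u \<noteq> 0" "h v v \<noteq> 0"
  shows "adj (pt u) (pt v) \<longleftrightarrow> pt u \<noteq> pt v \<and> gram_zero u v"
  using assms tangent_line_iff by (auto simp: adj_iff_line)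

section \<open>Tangent lines as cliques\<close>

text \<open>
  The vertices on the line polar to \<open>x\<close>.  For isotropic \<open>x\<close> this is the tangent line at \<open>pt x\<close> without
  its isotropic point.
\<close>

definition tangent_verts :: "'a ^ 3 \<Rightarrow> ('a ^ 3) set set" where
  "tangent_verts x = {pt w | w. h w w \<noteq> 0 \<and> h w x = 0}"

definition isotropic :: "'a ^ 3 \<Rightarrow> bool" where
  "isotropic x \<longleftrightarrow> x \<noteq> 0 \<and> h x x = 0"

lemma pt_in_tangent_verts_iff:
  assumes "w \<noteq> 0"
  shows "pt w \<in> tangent_verts x \<longleftrightarrow> h w w \<noteq> 0 \<and> h w x = 0"
proof
  assume "pt w \<in> tangent_verts x"
  then obtain u where u: "pt w = pt u" "h u u \<noteq> 0" "h u x = 0"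
    by (auto simp: tangent_verts_def)
  then obtain c where "c \<noteq> 0" "w = c *s u"
    using assms pt_eq_iff by blast
  then show "h w w \<noteq> 0 \<and> h w x = 0"
    using u by simp
qed (auto simp: tangent_verts_def)

lemma tangent_verts_subset_verts: "tangent_verts x \<subseteq> verts"
  by (auto simp: tangent_verts_def)

lemma tangent_verts_scale: "c \<noteq> 0 \<Longrightarrow> tangent_verts (c *s x) = tangent_verts x"
  by (simp add: tangent_verts_def)

text \<open>
  The tangent line at \<open>pt x\<close> without \<open>pt x\<close> is an affine line over the field.
\<close>

lemma tangent_verts_parametrized:
  assumes "isotropic x"
  obtains v where "h v v \<noteq> 0" "h v x = 0" "tangent_verts x = (\<lambda>a. pt (v + a *s x)) ` UNIV"
    "inj (\<lambda>a. pt (v + a *s x))"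
    "\<And>z. h z x = 0 \<Longrightarrow> \<exists>i j. z = i *s v + j *s x"
proof -
  have x: "x \<noteq> 0" "h x x = 0"
    using assms by (auto simp: isotropic_def)
  obtain v where v: "h v v \<noteq> 0" "h v x = 0" and span: "\<And>z. h z x = 0 \<Longrightarrow> \<exists>i j. z = i *s v + j *s x"
    using tangent_complement[OF x] by blast
  have xv: "h x v = 0"
    using v(2) h_eq_0_sym by blast
  have nz: "h (v + a *s x) (v + a *s x) = h v v" for a
    using x v xv by simp
  have "tangent_verts x = (\<lambda>a. pt (v + a *s x)) ` UNIV"
  proof (intro equalityI subsetI)
    fix P assume "P \<in> tangent_verts x"
    then obtain w where w: "P = pt w" "h w w \<noteq> 0" "h w x = 0"
      by (auto simp: tangent_verts_def)
    obtain i j where ij: "w = i *s v + j *s x"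
      using span w by blast
    then have "i \<noteq> 0"
      using w x by auto
    then have "w = i *s (v + (j / i) *s x)"
      using ij by (simp add: vec.scale_right_distrib)
    then have "P = pt (v + (j / i) *s x)"
      using w(1) \<open>i \<noteq> 0\<close> by simp
    then show "P \<in> range (\<lambda>a. pt (v + a *s x))"
      by blast
  next
    fix P assume "P \<in> range (\<lambda>a. pt (v + a *s x))"
    then obtain a where a: "P = pt (v + a *s x)"
      by blast
    have "h (v + a *s x) x = 0"
      using v x by simp
    moreover have "h (v + a *s x) (v + a *s x) \<noteq> 0"
      using v(1) unfolding nz .
    ultimately show "P \<in> tangent_verts x"
      unfolding tangent_verts_def a by blast
  qed
  moreover have "inj (\<lambda>a. pt (v + a *s x))"
  proof (rule injI)
    fix a b assume eq: "pt (v + a *s x) = pt (v + b *s x)"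
    have "v + a *s x \<noteq> 0"
      using v(1) by (intro nonisotropic_ne_0) (simp only: nz, simp)
    then obtain c where c: "v + a *s x = c *s (v + b *s x)"
      using eq pt_eq_iff by blast
    have "h (v + a *s x) v = c * h (v + b *s x) v"
      by (simp only: c h_scale_left)
    then have "c = 1"
      using v xv by simp
    then show "a = b"
      using c x(1) by simp
  qed
  ultimately show ?thesis
    using that v span by blast
qed

lemma card_tangent_verts:
  assumes "isotropic x"
  shows "card (tangent_verts x) = q ^ 2"
proof -
  obtain v where "tangent_verts x = (\<lambda>a. pt (v + a *s x)) ` UNIV" "inj (\<lambda>a. pt (v + a *s x))"
    by (rule tangent_verts_parametrized[OF assms], rule that)
  then show ?thesis
    by (simp add: card_image card_field)
qed

lemma tangent_verts_adj:
  assumes "isotropic x" "P \<in> tangent_verts x" "Q \<in> tangent_verts x" "P \<noteq> Q"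
  shows "adj P Q"
proof -
  obtain v where v: "h v v \<noteq> 0" "h v x = 0" "tangent_verts x = (\<lambda>a. pt (v + a *s x)) ` UNIV"
    by (rule tangent_verts_parametrized[OF assms(1)], rule that)
  obtain a b where ab: "P = pt (v + a *s x)" "Q = pt (v + b *s x)"
    using assms(2,3) unfolding v(3) by auto
  have "h x v = 0"
    using v(2) h_eq_0_sym by blast
  then have *: "h (v + c *s x) (v + d *s x) = h v v" for c d
    using v assms(1) by (simp add: isotropic_def)
  have "gram_zero (v + a *s x) (v + b *s x)"
    unfolding gram_zero_def * ..
  moreover have "h (v + c *s x) (v + c *s x) \<noteq> 0" for c
    using v(1) unfolding * .
  ultimately show ?thesis
    using adj_pt_iff assms(4) unfolding ab by blast
qed

lemma tangency_point_of_adj: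
  assumes "adj (pt u) (pt v)" "h u u \<noteq> 0" "h v v \<noteq> 0"
  shows "isotropic (tangency_point u v)" "h u (tangency_point u v) = 0" "h v (tangency_point u v) = 0"
proof -
  have "pt u \<noteq> pt v" "gram_zero u v"
    using assms adj_pt_iff by blast+
  then show "isotropic (tangency_point u v)" "h u (tangency_point u v) = 0" "h v (tangency_point u v) = 0"
    using tangency_point_orthogonal[of u v] assms(2,3) unfolding isotropic_def by blast+
qed

text \<open>
  Both \<open>x\<close> and \<open>y\<close> represent the pole of the line joining the two vertices.
\<close>

lemma tangent_verts_unique:
  assumes "isotropic x" "isotropic y" "P \<noteq> Q" "P \<in> tangent_verts x" "Q \<in> tangent_verts x"
    "P \<in> tangent_verts y" "Q \<in> tangent_verts y"
  shows "pt x = pt y" "tangent_verts x = tangent_verts y"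
proof -
  obtain u v where uv: "P = pt u" "Q = pt v" "h u u \<noteq> 0" "h v v \<noteq> 0"
    using assms(4,5) unfolding tangent_verts_def by blast
  have ne: "u \<noteq> 0" "v \<noteq> 0" "pt u \<noteq> pt v"
    using uv assms(3) nonisotropic_ne_0 by auto
  have "h u x = 0" "h v x = 0" "h u y = 0" "h v y = 0"
    using assms(4-7) ne(1,2) unfolding uv by (simp_all add: pt_in_tangent_verts_iff)
  then have o: "h x u = 0" "h x v = 0" "h y u = 0" "h y v = 0"
    using h_eq_0_sym by blast+
  have xy: "x \<noteq> 0" "y \<noteq> 0"
    using assms(1,2) by (auto simp: isotropic_def)
  obtain c where c: "y = c *s x"
    using orthogonal_to_pair_unique[OF ne xy(1) o] by blast
  then have "c \<noteq> 0"
    using xy by auto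
  then show "pt x = pt y" "tangent_verts x = tangent_verts y"
    using c tangent_verts_scale by simp_all
qed

lemma tangent_verts_eq_iff:
  assumes "isotropic x" "isotropic y"
  shows "tangent_verts x = tangent_verts y \<longleftrightarrow> pt x = pt y"
proof
  assume eq: "tangent_verts x = tangent_verts y"
  have "\<not> card (tangent_verts x) \<le> 1"
    using card_tangent_verts[OF assms(1)] q_ge_2 one_less_power[of q 2] by simp
  then obtain P Q where "P \<in> tangent_verts x" "Q \<in> tangent_verts x" "P \<noteq> Q"
    using card_le_Suc0_iff_eq[of "tangent_verts x"] by auto
  then show "pt x = pt y"
    using tangent_verts_unique(1) assms eq by blast
next
  assume "pt x = pt y"
  then obtain c where "c \<noteq> 0" "x = c *s y"
    using assms pt_eq_iff unfolding isotropic_def by blast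
  then show "tangent_verts x = tangent_verts y"
    using tangent_verts_scale by simp
qed

section \<open>Absence of O'Nan configurations\<close>

text \<open>
  The vectors \<open>tangency_point a u\<close> for \<open>u = b, c, d\<close> are isotropic and lie in the two-dimensional
  space orthogonal to \<open>a\<close>, so that they are linearly dependent.  Suppose that none of the four
  triples is collinear.  Then the dependency forces the two cyclic products \<open>F\<close> and \<open>R\<close> of the inner
  products \<open>h u (tangency_point a w)\<close> to be opposite.  On the other hand, \<open>key\<close> relates such an inner
  product to the one with \<open>u\<close> and \<open>w\<close> exchanged; multiplied around the cycle it compares \<open>F\<close> and \<open>R\<close>, and
  shows that \<open>h b c * h c d * h d b = h b b * h c c * h d d\<close>.  This equation says that \<open>d\<close> is on the
  tangent through \<open>b\<close> and \<open>c\<close>.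
\<close>

lemma no_onan_vectors:
  assumes nz: "h a a \<noteq> 0" "h b b \<noteq> 0" "h c c \<noteq> 0" "h d d \<noteq> 0"
    and t: "gram_zero a b" "gram_zero a c" "gram_zero a d" "gram_zero b c" "gram_zero b d" "gram_zero c d"
    and ne: "pt a \<noteq> pt b" "pt a \<noteq> pt c" "pt a \<noteq> pt d"
  shows "h c (tangency_point a b) = 0 \<or> h d (tangency_point a b) = 0 \<or> h d (tangency_point a c) = 0 \<or>
    h d (tangency_point b c) = 0"
proof (rule ccontr)
  assume contra: "\<not> ?thesis"
  define n where "n = h a a"
  have e_def: "h u (tangency_point a w) = h a w * h u a - n * h u w" for u w
    by (simp add: tangency_point_def n_def)
  have tg: "h u w * h w u = h u u * h w w" if "gram_zero u w" for u w
    using that by (simp add: gram_zero_def)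
  have key: "h w (tangency_point a u) * (h u w * h u a * h a w) =
      - (n * h u u * h w w) * h u (tangency_point a w)"
    if "gram_zero a u" "gram_zero a w" "gram_zero u w" for u w
    using that unfolding e_def gram_zero_def n_def by Groebner_Basis.algebra
  have nonzero: "h u w \<noteq> 0" "h w u \<noteq> 0" if "gram_zero u w" "h u u \<noteq> 0" "h w w \<noteq> 0" for u w
    using that unfolding gram_zero_def by auto
  have cb: "h c (tangency_point a b) \<noteq> 0" and db: "h d (tangency_point a b) \<noteq> 0" and
      dc: "h d (tangency_point a c) \<noteq> 0"
    using contra by auto
  have bc: "h b (tangency_point a c) \<noteq> 0"
    using key[OF t(1,2,4)] nonzero[OF t(1)] nonzero[OF t(2)] nonzero[OF t(4)] nz cb by auto
  have bd: "h b (tangency_point a d) \<noteq> 0"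
    using key[OF t(1,3,5)] nonzero[OF t(1)] nonzero[OF t(3)] nonzero[OF t(5)] nz db by auto
  have cd: "h c (tangency_point a d) \<noteq> 0"
    using key[OF t(2,3,6)] nonzero[OF t(2)] nonzero[OF t(3)] nonzero[OF t(6)] nz dc by auto
  have self: "h b (tangency_point a b) = 0" "h c (tangency_point a c) = 0" "h d (tangency_point a d) = 0"
    using tangency_point_orthogonal[OF t(1) nz(1,2) ne(1)]
      tangency_point_orthogonal[OF t(2) nz(1,3) ne(2)]
      tangency_point_orthogonal[OF t(3) nz(1,4) ne(3)] by auto
  have "h (tangency_point a b) a = 0" "h (tangency_point a c) a = 0" "h (tangency_point a d) a = 0"
    using tangency_point_orthogonal(1)[OF t(1) nz(1,2) ne(1)]
      tangency_point_orthogonal(1)[OF t(2) nz(1,3) ne(2)]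
      tangency_point_orthogonal(1)[OF t(3) nz(1,4) ne(3)]
      h_eq_0_sym by blast+
  moreover have "a \<noteq> 0"
    using nz nonisotropic_ne_0 by blast
  ultimately obtain i j k where ijk: "i \<noteq> 0 \<or> j \<noteq> 0 \<or> k \<noteq> 0"
      and dep: "i *s tangency_point a b + j *s tangency_point a c + k *s tangency_point a d = 0"
    using dependent_if_common_orthogonal by blast
  have rel: "bar i * h u (tangency_point a b) + bar j * h u (tangency_point a c) +
      bar k * h u (tangency_point a d) = 0" for u
  proof -
    have "h u (i *s tangency_point a b + j *s tangency_point a c + k *s tangency_point a d) = 0"
      unfolding dep by simp
    then show ?thesis
      by simp
  qed
  have r1: "bar j * h b (tangency_point a c) = - (bar k * h b (tangency_point a d))"
    using rel[of b] self by (simp add: eq_neg_iff_add_eq_0)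
  have r2: "bar i * h c (tangency_point a b) = - (bar k * h c (tangency_point a d))"
    using rel[of c] self by (simp add: eq_neg_iff_add_eq_0)
  have r3: "bar i * h d (tangency_point a b) = - (bar j * h d (tangency_point a c))"
    using rel[of d] self by (simp add: eq_neg_iff_add_eq_0)
  have "i \<noteq> 0" "j \<noteq> 0" "k \<noteq> 0"
    using r1 r2 r3 ijk bc bd cb cd db dc by auto
  then have nz3: "bar i * bar j * bar k \<noteq> 0"
    by simp
  define F where "F = h b (tangency_point a c) * h c (tangency_point a d) * h d (tangency_point a b)"
  define R where "R = h b (tangency_point a d) * h c (tangency_point a b) * h d (tangency_point a c)"
  \<comment> \<open>The three relations are multiplied; each of them replaces one factor of F by one of R.\<close>
  have "bar i * bar j * bar k * F = - (bar i * bar j * bar k * R)"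
    unfolding F_def R_def using r1 r2 r3 by Groebner_Basis.algebra
  then have "(bar i * bar j * bar k) * (F + R) = 0"
    by (simp only: distrib_left) simp
  then have FR: "F = - R"
    using nz3 by (simp add: eq_neg_iff_add_eq_0)
  have "R \<noteq> 0"
    unfolding R_def using bd cb dc by simp
  define p where "p = h b b * h c c * h d d"
  define X where "X = h b c * h c d * h d b"
  have "p \<noteq> 0" "n \<noteq> 0"
    using nz by (simp_all add: p_def n_def)
  have k1: "h c (tangency_point a b) * (h b c * h b a * h a c) =
      - (n * h b b * h c c) * h b (tangency_point a c)"
    using key[OF t(1,2,4)] .
  have k2: "h d (tangency_point a c) * (h c d * h c a * h a d) =
      - (n * h c c * h d d) * h c (tangency_point a d)"
    using key[OF t(2,3,6)] .
  have "gram_zero d b"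
    using t(5) by (simp add: gram_zero_def mult.commute)
  then have k3: "h b (tangency_point a d) * (h d b * h d a * h a b) =
      - (n * h d d * h b b) * h d (tangency_point a b)"
    using key[OF t(3,1)] by blast
  define Y where "Y = h b a * h a c * (h c a * h a d) * (h d a * h a b)"
  have "R * X * Y = - (n ^ 3 * p ^ 2 * F)"
    unfolding R_def X_def F_def p_def Y_def using k1 k2 k3 by Groebner_Basis.algebra
  moreover have "Y = n ^ 3 * p"
    unfolding p_def n_def Y_def using tg[OF t(1)] tg[OF t(2)] tg[OF t(3)] by Groebner_Basis.algebra
  ultimately have "(R * n ^ 3 * p) * X = (R * n ^ 3 * p) * p"
    unfolding FR by Groebner_Basis.algebra
  then have "X = p"
    using \<open>R \<noteq> 0\<close> \<open>n \<noteq> 0\<close> \<open>p \<noteq> 0\<close> by simp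
  then have "h d (tangency_point b c) * h c d = 0"
    unfolding X_def p_def tangency_point_def using tg[OF t(6)] by (simp add: algebra_simps)
  then show False
    using contra nonzero[OF t(6)] nz by simp
qed

section \<open>Cliques of size \<open>q\<^sup>2\<close>\<close>

definition clique :: "('a ^ 3) set set \<Rightarrow> bool" where
  "clique K \<longleftrightarrow> K \<subseteq> verts \<and> (\<forall>P\<in>K. \<forall>Q\<in>K. P \<noteq> Q \<longrightarrow> adj P Q)"

definition concurrent :: "('a ^ 3) set \<Rightarrow> ('a ^ 3) set \<Rightarrow> ('a ^ 3) set \<Rightarrow> bool" where
  "concurrent P Q R \<longleftrightarrow> (\<exists>x. isotropic x \<and> P \<in> tangent_verts x \<and> Q \<in> tangent_verts x \<and> R \<in> tangent_verts x)"

lemma no_onan: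
  assumes K: "clique K" "A \<in> K" "B \<in> K" "C \<in> K" "D \<in> K" and dist: "distinct [A, B, C, D]"
  shows "concurrent A B C \<or> concurrent A B D \<or> concurrent A C D \<or> concurrent B C D"
proof -
  have "\<exists>u. P = pt u \<and> h u u \<noteq> 0" if "P \<in> K" for P
    using K(1) that by (auto simp: clique_def verts_eq)
  from this[OF K(2)] this[OF K(3)] this[OF K(4)] this[OF K(5)]
  obtain a b c d where v: "A = pt a" "B = pt b" "C = pt c" "D = pt d"
    and nz: "h a a \<noteq> 0" "h b b \<noteq> 0" "h c c \<noteq> 0" "h d d \<noteq> 0"
    by (elim exE conjE)
  have ad: "adj A B" "adj A C" "adj A D" "adj B C" "adj B D" "adj C D"
    using K dist by (auto simp: clique_def)
  have t: "gram_zero a b" "gram_zero a c" "gram_zero a d" "gram_zero b c" "gram_zero b d" "gram_zero c d"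
    using ad nz by (simp_all add: v adj_pt_iff)
  have ne: "pt a \<noteq> pt b" "pt a \<noteq> pt c" "pt a \<noteq> pt d"
    using dist v by auto
  have conc: "concurrent (pt u) (pt v) (pt w)"
    if "adj (pt u) (pt v)" "h u u \<noteq> 0" "h v v \<noteq> 0" "h w w \<noteq> 0" "h w (tangency_point u v) = 0" for u v w
    unfolding concurrent_def tangent_verts_def using tangency_point_of_adj[OF that(1-3)] that by blast
  show ?thesis
    using no_onan_vectors[OF nz t ne] conc[of a b c] conc[of a b d] conc[of a c d] conc[of b c d] ad nz
    unfolding v by blast
qed

text \<open>
  In the affine parameter the neighbours are the solutions of a norm equation.
\<close>

lemma card_neighbours_on_tangent_verts:
  assumes "isotropic x" "P \<in> verts" "P \<notin> tangent_verts x"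
  shows "card {Q \<in> tangent_verts x. adj P Q} \<le> q + 1"
proof -
  obtain u where u: "P = pt u" "h u u \<noteq> 0"
    using assms by (auto simp: verts_eq)
  have ux: "h u x \<noteq> 0"
    using assms(3) u by (auto simp: tangent_verts_def)
  obtain v where v: "h v v \<noteq> 0" "h v x = 0" "tangent_verts x = (\<lambda>a. pt (v + a *s x)) ` UNIV"
    by (rule tangent_verts_parametrized[OF assms(1)], rule that)
  have xv: "h x v = 0"
    using v(2) h_eq_0_sym by blast
  have nz: "h (v + a *s x) (v + a *s x) = h v v" for a
    using v xv assms(1) by (simp add: isotropic_def)
  let ?A = "{a. adj P (pt (v + a *s x))}"
  have "{Q \<in> tangent_verts x. adj P Q} = (\<lambda>a. pt (v + a *s x)) ` ?A"
    unfolding v(3) by blast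
  then have "card {Q \<in> tangent_verts x. adj P Q} \<le> card ?A"
    by (simp add: card_image_le)
  also have "card ?A \<le> q + 1"
  proof (rule card_norm_le)
    show "inj_on (\<lambda>a. h u (v + a *s x)) ?A"
      using ux by (auto simp: inj_on_def)
    fix a assume "a \<in> ?A"
    then have "adj (pt u) (pt (v + a *s x))"
      using u by simp
    then have "gram_zero u (v + a *s x)"
      using adj_pt_iff[of u "v + a *s x"] u(2) nz v(1) by metis
    then show "h u (v + a *s x) * bar (h u (v + a *s x)) = h u u * h v v"
      unfolding bar_h gram_zero_def nz .
  qed
  finally show ?thesis .
qed

text \<open>
  By \<open>no_onan\<close> the clique contains three vertices on a common tangent.  Suppose that \<open>D\<close> is a member
  off this tangent.  If \<open>E\<close> were another one, the tangent joining \<open>D\<close> and \<open>E\<close> would meet the first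
  tangent in at most one of the three vertices, and the other two would form with \<open>D, E\<close> four vertices
  without a collinear triple.  So all other members are neighbours of \<open>D\<close> on the tangent, of which
  there are at most \<open>q + 1\<close>; but \<open>q + 2 < q\<^sup>2\<close> for \<open>q \<ge> 3\<close>.
\<close>

lemma big_clique_is_tangent_verts:
  assumes q: "q \<noteq> 2" and K: "clique K" "card K = q ^ 2"
  shows "\<exists>x. isotropic x \<and> K = tangent_verts x"
proof -
  have "3 \<le> q"
    using q q_ge_2 by simp
  then have "3 * q \<le> q ^ 2"
    by (simp add: power2_eq_square)
  then have q2: "q + 2 < q ^ 2"
    using \<open>3 \<le> q\<close> by simp
  have ex: "\<exists>P\<in>K. P \<notin> set S" if "length S \<le> 3" for S
  proof (rule ccontr)
    assume "\<not> ?thesis"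
    then have "K \<subseteq> set S"
      by blast
    then have "card K \<le> card (set S)"
      by (intro card_mono) auto
    also have "\<dots> \<le> 3"
      using card_length[of S] that by simp
    finally show False
      using q2 K(2) \<open>3 \<le> q\<close> by simp
  qed
  obtain A0 where A0: "A0 \<in> K"
    using ex[of "[]"] by auto
  obtain B0 where B0: "B0 \<in> K" "B0 \<noteq> A0"
    using ex[of "[A0]"] by auto
  obtain C0 where C0: "C0 \<in> K" "C0 \<noteq> A0" "C0 \<noteq> B0"
    using ex[of "[A0, B0]"] by auto
  obtain D0 where D0: "D0 \<in> K" "D0 \<noteq> A0" "D0 \<noteq> B0" "D0 \<noteq> C0"
    using ex[of "[A0, B0, C0]"] by auto
  have "\<exists>A B C. A \<in> K \<and> B \<in> K \<and> C \<in> K \<and> A \<noteq> B \<and> A \<noteq> C \<and> B \<noteq> C \<and> concurrent A B C"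
  proof -
    have "distinct [A0, B0, C0, D0]"
      using B0 C0 D0 by auto
    from no_onan[OF K(1) A0 B0(1) C0(1) D0(1) this] show ?thesis
      using A0 B0 C0 D0 by metis
  qed
  then obtain A B C x where ABC: "A \<in> K" "B \<in> K" "C \<in> K" "A \<noteq> B" "A \<noteq> C" "B \<noteq> C"
    and x: "isotropic x" "A \<in> tangent_verts x" "B \<in> tangent_verts x" "C \<in> tangent_verts x"
    by (auto simp: concurrent_def)
  have "K \<subseteq> tangent_verts x"
  proof (rule ccontr)
    assume "\<not> K \<subseteq> tangent_verts x"
    then obtain D where D: "D \<in> K" "D \<notin> tangent_verts x"
      by blast
    have on: "E \<in> tangent_verts x" if E: "E \<in> K" "E \<noteq> D" for E
    proof (rule ccontr)
      assume nE: "E \<notin> tangent_verts x"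
      \<comment> \<open>A tangent line is determined by any two of its vertices.\<close>
      have off2: "\<not> concurrent P Q F" if "P \<in> tangent_verts x" "Q \<in> tangent_verts x" "P \<noteq> Q"
          "F \<notin> tangent_verts x" for P Q F
        using that tangent_verts_unique(2) x(1) unfolding concurrent_def by blast
      have two: "concurrent P D E \<or> concurrent Q D E"
        if "P \<in> tangent_verts x" "Q \<in> tangent_verts x" "P \<noteq> Q" "P \<in> K" "Q \<in> K" for P Q
      proof -
        have "distinct [P, Q, D, E]"
          using that E D nE by auto
        then show ?thesis
          using no_onan[OF K(1) that(4,5) D(1) E(1)] off2[OF that(1-3)] D(2) nE by blast
      qed
      have one: "\<not> (concurrent P D E \<and> concurrent Q D E)"
        if "P \<in> tangent_verts x" "Q \<in> tangent_verts x" "P \<noteq> Q" for P Q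
      proof
        assume "concurrent P D E \<and> concurrent Q D E"
        then obtain y z where y: "isotropic y" "P \<in> tangent_verts y" "D \<in> tangent_verts y"
            "E \<in> tangent_verts y"
          and z: "isotropic z" "Q \<in> tangent_verts z" "D \<in> tangent_verts z" "E \<in> tangent_verts z"
          unfolding concurrent_def by blast
        have "D \<noteq> E"
          using E(2) by blast
        then have "tangent_verts y = tangent_verts z"
          using tangent_verts_unique(2)[OF y(1) z(1), of D E] y z by blast
        then have "Q \<in> tangent_verts y"
          using z(2) by simp
        then have "tangent_verts x = tangent_verts y"
          using tangent_verts_unique(2)[OF x(1) y(1) that(3)] that y by blast
        then show False
          using y(3) D(2) by simp
      qed
      show False
        using two[of A B] two[of A C] two[of B C] one[of A B] one[of A C] one[of B C] ABC x by blast
    qed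
    have "D \<in> verts"
      using D K(1) by (auto simp: clique_def)
    have "K \<subseteq> insert D {Q \<in> tangent_verts x. adj D Q}"
    proof
      fix E assume E: "E \<in> K"
      show "E \<in> insert D {Q \<in> tangent_verts x. adj D Q}"
      proof (cases "E = D")
        case False
        then have "adj D E"
          using E D(1) K(1) unfolding clique_def by blast
        then show ?thesis
          using on[OF E False] by simp
      qed simp
    qed
    then have "card K \<le> card (insert D {Q \<in> tangent_verts x. adj D Q})"
      by (intro card_mono) auto
    also have "\<dots> \<le> Suc (card {Q \<in> tangent_verts x. adj D Q})"
      by (rule card_insert_le_m1) auto
    also have "\<dots> \<le> q + 2"
      using card_neighbours_on_tangent_verts[OF x(1) \<open>D \<in> verts\<close> D(2)] by simp
    finally show False
      using q2 K(2) by simp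
  qed
  moreover have "card K = card (tangent_verts x)"
    using card_tangent_verts x(1) K(2) by simp
  ultimately have "K = tangent_verts x"
    by (intro card_subset_eq) auto
  then show ?thesis
    using x(1) by blast
qed

lemma tangent_verts_clique: "isotropic x \<Longrightarrow> clique (tangent_verts x)"
  unfolding clique_def using tangent_verts_adj tangent_verts_subset_verts by blast

section \<open>Orthogonality of vertices in terms of the graph\<close>

text \<open>
  If two circles with distinct centres were equal, the \<open>q + 1 > 2\<close> elements of norm \<open>\<rho>\<close> would all be
  roots of one quadratic polynomial.
\<close>

lemma circle_centre_unique:
  assumes "\<And>a. (a + A) * bar (a + A) = \<rho> \<longleftrightarrow> (a + B) * bar (a + B) = \<sigma>"
    and "bar \<rho> = \<rho>" "\<rho> \<noteq> 0"
  shows "A = B"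
proof (rule ccontr)
  assume "A \<noteq> B"
  define e where "e = B - A"
  have "bar e \<noteq> 0"
    using \<open>A \<noteq> B\<close> by (simp add: e_def)
  let ?f = "[:\<rho> * e, \<rho> + e * bar e - \<sigma>, bar e:]"
  have "card {b. b * bar b = \<rho>} \<le> 2"
  proof (rule card_poly_eq_le[of ?f])
    show "degree ?f = 2" "?f \<noteq> 0"
      using \<open>bar e \<noteq> 0\<close> by simp_all
    fix b assume "b \<in> {b. b * bar b = \<rho>}"
    then have b: "b * bar b = \<rho>"
      by simp
    then have "(b - A + B) * bar (b - A + B) = \<sigma>"
      using assms(1)[of "b - A"] by simp
    moreover have "b - A + B = b + e"
      by (simp add: e_def)
    ultimately have "(b + e) * (bar b + bar e) = \<sigma>"
      by simp
    moreover have "poly ?f b = b * ((b + e) * (bar b + bar e) - \<sigma>) + (\<rho> - b * bar b) * (b + e)"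
      by (simp add: algebra_simps)
    ultimately show "poly ?f b = 0"
      using b by simp
  qed
  then show False
    using card_norm_eq[OF assms(2,3)] q_ge_2 by simp
qed

definition same_neighbours_on where
  "same_neighbours_on K P Q \<longleftrightarrow>
     P \<in> verts \<and> Q \<in> verts \<and> P \<notin> K \<and> Q \<notin> K \<and> (\<forall>R\<in>K. adj P R \<longleftrightarrow> adj Q R)"

text \<open>
  The neighbours of \<open>pt l\<close> on the tangent line form the circle with centre \<open>- h v l / h x l\<close>.  Equal
  centres mean that a combination of \<open>l\<close> and \<open>m\<close> is orthogonal to \<open>v\<close> as well as to \<open>x\<close>, hence a multiple
  of \<open>x\<close>.
\<close>

lemma same_neighbours_on_tangent_verts_imp:
  assumes x: "isotropic x" and nz: "h l l \<noteq> 0" "h m m \<noteq> 0"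
    and same: "same_neighbours_on (tangent_verts x) (pt l) (pt m)"
  shows "\<exists>k c. m = k *s l + c *s x"
proof -
  obtain v where v: "h v v \<noteq> 0" "h v x = 0" "tangent_verts x = (\<lambda>a. pt (v + a *s x)) ` UNIV"
    by (rule tangent_verts_parametrized[OF x], rule that)
  have xv: "h x v = 0"
    using v(2) h_eq_0_sym by blast
  have nzv: "h (v + a *s x) (v + a *s x) = h v v" for a
    using v xv x by (simp add: isotropic_def)
  have circle: "h x u \<noteq> 0 \<and> (adj (pt u) (pt (v + a *s x)) \<longleftrightarrow>
      (a + h v u / h x u) * bar (a + h v u / h x u) = h u u * h v v / (h x u * h u x))"
    if "h u u \<noteq> 0" "pt u \<notin> tangent_verts x" for u a
  proof -
    have ux: "h u x \<noteq> 0" "h x u \<noteq> 0"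
      using that h_eq_0_sym[of u x] by (auto simp: tangent_verts_def)
    have "pt (v + a *s x) \<in> tangent_verts x"
      unfolding v(3) by blast
    then have "pt u \<noteq> pt (v + a *s x)"
      using that(2) by metis
    then have "adj (pt u) (pt (v + a *s x)) \<longleftrightarrow> gram_zero u (v + a *s x)"
      using adj_pt_iff[of u "v + a *s x"] that(1) v(1) nzv by metis
    also have "\<dots> \<longleftrightarrow> h (v + a *s x) u * bar (h (v + a *s x) u) = h u u * h v v"
      unfolding gram_zero_def nzv bar_h by (simp only: mult.commute)
    also have "h (v + a *s x) u = h x u * (a + h v u / h x u)"
      using ux by (simp add: field_simps)
    also have "h x u * (a + h v u / h x u) * bar (h x u * (a + h v u / h x u)) =
        (a + h v u / h x u) * bar (a + h v u / h x u) * (h x u * h u x)"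
      by (simp only: bar_mult bar_h mult_ac)
    also have "(\<dots> = h u u * h v v) \<longleftrightarrow>
        (a + h v u / h x u) * bar (a + h v u / h x u) = h u u * h v v / (h x u * h u x)"
      using ux by (subst nonzero_eq_divide_eq) auto
    finally show ?thesis
      using ux by blast
  qed
  have notin: "pt l \<notin> tangent_verts x" "pt m \<notin> tangent_verts x"
    using same by (auto simp: same_neighbours_on_def)
  have adj_eq: "adj (pt l) (pt (v + a *s x)) \<longleftrightarrow> adj (pt m) (pt (v + a *s x))" for a
    using same unfolding same_neighbours_on_def v(3) by blast
  have lx: "h x l \<noteq> 0" and mx: "h x m \<noteq> 0"
    using circle nz notin by blast+
  have lx': "h l x \<noteq> 0" and mx': "h m x \<noteq> 0"
    using lx mx h_eq_0_sym by blast+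
  have centre: "h v l / h x l = h v m / h x m"
  proof (rule circle_centre_unique)
    show "(a + h v l / h x l) * bar (a + h v l / h x l) = h l l * h v v / (h x l * h l x) \<longleftrightarrow>
        (a + h v m / h x m) * bar (a + h v m / h x m) = h m m * h v v / (h x m * h m x)" for a
      using circle[OF nz(1) notin(1), of a] circle[OF nz(2) notin(2), of a] adj_eq[of a] by blast
  qed (use nz v(1) lx lx' in \<open>simp_all add: mult.commute\<close>)
  define d where "d = (1 / h l x) *s l - (1 / h m x) *s m"
  have "h v d = 0" "h x d = 0"
    using centre lx mx by (simp_all add: d_def)
  then have d: "h d v = 0" "h d x = 0"
    using h_eq_0_sym by blast+
  have "x \<noteq> 0" "h x x = 0"
    using x by (auto simp: isotropic_def)
  moreover have "v \<noteq> 0" "pt v \<noteq> pt x"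
    using v(1,2) nonisotropic_ne_0 orthogonal_nonisotropic_ne \<open>x \<noteq> 0\<close> by blast+
  ultimately obtain c where "d = c *s x"
    using orthogonal_to_pair_unique[of v x x d] d xv by blast
  then have "(1 / h m x) *s m = (1 / h l x) *s l - c *s x"
    by (simp add: d_def algebra_simps)
  then have "h m x *s ((1 / h m x) *s m) = h m x *s ((1 / h l x) *s l - c *s x)"
    by simp
  then have "m = (h m x / h l x) *s l + (- (h m x * c)) *s x"
    using mx' by (simp add: vec.scale_right_diff_distrib)
  then show ?thesis
    by blast
qed

text \<open>
  Up to the factor \<open>k\<close>, adding a multiple of \<open>x\<close> changes no inner product with vectors of the tangent
  line, and the condition on \<open>h m m\<close> keeps the radius of the circle.
\<close>

lemma same_neighbours_on_tangent_verts_if: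
  assumes x: "isotropic x" and nz: "h l l \<noteq> 0" "h l x \<noteq> 0" "k \<noteq> 0"
    and m: "m = k *s l + c *s x" "h m m = k * bar k * h l l"
  shows "same_neighbours_on (tangent_verts x) (pt l) (pt m)"
proof -
  have mm: "h m m \<noteq> 0"
    unfolding m(2) using nz by simp
  have mx: "h m x \<noteq> 0"
    using m(1) nz x by (simp add: isotropic_def)
  have notin: "pt l \<notin> tangent_verts x" "pt m \<notin> tangent_verts x"
    using nz mm mx pt_in_tangent_verts_iff nonisotropic_ne_0 by blast+
  have "adj (pt l) R \<longleftrightarrow> adj (pt m) R" if R: "R \<in> tangent_verts x" for R
  proof -
    obtain w where w: "R = pt w" "h w w \<noteq> 0" "h w x = 0"
      using R by (auto simp: tangent_verts_def)
    have "h x w = 0"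
      using w(3) h_eq_0_sym by blast
    then have "h m w = k * h l w" "h w m = bar k * h w l"
      using w(3) by (simp_all add: m(1))
    then have "gram_zero m w \<longleftrightarrow> (k * bar k) * (h l w * h w l) = (k * bar k) * (h l l * h w w)"
      unfolding gram_zero_def m(2) by (simp only: mult_ac)
    also have "\<dots> \<longleftrightarrow> gram_zero l w"
      unfolding gram_zero_def using nz(3) by simp
    finally have "gram_zero m w \<longleftrightarrow> gram_zero l w" .
    moreover have "pt l \<noteq> R" "pt m \<noteq> R"
      using notin R by blast+
    ultimately show ?thesis
      using adj_pt_iff[OF nz(1) w(2)] adj_pt_iff[OF mm w(2)] w(1) by blast
  qed
  then show ?thesis
    using notin nz mm by (simp add: same_neighbours_on_def)
qed

text \<open>
  In terms of an orthogonal basis \<open>s, t\<close> of the polar line, the vectors \<open>s + e t\<close> with a suitable norm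
  of \<open>e\<close> are isotropic, and two different \<open>e\<close> give non-orthogonal vectors.
\<close>

lemma hyperbolic_pair:
  assumes "h r r \<noteq> 0"
  obtains x y where "isotropic x" "isotropic y" "h x y = 1" "h x r = 0" "h y r = 0"
proof -
  obtain s t where st: "h s s \<noteq> 0" "h t t \<noteq> 0" "h r s = 0" "h r t = 0" "h s t = 0"
    using exists_orthogonal_basis[OF assms] by blast
  have sym: "h s r = 0" "h t r = 0" "h t s = 0"
    using st h_eq_0_sym by blast+
  obtain e f where ef: "e \<noteq> f" "e * bar e = - (h s s / h t t)" "f * bar f = - (h s s / h t t)"
    using exists_norm_two[of "- (h s s / h t t)"] st by auto
  define x where "x = s + e *s t"
  define y0 where "y0 = s + f *s t"
  have inner: "h (s + c *s t) (s + d *s t) = h s s + c * bar d * h t t" for c d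
    using st sym by simp
  have iso: "h x x = 0" "h y0 y0 = 0"
    unfolding x_def y0_def inner ef using st by simp_all
  have "x \<noteq> 0" "y0 \<noteq> 0"
  proof -
    have "h x s = h s s" "h y0 s = h s s"
      using sym by (simp_all add: x_def y0_def)
    then show "x \<noteq> 0" "y0 \<noteq> 0"
      using st(1) h_zero_left by metis+
  qed
  have ne: "h x y0 \<noteq> 0"
  proof
    assume "h x y0 = 0"
    then have "h x y0 = h x x"
      using iso by simp
    then have "e * bar f = e * bar e"
      unfolding x_def y0_def inner using st by simp
    moreover have "e \<noteq> 0"
      using ef(2) st by auto
    ultimately show False
      using ef(1) by simp
  qed
  then have ne': "h y0 x \<noteq> 0"
    using h_eq_0_sym by blast
  let ?y = "(1 / h y0 x) *s y0"
  have "isotropic x" "isotropic ?y" "h x ?y = 1" "h x r = 0" "h ?y r = 0"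
    using iso \<open>x \<noteq> 0\<close> \<open>y0 \<noteq> 0\<close> ne ne' sym by (simp_all add: isotropic_def) (simp_all add: x_def y0_def)
  then show ?thesis
    using that by blast
qed

lemma isotropic_pair_ne:
  assumes "isotropic x" "h x y \<noteq> 0"
  shows "pt x \<noteq> pt y"
proof
  assume "pt x = pt y"
  then obtain c where "c \<noteq> 0" "x = c *s y"
    using assms pt_eq_iff unfolding isotropic_def by blast
  then have "h x x = bar c * h x y"
    by simp
  then show False
    using assms \<open>c \<noteq> 0\<close> by (simp add: isotropic_def)
qed

text \<open>
  If the ratio of the coordinates of \<open>l\<close> in a hyperbolic pair \<open>x, y\<close> is fixed by \<open>bar\<close>, replace \<open>x\<close> by
  \<open>x + \<theta> y\<close> with \<open>\<theta>\<close> of trace zero.  In this situation \<open>h l l\<close> is twice a scalar, so the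
  characteristic is not 2, \<open>\<theta>\<close> is not fixed by \<open>bar\<close>, and neither is the new ratio.
\<close>

lemma hyperbolic_pair_generic:
  assumes r: "h r r \<noteq> 0" and l: "h l l \<noteq> 0" "h l r = 0"
  obtains x y a b where "isotropic x" "isotropic y" "h x y = 1" "h x r = 0" "h y r = 0"
    "l = a *s x + b *s y" "a * bar b \<noteq> bar a * b"
proof -
  obtain x y where xy: "isotropic x" "isotropic y" "h x y = 1" "h x r = 0" "h y r = 0"
    using hyperbolic_pair[OF r] by blast
  have yx: "h y x = 1"
    using xy(3) bar_1 bar_h by metis
  have "x \<noteq> 0" "y \<noteq> 0" "pt x \<noteq> pt y" "r \<noteq> 0"
    using xy r isotropic_pair_ne[of x y] nonisotropic_ne_0 by (auto simp: isotropic_def)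
  then obtain a b where ab: "l = a *s x + b *s y"
    using span_if_common_orthogonal[of x y r l] xy l(2) by blast
  show ?thesis
  proof (cases "a * bar b = bar a * b")
    case False
    then show ?thesis
      using that xy ab by blast
  next
    case True
    have "h l l = a * bar b + b * bar a"
      using xy yx by (simp add: ab isotropic_def)
    then have two: "a \<noteq> 0" "(1::'a) + 1 \<noteq> 0"
      using l(1) True by (auto simp: mult.commute)
    obtain c where c: "bar c \<noteq> c"
      using exists_not_fixed by blast
    \<comment> \<open>A non-zero scalar of trace zero.\<close>
    define \<theta> where "\<theta> = c - bar c"
    have \<theta>: "bar \<theta> = - \<theta>" "\<theta> \<noteq> 0"
      using c by (simp_all add: \<theta>_def)
    define x' where "x' = x + \<theta> *s y"
    have x': "h x' x' = 0" "h x' y = 1" "h x' r = 0"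
      using xy yx \<theta> by (simp_all add: x'_def isotropic_def)
    then have "isotropic x'"
      by (auto simp: isotropic_def)
    moreover have "l = a *s x' + (b - a * \<theta>) *s y"
      by (simp add: ab x'_def vec.scale_right_distrib vec.scale_left_diff_distrib)
    moreover have "a * bar (b - a * \<theta>) \<noteq> bar a * (b - a * \<theta>)"
    proof
      assume "a * bar (b - a * \<theta>) = bar a * (b - a * \<theta>)"
      \<comment> \<open>The equation for \<open>a\<close> and \<open>b\<close> cancels, and \<open>bar \<theta> = - \<theta>\<close> doubles the rest.\<close>
      then have "a * bar a * \<theta> * (1 + 1) = 0"
        using True \<theta>(1) by (simp add: algebra_simps)
      then show False
        using two \<theta>(2) by simp
    qed
    ultimately show ?thesis
      using that[of x' y a "b - a * \<theta>"] xy x' by blast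
  qed
qed

definition big_clique :: "('a ^ 3) set set \<Rightarrow> bool" where
  "big_clique K \<longleftrightarrow> clique K \<and> card K = q ^ 2"

lemma big_clique_tangent_verts: "isotropic x \<Longrightarrow> big_clique (tangent_verts x)"
  by (simp add: big_clique_def tangent_verts_clique card_tangent_verts)

text \<open>
  Orthogonality of two vertices in terms of the graph.  For \<open>q \<noteq> 2\<close> the cliques \<open>K, K'\<close> are tangent
  lines through \<open>R\<close>.
\<close>

definition perp :: "('a ^ 3) set \<Rightarrow> ('a ^ 3) set \<Rightarrow> bool" where
  "perp P R \<longleftrightarrow> (\<exists>K K' Q. big_clique K \<and> big_clique K' \<and> K \<noteq> K' \<and> R \<in> K \<and> R \<in> K' \<and>
     Q \<noteq> P \<and> same_neighbours_on K P Q \<and> same_neighbours_on K' P Q)"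

text \<open>
  Conjugating both coordinates of \<open>l\<close> in a hyperbolic pair \<open>x, y\<close> of the polar line of \<open>r\<close> changes neither
  \<open>h l l\<close> nor the norms of \<open>h l x\<close> and \<open>h l y\<close>.  So the conjugate vector has the same neighbours as \<open>l\<close> on
  both tangent lines, and it represents a different point when the ratio of the coordinates is not
  fixed by \<open>bar\<close>.
\<close>

lemma perp_if_orthogonal:
  assumes r: "h r r \<noteq> 0" and l: "h l l \<noteq> 0" "h l r = 0"
  shows "perp (pt l) (pt r)"
proof -
  obtain x y a b where xy: "isotropic x" "isotropic y" "h x y = 1" "h x r = 0" "h y r = 0"
    and ab: "l = a *s x + b *s y" "a * bar b \<noteq> bar a * b"
    by (rule hyperbolic_pair_generic[OF r l], rule that)
  have yx: "h y x = 1"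
    using xy(3) bar_1 bar_h by metis
  have iso: "h x x = 0" "h y y = 0"
    using xy by (auto simp: isotropic_def)
  define m where "m = bar a *s x + bar b *s y"
  have inner: "h (i *s x + j *s y) x = j" "h (i *s x + j *s y) y = i"
    "h (i *s x + j *s y) (i *s x + j *s y) = i * bar j + j * bar i" for i j
    using iso xy(3) yx by simp_all
  have mm: "h m m = h l l"
    unfolding m_def ab(1) inner by (simp add: mult.commute)
  have nz: "a \<noteq> 0" "b \<noteq> 0"
    using ab(2) by auto
  have "same_neighbours_on (tangent_verts x) (pt l) (pt m)"
  proof (rule same_neighbours_on_tangent_verts_if[OF xy(1) l(1)])
    show "h l x \<noteq> 0"
      unfolding ab(1) inner by (rule nz(2))
    show "bar b / b \<noteq> 0"
      using nz by simp
    show "m = (bar b / b) *s l + (bar a - bar b / b * a) *s x"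
      using nz by (simp add: m_def ab(1) vec.scale_right_distrib vec.scale_left_diff_distrib)
    show "h m m = bar b / b * bar (bar b / b) * h l l"
      using nz mm by simp
  qed
  moreover have "same_neighbours_on (tangent_verts y) (pt l) (pt m)"
  proof (rule same_neighbours_on_tangent_verts_if[OF xy(2) l(1)])
    show "h l y \<noteq> 0"
      unfolding ab(1) inner by (rule nz(1))
    show "bar a / a \<noteq> 0"
      using nz by simp
    show "m = (bar a / a) *s l + (bar b - bar a / a * b) *s y"
      using nz by (simp add: m_def ab(1) vec.scale_right_distrib vec.scale_left_diff_distrib)
    show "h m m = bar a / a * bar (bar a / a) * h l l"
      using nz mm by simp
  qed
  moreover have "tangent_verts x \<noteq> tangent_verts y"
    using tangent_verts_eq_iff[OF xy(1,2)] isotropic_pair_ne[OF xy(1)] xy(3) by simp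
  moreover have "pt r \<in> tangent_verts x" "pt r \<in> tangent_verts y"
    using r xy(4,5) h_eq_0_sym unfolding tangent_verts_def by blast+
  moreover have "pt m \<noteq> pt l"
  proof
    assume "pt m = pt l"
    then obtain c where c: "m = c *s l"
      using mm l(1) nonisotropic_ne_0 pt_eq_iff by metis
    have "h m x = c * h l x" "h m y = c * h l y"
      unfolding c by simp_all
    then have "bar b = c * b" "bar a = c * a"
      unfolding m_def ab(1) inner .
    then show False
      using ab(2) by simp
  qed
  ultimately show ?thesis
    unfolding perp_def using big_clique_tangent_verts[OF xy(1)]
      big_clique_tangent_verts[OF xy(2)] by blast
qed

text \<open>
  The lines joining \<open>l\<close> to the other vertex pass through both isotropic points, so that \<open>l\<close> is in the span
  of \<open>x\<close> and \<open>y\<close>, which are orthogonal to \<open>r\<close>.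
\<close>

lemma orthogonal_if_perp:
  assumes q: "q \<noteq> 2" and nz: "h l l \<noteq> 0" "h r r \<noteq> 0" and perp: "perp (pt l) (pt r)"
  shows "h l r = 0"
proof -
  obtain K K' Q where K: "big_clique K" "big_clique K'" "K \<noteq> K'" "pt r \<in> K" "pt r \<in> K'"
    and Q: "Q \<noteq> pt l" "same_neighbours_on K (pt l) Q" "same_neighbours_on K' (pt l) Q"
    using perp unfolding perp_def by blast
  obtain x where x: "isotropic x" "K = tangent_verts x"
    using big_clique_is_tangent_verts[OF q] K(1) unfolding big_clique_def by blast
  obtain y where y: "isotropic y" "K' = tangent_verts y"
    using big_clique_is_tangent_verts[OF q] K(2) unfolding big_clique_def by blast
  have "Q \<in> verts"
    using Q(2) unfolding same_neighbours_on_def by blast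
  then obtain m where m: "Q = pt m" "h m m \<noteq> 0"
    by (auto simp: verts_eq)
  obtain k c where kc: "m = k *s l + c *s x"
    using same_neighbours_on_tangent_verts_imp[OF x(1) nz(1) m(2)] Q(2) x(2) m(1) by blast
  obtain k' c' where kc': "m = k' *s l + c' *s y"
    using same_neighbours_on_tangent_verts_imp[OF y(1) nz(1) m(2)] Q(3) y(2) m(1) by blast
  have "h r x = 0" "h r y = 0"
    using K(4,5) x(2) y(2) nonisotropic_ne_0[OF nz(2)] by (auto simp: pt_in_tangent_verts_iff)
  then have o: "h x r = 0" "h y r = 0"
    using h_eq_0_sym by blast+
  have "h m r = k * h l r" "h m r = k' * h l r"
    using o by (simp add: kc, simp add: kc')
  then have eq: "k * h l r = k' * h l r"
    by metis
  show ?thesis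
  proof (cases "k = k'")
    case False
    then show ?thesis
      using eq by simp
  next
    case True
    then have cc: "c *s x = c' *s y"
      using kc kc' by simp
    have "c \<noteq> 0"
    proof
      assume "c = 0"
      then have "m = k *s l"
        using kc by simp
      then show False
        using pt_eqI[OF nonisotropic_ne_0[OF m(2)]] Q(1) m(1) by blast
    qed
    then have "x = (c' / c) *s y"
      using arg_cong[OF cc, of "\<lambda>z. (1 / c) *s z"] by simp
    then have "pt x = pt y"
      using pt_eqI x(1) unfolding isotropic_def by blast
    then show ?thesis
      using tangent_verts_eq_iff[OF x(1) y(1)] x(2) y(2) K(3) by simp
  qed
qed

lemma perp_iff:
  assumes "q \<noteq> 2" "h l l \<noteq> 0" "h r r \<noteq> 0"
  shows "perp (pt l) (pt r) \<longleftrightarrow> h l r = 0"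
  using orthogonal_if_perp perp_if_orthogonal assms by blast

end

section \<open>Orthogonality-preserving maps are semilinear\<close>

lemma image_pt_semilinear:
  assumes "bij \<sigma>" "\<And>c x. T (c *s x) = \<sigma> c *s T x"
  shows "T ` pt x = pt (T x)"
proof -
  have "T ` pt x = (\<lambda>c. \<sigma> c *s T x) ` UNIV"
    by (simp add: vec.span_singleton image_image assms(2))
  also have "\<dots> = (\<lambda>c. c *s T x) ` (\<sigma> ` UNIV)"
    by (simp only: image_image)
  also have "\<sigma> ` UNIV = UNIV"
    using assms(1) by (rule bij_is_surj)
  finally show ?thesis
    by (simp only: vec.span_singleton)
qed

text \<open>
  Orthogonality is a relation between vectors, so the hypothesis on the map of points speaks of all
  vectors representing a point and its image.
\<close>

locale orthogonality_map = hermitian_plane q h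
  for q :: nat and h :: "'a::{field,finite} ^ 3 \<Rightarrow> 'a ^ 3 \<Rightarrow> 'a" +
  fixes F :: "('a ^ 3) set \<Rightarrow> ('a ^ 3) set"
  assumes F_points: "P \<in> proj_points \<Longrightarrow> F P \<in> proj_points"
    and F_orthogonal: "x \<noteq> 0 \<Longrightarrow> y \<noteq> 0 \<Longrightarrow> X \<noteq> 0 \<Longrightarrow> Y \<noteq> 0 \<Longrightarrow> F (pt x) = pt X \<Longrightarrow> F (pt y) = pt Y \<Longrightarrow>
      h X Y = 0 \<longleftrightarrow> h x y = 0"
begin

definition maps_to :: "'a ^ 3 \<Rightarrow> 'a ^ 3 \<Rightarrow> bool" where
  "maps_to x X \<longleftrightarrow> x \<noteq> 0 \<and> X \<noteq> 0 \<and> F (pt x) = pt X"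

lemma maps_to_exists: "x \<noteq> 0 \<Longrightarrow> \<exists>X. maps_to x X"
  using F_points[of "pt x"] by (auto simp: maps_to_def proj_points_eq)

lemma maps_to_orthogonal: "maps_to x X \<Longrightarrow> maps_to y Y \<Longrightarrow> h X Y = 0 \<longleftrightarrow> h x y = 0"
  using F_orthogonal unfolding maps_to_def by blast

lemma maps_to_scale: "maps_to x X \<Longrightarrow> c \<noteq> 0 \<Longrightarrow> maps_to x (c *s X)"
  and maps_to_scale_arg: "maps_to x X \<Longrightarrow> c \<noteq> 0 \<Longrightarrow> maps_to (c *s x) X"
  by (auto simp: maps_to_def)

lemma maps_to_unique:
  assumes "maps_to x X" "maps_to x Y"
  shows "\<exists>c. c \<noteq> 0 \<and> Y = c *s X"
  using assms pt_eq_iff[of Y X] by (auto simp: maps_to_def)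

lemma pt_ne_if_orthogonal:
  assumes "U \<noteq> 0" "h U Z \<noteq> 0" "h V Z = 0"
  shows "pt U \<noteq> pt V"
proof
  assume "pt U = pt V"
  then obtain c where "U = c *s V"
    using assms(1) pt_eq_iff by blast
  then show False
    using assms by simp
qed

text \<open>
  Collinear points have a common orthogonal vector, and so have their images.  The vector \<open>Z\<close> serves to
  separate the images of \<open>u\<close> and \<open>v\<close>.
\<close>

lemma maps_to_collinear:
  assumes "maps_to u U" "maps_to v V" "maps_to (i *s u + j *s v) X" "h U Z \<noteq> 0" "h V Z = 0"
  shows "\<exists>a b. X = a *s U + b *s V"
proof -
  obtain w where w: "w \<noteq> 0" "h w u = 0" "h w v = 0"
    using exists_orthogonal by blast
  then obtain W where W: "maps_to w W"
    using maps_to_exists by blast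
  have "h u w = 0" "h v w = 0"
    using w h_eq_0_sym by blast+
  then have "h U W = 0" "h V W = 0" "h X W = 0"
    using maps_to_orthogonal[OF assms(1) W] maps_to_orthogonal[OF assms(2) W]
      maps_to_orthogonal[OF assms(3) W]
    by simp_all
  moreover have "U \<noteq> 0" "V \<noteq> 0" "W \<noteq> 0"
    using assms(1,2) W by (auto simp: maps_to_def)
  moreover from this have "pt U \<noteq> pt V"
    using pt_ne_if_orthogonal assms(4,5) by blast
  ultimately show ?thesis
    using span_if_common_orthogonal by blast
qed

end

text \<open>
  An orthogonal basis with unit points in the planes of \<open>e1, e2\<close> and \<open>e1, e3\<close>.  The images of the
  basis vectors are scaled such that the unit points are mapped to unit points.  Because the basis is
  orthogonal for \<open>h\<close>, the images are again an orthogonal basis, and a coordinate of a vector vanishes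
  iff the corresponding coordinate of its image vanishes.
\<close>

locale orthogonality_frame = orthogonality_map q h F
  for q :: nat and h :: "'a::{field,finite} ^ 3 \<Rightarrow> 'a ^ 3 \<Rightarrow> 'a" and F +
  fixes e1 e2 e3 f1 f2 f3
  assumes e_nz: "h e1 e1 \<noteq> 0" "h e2 e2 \<noteq> 0" "h e3 e3 \<noteq> 0"
    and e_orth: "h e1 e2 = 0" "h e1 e3 = 0" "h e2 e3 = 0"
    and maps_to_e: "maps_to e1 f1" "maps_to e2 f2" "maps_to e3 f3" "maps_to (e1 + e2) (f1 + f2)"
        "maps_to (e1 + e3) (f1 + f3)"
begin

lemma e_orth' [simp]: "h e1 e2 = 0" "h e1 e3 = 0" "h e2 e3 = 0" "h e2 e1 = 0" "h e3 e1 = 0" "h e3 e2 = 0"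
  using e_orth h_eq_0_sym by blast+

lemma f_nz: "h f1 f1 \<noteq> 0" "h f2 f2 \<noteq> 0" "h f3 f3 \<noteq> 0"
  using maps_to_orthogonal[OF maps_to_e(1,1)] maps_to_orthogonal[OF maps_to_e(2,2)]
    maps_to_orthogonal[OF maps_to_e(3,3)] e_nz
  by simp_all

lemma f_orth [simp]: "h f1 f2 = 0" "h f1 f3 = 0" "h f2 f3 = 0" "h f2 f1 = 0" "h f3 f1 = 0" "h f3 f2 = 0"
  using maps_to_orthogonal[OF maps_to_e(1,2)] maps_to_orthogonal[OF maps_to_e(1,3)]
    maps_to_orthogonal[OF maps_to_e(2,3)]
    h_eq_0_sym[of f1 f2] h_eq_0_sym[of f1 f3] h_eq_0_sym[of f2 f3]
  by simp_all

abbreviation e_comb where "e_comb a b c \<equiv> a *s e1 + b *s e2 + c *s e3"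
abbreviation f_comb where "f_comb a b c \<equiv> a *s f1 + b *s f2 + c *s f3"

lemma f_comb_inner: "h (f_comb a b c) f1 = a * h f1 f1" "h (f_comb a b c) f2 = b * h f2 f2"
  "h (f_comb a b c) f3 = c * h f3 f3"
  by simp_all

lemma e_comb_inner: "h (e_comb a b c) e1 = a * h e1 e1" "h (e_comb a b c) e2 = b * h e2 e2"
  "h (e_comb a b c) e3 = c * h e3 e3"
  by simp_all

lemma f_comb_eq_iff: "f_comb a b c = f_comb a' b' c' \<longleftrightarrow> a = a' \<and> b = b' \<and> c = c'"
proof
  assume "f_comb a b c = f_comb a' b' c'"
  then have "a * h f1 f1 = a' * h f1 f1" "b * h f2 f2 = b' * h f2 f2" "c * h f3 f3 = c' * h f3 f3"
    using f_comb_inner by metis+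
  then show "a = a' \<and> b = b' \<and> c = c'"
    using f_nz by simp
qed simp

lemma e_comb_eq_0_iff: "e_comb a b c = 0 \<longleftrightarrow> a = 0 \<and> b = 0 \<and> c = 0"
proof
  assume "e_comb a b c = 0"
  then have "a * h e1 e1 = 0" "b * h e2 e2 = 0" "c * h e3 e3 = 0"
    using e_comb_inner h_zero_left by metis+
  then show "a = 0 \<and> b = 0 \<and> c = 0"
    using e_nz by simp
qed simp

lemma e_expansion: "x = e_comb (h x e1 / h e1 e1) (h x e2 / h e2 e2) (h x e3 / h e3 e3)"
  by (rule orthogonal_basis_expansion[OF e_nz e_orth])

lemma f_expansion: "\<exists>a b c. X = f_comb a b c"
  using orthogonal_basis_expansion[OF f_nz f_orth(1-3)] by blast

lemma maps_to_comb_zero_iff: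
  assumes "maps_to (e_comb a b c) (f_comb i j k)"
  shows "i = 0 \<longleftrightarrow> a = 0" "j = 0 \<longleftrightarrow> b = 0" "k = 0 \<longleftrightarrow> c = 0"
  using maps_to_orthogonal[OF assms maps_to_e(1)] maps_to_orthogonal[OF assms maps_to_e(2)]
    maps_to_orthogonal[OF assms maps_to_e(3)]
    f_nz e_nz unfolding f_comb_inner e_comb_inner by simp_all

lemma maps_to_comb_exists:
  assumes "e_comb a b c \<noteq> 0"
  shows "\<exists>i j k. maps_to (e_comb a b c) (f_comb i j k)"
  using maps_to_exists[OF assms] f_expansion by metis

text \<open>
  Collinearity in coordinates.  The last assumption makes the images of the two spanning points distinct.
\<close>

lemma maps_to_comb_collinear:
  assumes "maps_to (e_comb a b c) (f_comb i j k)" "maps_to (e_comb a' b' c') (f_comb i' j' k')"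
    and "maps_to (e_comb (r * a + s * a') (r * b + s * b') (r * c + s * c')) (f_comb i'' j'' k'')"
    and "(a = 0 \<and> a' \<noteq> 0) \<or> (a \<noteq> 0 \<and> a' = 0) \<or> (b = 0 \<and> b' \<noteq> 0) \<or> (b \<noteq> 0 \<and> b' = 0) \<or>
      (c = 0 \<and> c' \<noteq> 0) \<or> (c \<noteq> 0 \<and> c' = 0)"
  shows "\<exists>x y. i'' = x * i + y * i' \<and> j'' = x * j + y * j' \<and> k'' = x * k + y * k'"
proof -
  have main: "\<exists>x y. i'' = x * i + y * i' \<and> j'' = x * j + y * j' \<and> k'' = x * k + y * k'"
    if 1: "maps_to (e_comb a b c) (f_comb i j k)" and 2: "maps_to (e_comb a' b' c') (f_comb i' j' k')"
      and 3: "maps_to (e_comb (r * a + s * a') (r * b + s * b') (r * c + s * c')) (f_comb i'' j'' k'')"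
      and 4: "(a \<noteq> 0 \<and> a' = 0) \<or> (b \<noteq> 0 \<and> b' = 0) \<or> (c \<noteq> 0 \<and> c' = 0)"
    for a b c i j k a' b' c' i' j' k' r s
  proof -
    have "e_comb (r * a + s * a') (r * b + s * b') (r * c + s * c') =
        r *s e_comb a b c + s *s e_comb a' b' c'"
      by (simp add: vec.scale_left_distrib vec.scale_right_distrib)
    with 3 have img3: "maps_to (r *s e_comb a b c + s *s e_comb a' b' c') (f_comb i'' j'' k'')"
      by simp
    have "\<exists>Z. h (f_comb i j k) Z \<noteq> 0 \<and> h (f_comb i' j' k') Z = 0"
    proof -
      have "(i \<noteq> 0 \<and> i' = 0) \<or> (j \<noteq> 0 \<and> j' = 0) \<or> (k \<noteq> 0 \<and> k' = 0)"
        using 4 maps_to_comb_zero_iff[OF 1] maps_to_comb_zero_iff[OF 2] by blast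
      then have "(i * h f1 f1 \<noteq> 0 \<and> i' * h f1 f1 = 0) \<or> (j * h f2 f2 \<noteq> 0 \<and> j' * h f2 f2 = 0) \<or>
          (k * h f3 f3 \<noteq> 0 \<and> k' * h f3 f3 = 0)"
        using f_nz by simp
      then show ?thesis
        unfolding f_comb_inner[of i j k, symmetric] f_comb_inner[of i' j' k', symmetric] by blast
    qed
    then obtain x y where "f_comb i'' j'' k'' = x *s f_comb i j k + y *s f_comb i' j' k'"
      using maps_to_collinear[OF 1 2 img3] by blast
    also have "\<dots> = f_comb (x * i + y * i') (x * j + y * j') (x * k + y * k')"
      by (simp add: vec.scale_left_distrib vec.scale_right_distrib)
    finally show ?thesis
      unfolding f_comb_eq_iff by blast
  qed
  show ?thesis
  proof (cases "(a \<noteq> 0 \<and> a' = 0) \<or> (b \<noteq> 0 \<and> b' = 0) \<or> (c \<noteq> 0 \<and> c' = 0)")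
    case True
    then show ?thesis
      using main[OF assms(1-3)] by blast
  next
    case False
    then have "(a' \<noteq> 0 \<and> a = 0) \<or> (b' \<noteq> 0 \<and> b = 0) \<or> (c' \<noteq> 0 \<and> c = 0)"
      using assms(4) by blast
    moreover have "maps_to (e_comb (s * a' + r * a) (s * b' + r * b) (s * c' + r * c)) (f_comb i'' j'' k'')"
      using assms(3) by (simp add: add.commute)
    ultimately obtain x y where "i'' = x * i' + y * i \<and> j'' = x * j' + y * j \<and> k'' = x * k' + y * k"
      using main[OF assms(2,1)] by blast
    then show ?thesis
      by (intro exI[of _ y] exI[of _ x]) (simp add: add.commute)
  qed
qed

lemma maps_to_comb_scale:
  assumes "maps_to x (f_comb i j k)" "c \<noteq> 0"
  shows "maps_to x (f_comb (c * i) (c * j) (c * k))"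
  using maps_to_scale[OF assms] by (simp add: vec.scale_right_distrib)

lemma maps_to_comb_scale_arg:
  assumes "maps_to (e_comb a b d) X" "c \<noteq> 0"
  shows "maps_to (e_comb (c * a) (c * b) (c * d)) X"
  using maps_to_scale_arg[OF assms] by (simp add: vec.scale_right_distrib)

lemma maps_to_comb_unique:
  assumes "maps_to x (f_comb i j k)" "maps_to x (f_comb i' j' k')"
  shows "\<exists>c. c \<noteq> 0 \<and> i' = c * i \<and> j' = c * j \<and> k' = c * k"
proof -
  obtain c where "c \<noteq> 0" "f_comb i' j' k' = c *s f_comb i j k"
    using maps_to_unique[OF assms] by blast
  moreover have "c *s f_comb i j k = f_comb (c * i) (c * j) (c * k)"
    by (simp add: vec.scale_right_distrib)
  ultimately show ?thesis
    using f_comb_eq_iff by auto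
qed

lemma maps_to_comb_affine:
  "\<exists>j k. maps_to (e_comb 1 b c) (f_comb 1 j k)"
proof -
  obtain i j k where maps_to: "maps_to (e_comb 1 b c) (f_comb i j k)"
    using maps_to_comb_exists[of 1 b c] e_comb_eq_0_iff[of 1 b c] by auto
  then have "i \<noteq> 0"
    using maps_to_comb_zero_iff(1)[OF maps_to] by simp
  then show ?thesis
    using maps_to_comb_scale[OF maps_to, of "1 / i"] by auto
qed

lemma maps_to_basis: "maps_to (e_comb 1 0 0) (f_comb 1 0 0)" "maps_to (e_comb 0 1 0) (f_comb 0 1 0)"
  "maps_to (e_comb 0 0 1) (f_comb 0 0 1)" "maps_to (e_comb 1 1 0) (f_comb 1 1 0)"
      "maps_to (e_comb 1 0 1) (f_comb 1 0 1)"
  using maps_to_e by simp_all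

lemma exists_\<sigma>: "\<exists>s. maps_to (e_comb 1 a 0) (f_comb 1 s 0)"
proof -
  obtain j k where maps_to: "maps_to (e_comb 1 a 0) (f_comb 1 j k)"
    using maps_to_comb_affine by blast
  then have "k = 0"
    using maps_to_comb_zero_iff(3)[OF maps_to] by blast
  then show ?thesis
    using maps_to by blast
qed

lemma exists_\<tau>: "\<exists>s. maps_to (e_comb 1 0 a) (f_comb 1 0 s)"
proof -
  obtain j k where maps_to: "maps_to (e_comb 1 0 a) (f_comb 1 j k)"
    using maps_to_comb_affine by blast
  then have "j = 0"
    using maps_to_comb_zero_iff(2)[OF maps_to] by blast
  then show ?thesis
    using maps_to by blast
qed

definition \<sigma> where "\<sigma> a = (SOME s. maps_to (e_comb 1 a 0) (f_comb 1 s 0))"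
definition \<tau> where "\<tau> a = (SOME s. maps_to (e_comb 1 0 a) (f_comb 1 0 s))"

lemma maps_to_\<sigma>: "maps_to (e_comb 1 a 0) (f_comb 1 (\<sigma> a) 0)"
  unfolding \<sigma>_def using exists_\<sigma> by (rule someI_ex)

lemma maps_to_\<tau>: "maps_to (e_comb 1 0 a) (f_comb 1 0 (\<tau> a))"
  unfolding \<tau>_def using exists_\<tau> by (rule someI_ex)

lemma \<sigma>_eq_0_iff: "\<sigma> a = 0 \<longleftrightarrow> a = 0"
  using maps_to_comb_zero_iff(2)[OF maps_to_\<sigma>] .

lemma \<tau>_eq_0_iff: "\<tau> a = 0 \<longleftrightarrow> a = 0"
  using maps_to_comb_zero_iff(3)[OF maps_to_\<tau>] .

lemma \<sigma>_1: "\<sigma> 1 = 1" and \<tau>_1: "\<tau> 1 = 1"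
  using maps_to_comb_unique[OF maps_to_\<sigma>[of 1] maps_to_basis(4)]
    maps_to_comb_unique[OF maps_to_\<tau>[of 1] maps_to_basis(5)]
  by simp_all

text \<open>
  The point is the intersection of the line joining \<open>e1 + a e2\<close> to \<open>e3\<close> and the line joining
  \<open>e1 + b e3\<close> to \<open>e2\<close>.
\<close>

lemma maps_to_affine: "maps_to (e_comb 1 a b) (f_comb 1 (\<sigma> a) (\<tau> b))"
proof -
  obtain j k where maps_to: "maps_to (e_comb 1 a b) (f_comb 1 j k)"
    using maps_to_comb_affine by blast
  have "\<exists>x y. 1 = x * 1 + y * 0 \<and> j = x * \<sigma> a + y * 0 \<and> k = x * 0 + y * 1"
    by (rule maps_to_comb_collinear[OF maps_to_\<sigma>[of a] maps_to_basis(3), of 1 b])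
        (use maps_to in simp_all)
  moreover have "\<exists>x y. 1 = x * 1 + y * 0 \<and> j = x * 0 + y * 1 \<and> k = x * \<tau> b + y * 0"
    by (rule maps_to_comb_collinear[OF maps_to_\<tau>[of b] maps_to_basis(2), of 1 a])
        (use maps_to in simp_all)
  ultimately have "j = \<sigma> a" "k = \<tau> b"
    by auto
  then show ?thesis
    using maps_to by simp
qed

text \<open>
  The point is the intersection of the line joining \<open>e1\<close> to \<open>e1 + a e2 + b e3\<close> and the line joining \<open>e2\<close>
  to \<open>e3\<close>.
\<close>

lemma maps_to_infinite:
  assumes "a \<noteq> 0 \<or> b \<noteq> 0"
  shows "maps_to (e_comb 0 a b) (f_comb 0 (\<sigma> a) (\<tau> b))"
proof -
  have "e_comb 0 a b \<noteq> 0"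
    unfolding e_comb_eq_0_iff using assms by simp
  then obtain i j k where maps_to: "maps_to (e_comb 0 a b) (f_comb i j k)"
    using maps_to_comb_exists by blast
  then have "i = 0"
    using maps_to_comb_zero_iff(1)[OF maps_to] by blast
  \<comment> \<open>The vector is the affine point minus \<open>e1\<close>.\<close>
  have "\<exists>x y. i = x * 1 + y * 1 \<and> j = x * \<sigma> a + y * 0 \<and> k = x * \<tau> b + y * 0"
    by (rule maps_to_comb_collinear[OF maps_to_affine[of a b] maps_to_basis(1), of 1 "- 1"])
        (use maps_to assms in simp_all)
  then obtain x where x: "j = x * \<sigma> a" "k = x * \<tau> b"
    by auto
  have "x \<noteq> 0"
    using maps_to x \<open>i = 0\<close> by (auto simp: maps_to_def)
  then show ?thesis
    using maps_to_comb_scale[OF maps_to, of "1 / x"] x \<open>i = 0\<close> by simp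
qed

text \<open>
  For \<open>a \<noteq> 0\<close> the vectors \<open>a e2 + a e3\<close> and \<open>e2 + e3\<close> represent the same point.
\<close>

lemma \<tau>_eq_\<sigma>: "\<tau> a = \<sigma> a"
proof (cases "a = 0")
  case True
  then show ?thesis
    using \<sigma>_eq_0_iff[of 0] \<tau>_eq_0_iff[of 0] by simp
next
  case False
  have "maps_to (e_comb 0 a a) (f_comb 0 1 1)"
    using maps_to_comb_scale_arg[OF maps_to_infinite[of 1 1] False] \<sigma>_1 \<tau>_1 by simp
  moreover have "maps_to (e_comb 0 a a) (f_comb 0 (\<sigma> a) (\<tau> a))"
    using maps_to_infinite False by blast
  ultimately show ?thesis
    using maps_to_comb_unique by fastforce
qed

text \<open>
  The point \<open>e1 + (a + b) e2 + e3\<close> is on the line joining \<open>e1 + a e2\<close> to \<open>b e2 + e3\<close>.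
\<close>

lemma \<sigma>_add: "\<sigma> (a + b) = \<sigma> a + \<sigma> b"
proof -
  have 1: "maps_to (e_comb 0 b 1) (f_comb 0 (\<sigma> b) 1)"
    using maps_to_infinite[of b 1] \<tau>_1 by simp
  have 2: "maps_to (e_comb 1 (a + b) 1) (f_comb 1 (\<sigma> (a + b)) 1)"
    using maps_to_affine[of "a + b" 1] \<tau>_1 by simp
  have "\<exists>x y. 1 = x * 1 + y * 0 \<and> \<sigma> (a + b) = x * \<sigma> a + y * \<sigma> b \<and> 1 = x * 0 + y * 1"
    by (rule maps_to_comb_collinear[OF maps_to_\<sigma>[of a] 1, of 1 1]) (use 2 in simp_all)
  then show ?thesis
    by auto
qed

text \<open>
  The vectors \<open>b a e2 + b e3\<close> and \<open>a e2 + e3\<close> represent the same point.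
\<close>

lemma \<sigma>_mult: "\<sigma> (a * b) = \<sigma> a * \<sigma> b"
proof (cases "b = 0")
  case True
  then show ?thesis
    using \<sigma>_eq_0_iff[of 0] by simp
next
  case False
  have "maps_to (e_comb 0 (b * a) b) (f_comb 0 (\<sigma> a) 1)"
    using maps_to_comb_scale_arg[OF maps_to_infinite[of a 1] False] \<tau>_1 by simp
  moreover have "maps_to (e_comb 0 (b * a) b) (f_comb 0 (\<sigma> (b * a)) (\<sigma> b))"
    using maps_to_infinite[of "b * a" b] False \<tau>_eq_\<sigma> by simp
  ultimately have "\<sigma> (b * a) = \<sigma> b * \<sigma> a"
    using maps_to_comb_unique by fastforce
  then show ?thesis
    by (simp add: mult.commute)
qed

lemma \<sigma>_inj: "\<sigma> a = \<sigma> b \<longleftrightarrow> a = b"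
proof
  assume "\<sigma> a = \<sigma> b"
  moreover have "\<sigma> a = \<sigma> (a - b) + \<sigma> b"
    using \<sigma>_add[of "a - b" b] by simp
  ultimately show "a = b"
    using \<sigma>_eq_0_iff[of "a - b"] by simp
qed simp

lemma bij_\<sigma>: "bij \<sigma>"
  using \<sigma>_inj finite_UNIV_inj_surj[of \<sigma>] by (auto simp: bij_def inj_def)

definition T where
  "T x = f_comb (\<sigma> (h x e1 / h e1 e1)) (\<sigma> (h x e2 / h e2 e2)) (\<sigma> (h x e3 / h e3 e3))"

lemma T_add: "T (x + y) = T x + T y"
  unfolding T_def by (simp add: add_divide_distrib \<sigma>_add vec.scale_left_distrib)

lemma T_scale: "T (c *s x) = \<sigma> c *s T x"
  unfolding T_def h_scale_left times_divide_eq_right[symmetric] \<sigma>_mult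
  by (simp add: vec.scale_right_distrib)

lemma T_inj: "T x = T y \<Longrightarrow> x = y"
proof -
  assume "T x = T y"
  then have "h x e1 / h e1 e1 = h y e1 / h e1 e1" "h x e2 / h e2 e2 = h y e2 / h e2 e2"
    "h x e3 / h e3 e3 = h y e3 / h e3 e3"
    unfolding T_def f_comb_eq_iff \<sigma>_inj by blast+
  then show "x = y"
    using e_expansion[of x] e_expansion[of y] by metis
qed

lemma semilinear_T: "semilinear_bij \<sigma> T"
proof -
  have "bij T"
    using T_inj finite_UNIV_inj_surj[of T] by (auto simp: bij_def inj_def)
  then show ?thesis
    using bij_\<sigma> \<sigma>_add \<sigma>_mult T_add T_scale by (simp add: semilinear_bij_def field_automorphism_def)
qed

lemma maps_to_T:
  assumes "x \<noteq> 0"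
  shows "maps_to x (T x)"
proof -
  define a b c where abc: "a = h x e1 / h e1 e1" "b = h x e2 / h e2 e2" "c = h x e3 / h e3 e3"
  have x: "x = e_comb a b c"
    unfolding abc by (rule e_expansion)
  have Tx: "T x = f_comb (\<sigma> a) (\<sigma> b) (\<sigma> c)"
    by (simp add: T_def abc)
  show ?thesis
  proof (cases "a = 0")
    case True
    then have "b \<noteq> 0 \<or> c \<noteq> 0"
      using assms x by auto
    then have "maps_to (e_comb 0 b c) (f_comb 0 (\<sigma> b) (\<sigma> c))"
      using maps_to_infinite \<tau>_eq_\<sigma> by simp
    then show ?thesis
      unfolding x[unfolded True] using Tx True \<sigma>_eq_0_iff[of 0] x by simp
  next
    case False
    have "maps_to (e_comb (a * 1) (a * (b / a)) (a * (c / a)))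
        (f_comb (\<sigma> a * 1) (\<sigma> a * \<sigma> (b / a)) (\<sigma> a * \<tau> (c / a)))"
      using maps_to_comb_scale[OF maps_to_comb_scale_arg[OF maps_to_affine False]] False
        \<sigma>_eq_0_iff by blast
    then show ?thesis
      using False unfolding \<tau>_eq_\<sigma> \<sigma>_mult[symmetric] Tx x[symmetric] by (simp flip: x)
  qed
qed

lemma F_eq_image:
  assumes "P \<in> proj_points"
  shows "F P = T ` P"
proof -
  obtain x where x: "x \<noteq> 0" "P = pt x"
    using assms by (auto simp: proj_points_eq)
  have "F P = pt (T x)"
    using maps_to_T[OF x(1)] x(2) by (simp add: maps_to_def)
  also have "\<dots> = T ` P"
    unfolding x(2) using bij_\<sigma> T_scale by (rule image_pt_semilinear[symmetric])
  finally show ?thesis .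
qed

end

context orthogonality_map
begin

lemma exists_nonisotropic: "\<exists>r. h r r \<noteq> 0"
proof -
  obtain x :: "'a ^ 3" where "x \<noteq> 0"
    using exists_orthogonal by blast
  then show ?thesis
    by (cases "h x x = 0") (use tangent_complement in blast)+
qed

lemma maps_to_unit_point:
  assumes "maps_to e f" "maps_to e' f'" "h e e \<noteq> 0" "h e' e' \<noteq> 0" "h e e' = 0"
  shows "\<exists>c. c \<noteq> 0 \<and> maps_to (e + e') (f + c *s f')"
proof -
  have "h f f \<noteq> 0" "h f' f' \<noteq> 0" "h f f' = 0"
    using assms maps_to_orthogonal by blast+
  moreover from this have "h f' f = 0"
    using h_eq_0_sym by blast
  moreover have "h e' e = 0"
    using assms h_eq_0_sym by blast
  have "e + e' \<noteq> 0"
  proof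
    assume "e + e' = 0"
    then have "h (e + e') e = 0"
      by simp
    then show False
      using assms \<open>h e' e = 0\<close> by simp
  qed
  then obtain X where X: "maps_to (e + e') X"
    using maps_to_exists by blast
  then obtain a b where ab: "X = a *s f + b *s f'"
    using maps_to_collinear[OF assms(1,2), of 1 1 X f] \<open>h f f \<noteq> 0\<close> \<open>h f' f = 0\<close> by auto
  have "h X f \<noteq> 0" "h X f' \<noteq> 0"
    using maps_to_orthogonal[OF X assms(1)] maps_to_orthogonal[OF X assms(2)] assms(3-5)
      \<open>h e' e = 0\<close> by simp_all
  then have "a \<noteq> 0" "b \<noteq> 0"
    using ab \<open>h f f' = 0\<close> \<open>h f' f = 0\<close> by auto
  have "maps_to (e + e') ((1 / a) *s X)"
    using maps_to_scale[OF X] \<open>a \<noteq> 0\<close> by simp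
  moreover have "(1 / a) *s X = f + (b / a) *s f'"
    using \<open>a \<noteq> 0\<close> by (simp add: ab vec.scale_right_distrib)
  ultimately show ?thesis
    using \<open>a \<noteq> 0\<close> \<open>b \<noteq> 0\<close> by (intro exI[of _ "b / a"]) simp
qed

theorem semilinear: "\<exists>\<sigma> T. semilinear_bij \<sigma> T \<and> (\<forall>P\<in>proj_points. F P = T ` P)"
proof -
  obtain e1 where e1: "h e1 e1 \<noteq> 0"
    using exists_nonisotropic by blast
  obtain e2 e3 where e: "h e2 e2 \<noteq> 0" "h e3 e3 \<noteq> 0" "h e1 e2 = 0" "h e1 e3 = 0" "h e2 e3 = 0"
    using exists_orthogonal_basis[OF e1] by blast
  obtain f1 where f1: "maps_to e1 f1"
    using maps_to_exists[OF nonisotropic_ne_0[OF e1]] by blast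
  obtain g2 where g2: "maps_to e2 g2"
    using maps_to_exists[OF nonisotropic_ne_0[OF e(1)]] by blast
  obtain g3 where g3: "maps_to e3 g3"
    using maps_to_exists[OF nonisotropic_ne_0[OF e(2)]] by blast
  obtain c where c: "c \<noteq> 0" "maps_to (e1 + e2) (f1 + c *s g2)"
    using maps_to_unit_point[OF f1 g2 e1 e(1,3)] by blast
  obtain d where d: "d \<noteq> 0" "maps_to (e1 + e3) (f1 + d *s g3)"
    using maps_to_unit_point[OF f1 g3 e1 e(2,4)] by blast
  interpret orthogonality_frame q h F e1 e2 e3 f1 "c *s g2" "d *s g3"
    using e1 e f1 maps_to_scale[OF g2 c(1)] maps_to_scale[OF g3 d(1)] c(2) d(2) by unfold_locales
  show ?thesis
    using semilinear_T F_eq_image by blast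
qed

end

section \<open>Extending graph automorphisms to collineations\<close>

text \<open>
  The inverse of a bijective homomorphism is a homomorphism, because the product of two preimages lies in
  the domain again and is therefore the preimage of the product.
\<close>

lemma is_iso_if_bij_hom:
  assumes hom: "\<Phi> \<in> hom H G" and bij: "bij_betw \<Phi> (carrier H) (carrier G)"
    and closed: "\<And>x y. x \<in> carrier H \<Longrightarrow> y \<in> carrier H \<Longrightarrow> x \<otimes>\<^bsub>H\<^esub> y \<in> carrier H"
  shows "G \<cong> H"
proof -
  let ?\<Psi> = "inv_into (carrier H) \<Phi>"
  have bij': "bij_betw ?\<Psi> (carrier G) (carrier H)"
    using bij by (rule bij_betw_inv_into)
  have "?\<Psi> (a \<otimes>\<^bsub>G\<^esub> b) = ?\<Psi> a \<otimes>\<^bsub>H\<^esub> ?\<Psi> b" if "a \<in> carrier G" "b \<in> carrier G" for a b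
  proof -
    have ab: "?\<Psi> a \<in> carrier H" "?\<Psi> b \<in> carrier H"
      using bij_betw_apply[OF bij'] that by auto
    then have "\<Phi> (?\<Psi> a \<otimes>\<^bsub>H\<^esub> ?\<Psi> b) = \<Phi> (?\<Psi> a) \<otimes>\<^bsub>G\<^esub> \<Phi> (?\<Psi> b)"
      using hom by (simp add: hom_def)
    also have "\<dots> = a \<otimes>\<^bsub>G\<^esub> b"
      using that bij by (simp add: bij_betw_inv_into_right)
    finally have "?\<Psi> (\<Phi> (?\<Psi> a \<otimes>\<^bsub>H\<^esub> ?\<Psi> b)) = ?\<Psi> (a \<otimes>\<^bsub>G\<^esub> b)"
      by simp
    then show ?thesis
      using bij_betw_inv_into_left[OF bij closed[OF ab]] by simp
  qed
  then have "?\<Psi> \<in> hom G H"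
    using bij' by (auto simp: hom_def bij_betw_apply)
  then show ?thesis
    using bij' by (auto simp: is_iso_def Group.iso_def)
qed

lemma bij_betw_finite_endo:
  assumes "finite A" "f ` A \<subseteq> A" "inj_on f A"
  shows "bij_betw f A A"
  using endo_inj_surj[OF assms] assms(3) by (simp add: bij_betw_def)

lemma semilinear_span_pair:
  fixes T :: "'a::field ^ 'n \<Rightarrow> 'a ^ 'n"
  assumes "semilinear_bij \<sigma> T"
  shows "T ` vec.span {u, v} = vec.span {T u, T v}"
proof -
  have T: "\<And>x y. T (x + y) = T x + T y" "\<And>c x. T (c *s x) = \<sigma> c *s T x" and \<sigma>: "bij \<sigma>"
    using assms by (auto simp: semilinear_bij_def field_automorphism_def)
  have span: "vec.span {a, b} = {i *s a + j *s b | i j. True}" for a b :: "'a ^ 'n"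
    using mem_span_pair[of _ a b] by auto
  show ?thesis
    unfolding span
  proof (intro equalityI subsetI)
    fix z assume "z \<in> T ` {i *s u + j *s v | i j. True}"
    then obtain i j where "z = T (i *s u + j *s v)"
      by blast
    then have "z = \<sigma> i *s T u + \<sigma> j *s T v"
      using T by simp
    then show "z \<in> {i *s T u + j *s T v | i j. True}"
      by blast
  next
    fix z assume "z \<in> {i *s T u + j *s T v | i j. True}"
    then obtain i j where z: "z = i *s T u + j *s T v"
      by blast
    obtain i' j' where "i = \<sigma> i'" "j = \<sigma> j'"
      using \<sigma> by (meson bij_pointE)
    then have "z = T (i' *s u + j' *s v)"
      using T z by simp
    then show "z \<in> T ` {i *s u + j *s v | i j. True}"
      by blast
  qed
qed

context hermitian_plane
begin

definition graph_auto :: "(('a ^ 3) set \<Rightarrow> ('a ^ 3) set) \<Rightarrow> bool" where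
  "graph_auto f \<longleftrightarrow> bij_betw f verts verts \<and> (\<forall>P\<in>verts. \<forall>Q\<in>verts. adj (f P) (f Q) \<longleftrightarrow> adj P Q)"

lemma carrier_graph_AutGroup:
  "carrier (graph_AutGroup (NU3 h)) = {f \<in> extensional verts. graph_auto f}"
  unfolding graph_AutGroup_def graph_auto_def adj_def
  by (auto simp: NU3_def verts_def Let_def Bij_def)

lemma mult_graph_AutGroup:
  assumes "f \<in> carrier (graph_AutGroup (NU3 h))" "g \<in> carrier (graph_AutGroup (NU3 h))"
  shows "f \<otimes>\<^bsub>graph_AutGroup (NU3 h)\<^esub> g = compose verts f g"
proof -
  have "f \<in> Bij verts" "g \<in> Bij verts"
    using assms by (auto simp: carrier_graph_AutGroup graph_auto_def Bij_def)
  then show ?thesis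
    by (simp add: graph_AutGroup_def NU3_def Let_def verts_def[symmetric] BijGroup_def)
qed

lemma graph_auto_in_verts: "graph_auto f \<Longrightarrow> P \<in> verts \<Longrightarrow> f P \<in> verts"
  by (auto simp: graph_auto_def bij_betw_apply)

lemma graph_auto_eq_iff: "graph_auto f \<Longrightarrow> P \<in> verts \<Longrightarrow> Q \<in> verts \<Longrightarrow> f P = f Q \<longleftrightarrow> P = Q"
  by (auto simp: graph_auto_def bij_betw_def inj_on_eq_iff)

lemma graph_auto_inj_on: "graph_auto f \<Longrightarrow> inj_on f verts"
  by (auto simp: graph_auto_def bij_betw_def)

lemma graph_auto_adj: "graph_auto f \<Longrightarrow> P \<in> verts \<Longrightarrow> Q \<in> verts \<Longrightarrow> adj (f P) (f Q) \<longleftrightarrow> adj P Q"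
  by (auto simp: graph_auto_def)

lemma graph_auto_inv:
  assumes "graph_auto f"
  shows "graph_auto (inv_into verts f)"
proof -
  have bij: "bij_betw f verts verts"
    using assms by (simp add: graph_auto_def)
  have "adj (inv_into verts f P) (inv_into verts f Q) \<longleftrightarrow> adj P Q" if "P \<in> verts" "Q \<in> verts" for P Q
  proof -
    have "inv_into verts f P \<in> verts" "inv_into verts f Q \<in> verts"
      using bij_betw_apply[OF bij_betw_inv_into[OF bij]] that by auto
    then show ?thesis
      using graph_auto_adj[OF assms, of "inv_into verts f P" "inv_into verts f Q"]
        bij_betw_inv_into_right[OF bij] that by simp
  qed
  then show ?thesis
    using bij_betw_inv_into[OF bij] by (simp add: graph_auto_def)
qed

lemma graph_auto_big_clique:
  assumes f: "graph_auto f" and K: "big_clique K"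
  shows "big_clique (f ` K)"
proof -
  have KV: "K \<subseteq> verts"
    using K by (simp add: big_clique_def clique_def)
  have maps_to_adj: "adj (f P) (f Q)" if "P \<in> K" "Q \<in> K" "f P \<noteq> f Q" for P Q
  proof -
    have "adj P Q"
      using K that by (auto simp: big_clique_def clique_def)
    moreover have "P \<in> verts" "Q \<in> verts"
      using KV that by auto
    ultimately show ?thesis
      using graph_auto_adj[OF f, of P Q] by simp
  qed
  have "f ` K \<subseteq> verts"
    using graph_auto_in_verts[OF f] KV by blast
  moreover have "card (f ` K) = card K"
    using graph_auto_inj_on[OF f] KV by (meson card_image inj_on_subset)
  ultimately show ?thesis
    using K maps_to_adj by (auto simp: big_clique_def clique_def)
qed

lemma graph_auto_same_neighbours_on:
  assumes f: "graph_auto f" and K: "K \<subseteq> verts" and same: "same_neighbours_on K P Q"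
  shows "same_neighbours_on (f ` K) (f P) (f Q)"
proof -
  have PQ: "P \<in> verts" "Q \<in> verts" "P \<notin> K" "Q \<notin> K" "\<And>R. R \<in> K \<Longrightarrow> adj P R \<longleftrightarrow> adj Q R"
    using same by (auto simp: same_neighbours_on_def)
  have "f P \<notin> f ` K" "f Q \<notin> f ` K"
    using PQ(1-4) K inj_on_image_mem_iff[OF graph_auto_inj_on[OF f]] by blast+
  moreover have "adj (f P) (f R) \<longleftrightarrow> adj (f Q) (f R)" if "R \<in> K" for R
    using PQ graph_auto_adj[OF f] K that by blast
  ultimately show ?thesis
    using graph_auto_in_verts[OF f] PQ by (simp add: same_neighbours_on_def)
qed

lemma graph_auto_perp:
  assumes f: "graph_auto f" and V: "P \<in> verts" "R \<in> verts" and perp: "perp P R"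
  shows "perp (f P) (f R)"
proof -
  obtain K K' Q where K: "big_clique K" "big_clique K'" "K \<noteq> K'" "R \<in> K" "R \<in> K'"
    and Q: "Q \<noteq> P" "same_neighbours_on K P Q" "same_neighbours_on K' P Q"
    using perp unfolding perp_def by blast
  have KV: "K \<subseteq> verts" "K' \<subseteq> verts"
    using K by (auto simp: big_clique_def clique_def)
  have "f ` K \<noteq> f ` K'"
    using inj_on_image_eq_iff[OF graph_auto_inj_on[OF f] KV] K(3) by simp
  moreover have "Q \<in> verts"
    using Q(2) by (simp add: same_neighbours_on_def)
  then have "f Q \<noteq> f P"
    using graph_auto_eq_iff[OF f] Q(1) V(1) by simp
  ultimately show ?thesis
    unfolding perp_def
    using graph_auto_big_clique[OF f K(1)] graph_auto_big_clique[OF f K(2)] K(4,5)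
      graph_auto_same_neighbours_on[OF f KV(1) Q(2)] graph_auto_same_neighbours_on[OF f KV(2) Q(3)]
    by blast
qed

lemma graph_auto_perp_iff:
  assumes f: "graph_auto f" and V: "P \<in> verts" "R \<in> verts"
  shows "perp (f P) (f R) \<longleftrightarrow> perp P R"
proof
  assume "perp (f P) (f R)"
  then have "perp (inv_into verts f (f P)) (inv_into verts f (f R))"
    using graph_auto_perp[OF graph_auto_inv[OF f]] graph_auto_in_verts[OF f] V by blast
  then show "perp P R"
    using inv_into_f_f[OF graph_auto_inj_on[OF f]] V by simp
qed (rule graph_auto_perp[OF assms])

text \<open>
  An isotropic point is sent to the isotropic point whose tangent line is the image of its tangent line.
  The image of an isotropic point is left to \<open>SOME\<close> until \<open>extend_isotropic\<close> shows that it exists.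
\<close>

definition extend_to_points :: "(('a ^ 3) set \<Rightarrow> ('a ^ 3) set) \<Rightarrow> ('a ^ 3) set \<Rightarrow> ('a ^ 3) set" where
  "extend_to_points f P = (if P \<in> verts then f P
     else SOME R. \<exists>x y. P = pt x \<and> R = pt y \<and> isotropic x \<and> isotropic y \<and>
         tangent_verts y = f ` tangent_verts x)"

lemma extend_isotropic:
  assumes q: "q \<noteq> 2" and f: "graph_auto f" and x: "isotropic x"
  shows "\<exists>y. isotropic y \<and> extend_to_points f (pt x) = pt y \<and> tangent_verts y = f ` tangent_verts x"
proof -
  let ?R = "\<lambda>R. \<exists>x' y. pt x = pt x' \<and> R = pt y \<and> isotropic x' \<and> isotropic y \<and>
      tangent_verts y = f ` tangent_verts x'"
  obtain y where y: "isotropic y" "f ` tangent_verts x = tangent_verts y"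
    using big_clique_is_tangent_verts[OF q] graph_auto_big_clique[OF f big_clique_tangent_verts[OF x]]
    unfolding big_clique_def by blast
  then have "?R (pt y)"
    using x by metis
  then have "?R (SOME R. ?R R)"
    by (rule someI)
  moreover have "pt x \<notin> verts"
    using x pt_in_hermitian_variety[of x] by (simp add: verts_def isotropic_def)
  ultimately obtain x' y where "pt x = pt x'" "extend_to_points f (pt x) = pt y" "isotropic x'"
      "isotropic y"
      "tangent_verts y = f ` tangent_verts x'"
    by (auto simp: extend_to_points_def)
  moreover from this have "tangent_verts x' = tangent_verts x"
    using tangent_verts_eq_iff[OF _ x] by simp
  ultimately show ?thesis
    by auto
qed

lemma extend_isotropic':
  assumes "q \<noteq> 2" "graph_auto f" "isotropic x" "X \<noteq> 0" "extend_to_points f (pt x) = pt X"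
  shows "isotropic X" "tangent_verts X = f ` tangent_verts x"
proof -
  obtain y where y: "isotropic y" "pt X = pt y" "tangent_verts y = f ` tangent_verts x"
    using extend_isotropic[OF assms(1-3)] assms(5) by auto
  obtain c where "c \<noteq> 0" "X = c *s y"
    using y(2) assms(4) pt_eq_iff by blast
  then show "isotropic X" "tangent_verts X = f ` tangent_verts x"
    using y tangent_verts_scale by (simp_all add: isotropic_def)
qed

lemma extend_nonisotropic:
  assumes "graph_auto f" "h x x \<noteq> 0" "X \<noteq> 0" "extend_to_points f (pt x) = pt X"
  shows "h X X \<noteq> 0" "pt X = f (pt x)"
proof -
  show X: "pt X = f (pt x)"
    using assms by (simp add: extend_to_points_def)
  then have "pt X \<in> verts"
    using assms graph_auto_in_verts by simp
  then show "h X X \<noteq> 0"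
    using assms(3) pt_in_hermitian_variety by (simp add: verts_def)
qed

lemma isotropic_orthogonal_iff:
  assumes "isotropic x" "isotropic y"
  shows "h x y = 0 \<longleftrightarrow> tangent_verts x = tangent_verts y"
proof -
  have "h x y = 0 \<longleftrightarrow> pt x = pt y"
    using assms isotropic_orthogonal_imp_eq isotropic_pair_ne unfolding isotropic_def by metis
  then show ?thesis
    using tangent_verts_eq_iff[OF assms] by simp
qed

lemma extend_orthogonal:
  assumes q: "q \<noteq> 2" and f: "graph_auto f" and nz: "x \<noteq> 0" "y \<noteq> 0" "X \<noteq> 0" "Y \<noteq> 0"
    and ext: "extend_to_points f (pt x) = pt X" "extend_to_points f (pt y) = pt Y"
  shows "h X Y = 0 \<longleftrightarrow> h x y = 0"
proof -
  have mixed: "h X Y = 0 \<longleftrightarrow> h x y = 0"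
    if x: "h x x \<noteq> 0" and y: "h y y = 0" and nz: "x \<noteq> 0" "y \<noteq> 0" "X \<noteq> 0" "Y \<noteq> 0"
      and ext: "extend_to_points f (pt x) = pt X" "extend_to_points f (pt y) = pt Y" for x y X Y
  proof -
    have iy: "isotropic y"
      using y nz by (simp add: isotropic_def)
    note X = extend_nonisotropic[OF f x nz(3) ext(1)]
    note Y = extend_isotropic'[OF q f iy nz(4) ext(2)]
    have "h X Y = 0 \<longleftrightarrow> pt X \<in> tangent_verts Y"
      using X(1) pt_in_tangent_verts_iff[OF nz(3)] by simp
    also have "\<dots> \<longleftrightarrow> f (pt x) \<in> f ` tangent_verts y"
      using X(2) Y(2) by simp
    also have "\<dots> \<longleftrightarrow> pt x \<in> tangent_verts y"
      using inj_on_image_mem_iff[OF graph_auto_inj_on[OF f]] tangent_verts_subset_verts x by simp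
    also have "\<dots> \<longleftrightarrow> h x y = 0"
      using x pt_in_tangent_verts_iff[OF nz(1)] by simp
    finally show ?thesis .
  qed
  consider "h x x \<noteq> 0" "h y y \<noteq> 0" | "h x x \<noteq> 0" "h y y = 0" | "h x x = 0" "h y y \<noteq> 0"
    | "isotropic x" "isotropic y"
    using nz unfolding isotropic_def by blast
  then show ?thesis
  proof cases
    case 1
    note X = extend_nonisotropic[OF f 1(1) nz(3) ext(1)]
      and Y = extend_nonisotropic[OF f 1(2) nz(4) ext(2)]
    have "h X Y = 0 \<longleftrightarrow> perp (f (pt x)) (f (pt y))"
      using perp_iff[OF q X(1) Y(1)] unfolding X(2) Y(2) by simp
    also have "\<dots> \<longleftrightarrow> h x y = 0"
      using graph_auto_perp_iff[OF f] perp_iff[OF q 1] 1 by simp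
    finally show ?thesis .
  next
    case 2
    then show ?thesis
      using mixed[OF _ _ nz ext] by blast
  next
    case 3
    then show ?thesis
      using mixed[OF 3(2,1) nz(2,1,4,3) ext(2,1)] h_eq_0_sym by metis
  next
    case 4
    note X = extend_isotropic'[OF q f 4(1) nz(3) ext(1)]
      and Y = extend_isotropic'[OF q f 4(2) nz(4) ext(2)]
    have "h X Y = 0 \<longleftrightarrow> f ` tangent_verts x = f ` tangent_verts y"
      using isotropic_orthogonal_iff[OF X(1) Y(1)] X(2) Y(2) by simp
    also have "\<dots> \<longleftrightarrow> tangent_verts x = tangent_verts y"
      by (rule inj_on_image_eq_iff[OF graph_auto_inj_on[OF f] tangent_verts_subset_verts tangent_verts_subset_verts])
    also have "\<dots> \<longleftrightarrow> h x y = 0"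
      using isotropic_orthogonal_iff[OF 4] by simp
    finally show ?thesis .
  qed
qed

lemma extend_in_proj_points:
  assumes "q \<noteq> 2" "graph_auto f" "P \<in> proj_points"
  shows "extend_to_points f P \<in> proj_points"
proof -
  obtain x where x: "x \<noteq> 0" "P = pt x"
    using assms(3) by (auto simp: proj_points_eq)
  show ?thesis
  proof (cases "h x x = 0")
    case True
    then show ?thesis
      using extend_isotropic[OF assms(1,2), of x] x by (auto simp: isotropic_def)
  next
    case False
    then have "extend_to_points f P = f (pt x)" "f (pt x) \<in> verts"
      using x graph_auto_in_verts[OF assms(2)] by (simp_all add: extend_to_points_def)
    then show ?thesis
      by (simp add: verts_def)
  qed
qed

lemma carrier_PGammaU:
  "carrier (PGammaU h) = {\<phi> \<in> Bij proj_points.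
     (\<exists>\<sigma> T. semilinear_bij \<sigma> T \<and> (\<forall>P\<in>proj_points. \<phi> P = T ` P)) \<and>
     \<phi> ` hermitian_variety h = hermitian_variety h}"
  by (simp add: PGammaU_def PGammaL_def)

lemma mult_PGammaU:
  assumes "\<phi> \<in> carrier (PGammaU h)" "\<psi> \<in> carrier (PGammaU h)"
  shows "\<phi> \<otimes>\<^bsub>PGammaU h\<^esub> \<psi> = compose proj_points \<phi> \<psi>"
proof -
  have "\<phi> \<in> Bij proj_points" "\<psi> \<in> Bij proj_points"
    using assms by (auto simp: carrier_PGammaU)
  then show ?thesis
    by (simp add: PGammaU_def PGammaL_def BijGroup_def)
qed

lemma hermitian_variety_subset: "hermitian_variety h \<subseteq> proj_points"
  by (auto simp: hermitian_variety_def)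

lemma PGammaU_closed:
  assumes "\<phi> \<in> carrier (PGammaU h)" "\<psi> \<in> carrier (PGammaU h)"
  shows "\<phi> \<otimes>\<^bsub>PGammaU h\<^esub> \<psi> \<in> carrier (PGammaU h)"
proof -
  obtain \<sigma> S where S: "semilinear_bij \<sigma> S" "\<And>P. P \<in> proj_points \<Longrightarrow> \<phi> P = S ` P"
    using assms(1) by (auto simp: carrier_PGammaU)
  obtain \<tau> T where T: "semilinear_bij \<tau> T" "\<And>P. P \<in> proj_points \<Longrightarrow> \<psi> P = T ` P"
    using assms(2) by (auto simp: carrier_PGammaU)
  have B: "\<phi> \<in> Bij proj_points" "\<psi> \<in> Bij proj_points"
    and H: "\<phi> ` hermitian_variety h = hermitian_variety h" "\<psi> ` hermitian_variety h = hermitian_variety h"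
    using assms by (auto simp: carrier_PGammaU)
  have "semilinear_bij (\<sigma> \<circ> \<tau>) (S \<circ> T)"
    using S(1) T(1) by (auto simp: semilinear_bij_def field_automorphism_def intro: bij_comp)
  moreover have "compose proj_points \<phi> \<psi> P = (S \<circ> T) ` P" if "P \<in> proj_points" for P
  proof -
    have "\<psi> P \<in> proj_points"
      using B(2) that Bij_imp_funcset by blast
    then show ?thesis
      using S(2) T(2) that by (simp add: compose_def image_comp)
  qed
  moreover have "compose proj_points \<phi> \<psi> ` hermitian_variety h = hermitian_variety h"
  proof -
    have "compose proj_points \<phi> \<psi> ` hermitian_variety h = \<phi> ` \<psi> ` hermitian_variety h"
      unfolding image_image using hermitian_variety_subset by (intro image_cong) (auto simp: compose_def)
    then show ?thesis
      by (simp add: H)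
  qed
  ultimately show ?thesis
    using compose_Bij[OF B] unfolding mult_PGammaU[OF assms] carrier_PGammaU by blast
qed

lemma PGammaU_line_join:
  assumes \<phi>: "\<phi> \<in> carrier (PGammaU h)" and PQ: "P \<in> proj_points" "Q \<in> proj_points"
  shows "{R \<in> hermitian_variety h. R \<subseteq> line_join (\<phi> P) (\<phi> Q)} =
    \<phi> ` {R \<in> hermitian_variety h. R \<subseteq> line_join P Q}"
proof -
  obtain \<sigma> T where T: "semilinear_bij \<sigma> T" "\<And>P. P \<in> proj_points \<Longrightarrow> \<phi> P = T ` P"
    using \<phi> by (auto simp: carrier_PGammaU)
  have H: "\<phi> ` hermitian_variety h = hermitian_variety h"
    using \<phi> by (auto simp: carrier_PGammaU)
  have bij: "bij \<sigma>" "bij T" and scale: "\<And>c x. T (c *s x) = \<sigma> c *s T x"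
    using T(1) by (auto simp: semilinear_bij_def field_automorphism_def)
  obtain u v where uv: "u \<noteq> 0" "v \<noteq> 0" "P = pt u" "Q = pt v"
    using PQ by (auto simp: proj_points_eq)
  have "\<phi> P = pt (T u)" "\<phi> Q = pt (T v)"
    using image_pt_semilinear[of \<sigma> T, OF bij(1) scale] T(2)[OF PQ(1)] T(2)[OF PQ(2)] uv(3,4) by auto
  then have join: "line_join (\<phi> P) (\<phi> Q) = T ` line_join P Q"
    by (simp only: line_join_pt uv semilinear_span_pair[OF T(1)])
  have sub: "\<phi> R \<subseteq> T ` L \<longleftrightarrow> R \<subseteq> L" if "R \<in> hermitian_variety h" for R L
  proof -
    have "\<phi> R = T ` R"
      using T(2) hermitian_variety_subset that by blast
    then show ?thesis
      using inj_image_subset_iff[OF bij_is_inj[OF bij(2)]] by simp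
  qed
  have "{R \<in> hermitian_variety h. R \<subseteq> T ` line_join P Q} =
      {R \<in> \<phi> ` hermitian_variety h. R \<subseteq> T ` line_join P Q}"
    by (simp only: H)
  also have "\<dots> = \<phi> ` {R \<in> hermitian_variety h. \<phi> R \<subseteq> T ` line_join P Q}"
    by blast
  also have "{R \<in> hermitian_variety h. \<phi> R \<subseteq> T ` line_join P Q} =
      {R \<in> hermitian_variety h. R \<subseteq> line_join P Q}"
    using sub by blast
  finally show ?thesis
    by (simp only: join)
qed

lemma PGammaU_graph_auto:
  assumes \<phi>: "\<phi> \<in> carrier (PGammaU h)"
  shows "graph_auto \<phi>"
proof -
  have bij: "bij_betw \<phi> proj_points proj_points"
    and H: "\<phi> ` hermitian_variety h = hermitian_variety h"
    using \<phi> by (auto simp: carrier_PGammaU Bij_def)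
  have inj: "inj_on \<phi> proj_points"
    using bij by (rule bij_betw_imp_inj_on)
  have "\<phi> ` verts = verts"
    unfolding verts_def using inj_on_image_set_diff[OF inj _ hermitian_variety_subset, of proj_points]
      bij_betw_imp_surj_on[OF bij] H by simp
  moreover have VP: "verts \<subseteq> proj_points"
    by (auto simp: verts_def)
  ultimately have bijV: "bij_betw \<phi> verts verts"
    using inj by (simp add: bij_betw_def inj_on_subset)
  have "adj (\<phi> P) (\<phi> Q) \<longleftrightarrow> adj P Q" if PQ: "P \<in> verts" "Q \<in> verts" for P Q
  proof -
    have V: "\<phi> P \<in> verts" "\<phi> Q \<in> verts"
      using bij_betw_apply[OF bijV] PQ by auto
    have ne: "\<phi> P = \<phi> Q \<longleftrightarrow> P = Q"
      using inj_on_eq_iff[OF bij_betw_imp_inj_on[OF bijV]] PQ by blast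
    have line: "line_join A B \<in> proj_lines" if AB: "A \<in> verts" "B \<in> verts" "A \<noteq> B" for A B
    proof -
      obtain a b where "A = pt a" "B = pt b" "a \<noteq> 0" "b \<noteq> 0"
        using AB(1,2) VP unfolding proj_points_eq by blast
      then show ?thesis
        using line_join_in_proj_lines AB(3) by blast
    qed
    have "card {R \<in> hermitian_variety h. R \<subseteq> line_join (\<phi> P) (\<phi> Q)} =
        card {R \<in> hermitian_variety h. R \<subseteq> line_join P Q}"
    proof -
      have "inj_on \<phi> {R \<in> hermitian_variety h. R \<subseteq> line_join P Q}"
        using inj hermitian_variety_subset by (elim inj_on_subset) blast
      moreover have "P \<in> proj_points" "Q \<in> proj_points"
        using PQ VP by auto
      ultimately show ?thesis
        using PGammaU_line_join[OF \<phi>] by (simp add: card_image)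
    qed
    then have "tangent_line h (line_join (\<phi> P) (\<phi> Q)) \<longleftrightarrow> tangent_line h (line_join P Q)" if "P \<noteq> Q"
      using line PQ V ne that by (simp add: tangent_line_def)
    then show ?thesis
      using V PQ ne by (auto simp: adj_iff_line)
  qed
  then show ?thesis
    using bijV by (simp add: graph_auto_def)
qed

text \<open>
  An isotropic point is the only isotropic point on the line joining two vertices of its tangent line,
  and the images of these vertices determine the image of the tangent line.
\<close>

lemma PGammaU_determined_on_verts:
  assumes \<phi>: "\<phi> \<in> carrier (PGammaU h)" and \<psi>: "\<psi> \<in> carrier (PGammaU h)"
    and eq: "\<And>P. P \<in> verts \<Longrightarrow> \<phi> P = \<psi> P"
  shows "\<phi> = \<psi>"
proof (rule extensionalityI[of _ proj_points])
  show "\<phi> \<in> extensional proj_points" "\<psi> \<in> extensional proj_points"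
    using \<phi> \<psi> by (auto simp: carrier_PGammaU Bij_def)
  fix P :: "('a ^ 3) set" assume P: "P \<in> proj_points"
  show "\<phi> P = \<psi> P"
  proof (cases "P \<in> verts")
    case False
    then have PH: "P \<in> hermitian_variety h"
      using P by (simp add: verts_def)
    obtain x where x: "x \<noteq> 0" "P = pt x"
      using P by (auto simp: proj_points_eq)
    then have iso: "isotropic x"
      using PH pt_in_hermitian_variety by (simp add: isotropic_def)
    obtain v where v: "tangent_verts x = (\<lambda>a. pt (v + a *s x)) ` UNIV" "inj (\<lambda>a. pt (v + a *s x))"
      by (rule tangent_verts_parametrized[OF iso], rule that)
    define Q where "Q = (\<lambda>a. pt (v + a *s x))"
    have Q: "Q 0 \<in> tangent_verts x" "Q 1 \<in> tangent_verts x" "Q 0 \<noteq> Q 1"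
      unfolding v(1) Q_def[symmetric] using injD[OF v(2)[folded Q_def], of 0 1] by auto
    have QV: "Q 0 \<in> verts" "Q 1 \<in> verts"
      using Q tangent_verts_subset_verts by blast+
    then have QP: "Q 0 \<in> proj_points" "Q 1 \<in> proj_points"
      by (auto simp: verts_def)
    have "x = (- 1) *s (v + 0 *s x) + 1 *s (v + 1 *s x)"
      by simp
    then have "x \<in> vec.span {v + 0 *s x, v + 1 *s x}"
      unfolding mem_span_pair by blast
    then have PL: "P \<in> {R \<in> hermitian_variety h. R \<subseteq> line_join (Q 0) (Q 1)}"
      using PH x(2) unfolding Q_def line_join_pt by (simp add: pt_subset_span_pair)
    have "adj (Q 0) (Q 1)"
      using tangent_verts_adj[OF iso Q] .
    then have "adj (\<phi> (Q 0)) (\<phi> (Q 1))"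
      using graph_auto_adj[OF PGammaU_graph_auto[OF \<phi>] QV] by blast
    then have "card {R \<in> hermitian_variety h. R \<subseteq> line_join (\<phi> (Q 0)) (\<phi> (Q 1))} = 1"
      by (simp add: adj_iff_line tangent_line_def)
    moreover have "\<phi> P \<in> {R \<in> hermitian_variety h. R \<subseteq> line_join (\<phi> (Q 0)) (\<phi> (Q 1))}"
      using PGammaU_line_join[OF \<phi> QP] PL by blast
    moreover have "\<psi> P \<in> {R \<in> hermitian_variety h. R \<subseteq> line_join (\<phi> (Q 0)) (\<phi> (Q 1))}"
      using PGammaU_line_join[OF \<psi> QP] PL eq[OF QV(1)] eq[OF QV(2)] by auto
    ultimately show ?thesis
      using card_1_singletonE by (metis singletonD)
  qed (rule eq)
qed

lemma graph_auto_extends: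
  assumes q: "q \<noteq> 2" and f: "graph_auto f"
  shows "\<exists>\<phi>\<in>carrier (PGammaU h). \<forall>P\<in>verts. \<phi> P = f P"
proof -
  have "orthogonality_map q h (extend_to_points f)"
  proof (intro orthogonality_map.intro orthogonality_map_axioms.intro)
    show "hermitian_plane q h"
      by (rule hermitian_plane_axioms)
    show "extend_to_points f P \<in> proj_points" if "P \<in> proj_points" for P
      using q f that by (rule extend_in_proj_points)
    show "h X Y = 0 \<longleftrightarrow> h x y = 0"
      if "x \<noteq> 0" "y \<noteq> 0" "X \<noteq> 0" "Y \<noteq> 0" "extend_to_points f (pt x) = pt X"
          "extend_to_points f (pt y) = pt Y" for x y X Y
      using q f that by (rule extend_orthogonal)
  qed
  from orthogonality_map.semilinear[OF this]
  obtain \<sigma> T where "semilinear_bij \<sigma> T \<and> (\<forall>P\<in>proj_points. extend_to_points f P = T ` P)"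
    by (elim exE)
  then have T: "semilinear_bij \<sigma> T" "\<And>P. P \<in> proj_points \<Longrightarrow> extend_to_points f P = T ` P"
    by simp_all
  define \<phi> where "\<phi> = restrict (extend_to_points f) proj_points"
  have inj: "inj_on \<phi> proj_points"
  proof (rule inj_onI)
    fix P Q assume PQ: "P \<in> proj_points" "Q \<in> proj_points" "\<phi> P = \<phi> Q"
    then have "T ` P = T ` Q"
      using T(2) by (simp add: \<phi>_def)
    then show "P = Q"
      using T(1) bij_is_inj inj_image_eq_iff unfolding semilinear_bij_def by blast
  qed
  have "\<phi> ` proj_points \<subseteq> proj_points"
    using extend_in_proj_points[OF q f] by (auto simp: \<phi>_def)
  then have bij: "bij_betw \<phi> proj_points proj_points"
    using inj by (intro bij_betw_finite_endo) auto
  have "\<phi> ` hermitian_variety h \<subseteq> hermitian_variety h"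
  proof
    fix R assume "R \<in> \<phi> ` hermitian_variety h"
    then obtain P where P: "P \<in> hermitian_variety h" "R = \<phi> P"
      by blast
    then obtain x where x: "x \<noteq> 0" "P = pt x"
      using hermitian_variety_subset by (auto simp: proj_points_eq)
    then have "isotropic x"
      using P pt_in_hermitian_variety by (simp add: isotropic_def)
    then obtain y where "isotropic y" "extend_to_points f (pt x) = pt y"
      using extend_isotropic[OF q f] by blast
    then show "R \<in> hermitian_variety h"
      using P(2) x pt_in_hermitian_variety[of y] by (simp add: \<phi>_def isotropic_def)
  qed
  then have "\<phi> ` hermitian_variety h = hermitian_variety h"
    using inj inj_on_subset[OF inj hermitian_variety_subset] by (intro endo_inj_surj) auto
  moreover have "\<phi> P = T ` P" if "P \<in> proj_points" for P
    using T(2) that by (simp add: \<phi>_def)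
  ultimately have "\<phi> \<in> carrier (PGammaU h)"
    using bij T(1) unfolding carrier_PGammaU by (auto simp: Bij_def \<phi>_def)
  moreover have "\<phi> P = f P" if "P \<in> verts" for P
    using that by (simp add: \<phi>_def extend_to_points_def verts_def)
  ultimately show ?thesis
    by blast
qed

theorem graph_AutGroup_iso_PGammaU:
  assumes q: "q \<noteq> 2"
  shows "graph_AutGroup (NU3 h) \<cong> PGammaU h"
proof (rule is_iso_if_bij_hom)
  let ?G = "graph_AutGroup (NU3 h)" and ?\<Phi> = "\<lambda>\<phi>. restrict \<phi> verts"
  have mem: "?\<Phi> \<phi> \<in> carrier ?G" if "\<phi> \<in> carrier (PGammaU h)" for \<phi>
    using PGammaU_graph_auto[OF that]
    by (simp add: carrier_graph_AutGroup graph_auto_def cong: bij_betw_cong)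
  have "?\<Phi> (\<phi> \<otimes>\<^bsub>PGammaU h\<^esub> \<psi>) = ?\<Phi> \<phi> \<otimes>\<^bsub>?G\<^esub> ?\<Phi> \<psi>"
    if "\<phi> \<in> carrier (PGammaU h)" "\<psi> \<in> carrier (PGammaU h)" for \<phi> \<psi>
  proof
    fix P
    show "?\<Phi> (\<phi> \<otimes>\<^bsub>PGammaU h\<^esub> \<psi>) P = (?\<Phi> \<phi> \<otimes>\<^bsub>?G\<^esub> ?\<Phi> \<psi>) P"
      using graph_auto_in_verts[OF PGammaU_graph_auto[OF that(2)], of P]
      unfolding mult_PGammaU[OF that] mult_graph_AutGroup[OF mem[OF that(1)] mem[OF that(2)]]
      by (auto simp: compose_def verts_def)
  qed
  then show "?\<Phi> \<in> hom (PGammaU h) ?G"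
    using mem by (simp add: hom_def)
  show "bij_betw ?\<Phi> (carrier (PGammaU h)) (carrier ?G)"
  proof (rule bij_betw_imageI)
    show "inj_on ?\<Phi> (carrier (PGammaU h))"
      using PGammaU_determined_on_verts by (intro inj_onI) (metis restrict_apply')
    show "?\<Phi> ` carrier (PGammaU h) = carrier ?G"
    proof (intro equalityI subsetI)
      fix f assume "f \<in> carrier ?G"
      then have f: "f \<in> extensional verts" "graph_auto f"
        by (auto simp: carrier_graph_AutGroup)
      obtain \<phi> where \<phi>: "\<phi> \<in> carrier (PGammaU h)" "\<forall>P\<in>verts. \<phi> P = f P"
        using graph_auto_extends[OF q f(2)] by blast
      then have "?\<Phi> \<phi> = f"
        using f(1) by (intro extensionalityI[of _ verts]) auto
      then show "f \<in> ?\<Phi> ` carrier (PGammaU h)"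
        using \<phi>(1) by blast
    qed (use mem in blast)
  qed
  show "\<phi> \<otimes>\<^bsub>PGammaU h\<^esub> \<psi> \<in> carrier (PGammaU h)"
    if "\<phi> \<in> carrier (PGammaU h)" "\<psi> \<in> carrier (PGammaU h)" for \<phi> \<psi>
    using PGammaU_closed[OF that] .
qed

end

section \<open>Complete multipartite graphs\<close>

text \<open>
  A partition of a set with \<open>n m\<close> elements into classes of size \<open>m\<close> can be numbered: \<open>\<beta> (i, j)\<close> is the
  \<open>j\<close>-th element of the \<open>i\<close>-th class.  The class of an element is given by
  the function \<open>C\<close>.
\<close>

lemma exists_class_coordinates:
  fixes C :: "'b \<Rightarrow> 'b set"
  assumes fin: "finite V" and refl: "\<And>P. P \<in> V \<Longrightarrow> P \<in> C P" and sub: "\<And>P. P \<in> V \<Longrightarrow> C P \<subseteq> V"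
    and eq: "\<And>P Q. P \<in> V \<Longrightarrow> Q \<in> C P \<Longrightarrow> C Q = C P"
    and card_C: "\<And>P. P \<in> V \<Longrightarrow> card (C P) = m" and card_V: "card V = n * m" and m: "m > 0"
  shows "\<exists>\<beta>. bij_betw \<beta> ({1..n} \<times> {1..m}) V \<and>
    (\<forall>i\<in>{1..n}. \<forall>j\<in>{1..m}. \<forall>i'\<in>{1..n}. \<forall>j'\<in>{1..m}. \<beta> (i', j') \<in> C (\<beta> (i, j)) \<longleftrightarrow> i = i')"
proof -
  have disj: "K \<inter> K' = {}" if "K \<in> C ` V" "K' \<in> C ` V" "K \<noteq> K'" for K K'
    using that eq by blast
  have Un: "\<Union> (C ` V) = V"
    using refl sub by blast
  have "m * card (C ` V) = card (\<Union> (C ` V))"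
  proof (rule card_partition)
    show "finite (\<Union> (C ` V))"
      unfolding Un by (rule fin)
  qed (use fin card_C disj in auto)
  then have "card (C ` V) = n"
    using card_V m by (simp add: Un mult.commute)
  then obtain g where g: "bij_betw g {1..n} (C ` V)"
    using ex_bij_betw_nat_finite_1[of "C ` V"] fin by auto
  have gC: "g i \<in> C ` V" if "i \<in> {1..n}" for i
    using g that bij_betw_apply by fastforce
  have "\<exists>k. bij_betw k {1..m} K" if "K \<in> C ` V" for K
  proof -
    have "card K = m" "finite K"
      using that card_C finite_subset[OF sub fin] by auto
    then show ?thesis
      using ex_bij_betw_nat_finite_1[of K] by auto
  qed
  then obtain k where k: "\<And>K. K \<in> C ` V \<Longrightarrow> bij_betw (k K) {1..m} K"
    by metis
  define \<beta> where "\<beta> = (\<lambda>(i, j). k (g i) j)"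
  have \<beta>_mem: "\<beta> (i, j) \<in> g i" if "i \<in> {1..n}" "j \<in> {1..m}" for i j
    using bij_betw_apply[OF k[OF gC[OF that(1)]] that(2)] by (simp add: \<beta>_def)
  have C_\<beta>: "\<beta> (i, j) \<in> V \<and> C (\<beta> (i, j)) = g i" if ij: "i \<in> {1..n}" "j \<in> {1..m}" for i j
  proof -
    obtain P where P: "P \<in> V" "g i = C P"
      using gC[OF ij(1)] by blast
    have mem: "\<beta> (i, j) \<in> C P"
      using \<beta>_mem[OF ij] P(2) by simp
    show ?thesis
      using eq[OF P(1) mem] subsetD[OF sub[OF P(1)] mem] P(2) by simp
  qed
  have i_eq: "\<beta> (i', j') \<in> C (\<beta> (i, j)) \<longleftrightarrow> i = i'"
    if ij: "i \<in> {1..n}" "j \<in> {1..m}" "i' \<in> {1..n}" "j' \<in> {1..m}" for i j i' j'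
  proof
    assume "\<beta> (i', j') \<in> C (\<beta> (i, j))"
    then have "C (\<beta> (i', j')) = C (\<beta> (i, j))"
      using eq C_\<beta>[OF ij(1,2)] by blast
    then have "g i' = g i"
      using C_\<beta>[OF ij(1,2)] C_\<beta>[OF ij(3,4)] by simp
    then show "i = i'"
      using bij_betw_imp_inj_on[OF g] ij by (auto simp: inj_on_eq_iff)
  next
    assume "i = i'"
    then show "\<beta> (i', j') \<in> C (\<beta> (i, j))"
      using \<beta>_mem[OF ij(3,4)] C_\<beta>[OF ij(1,2)] by simp
  qed
  have "inj_on \<beta> ({1..n} \<times> {1..m})"
  proof (rule inj_onI, clarify)
    fix i j i' j'
    assume ij: "i \<in> {1..n}" "j \<in> {1..m}" "i' \<in> {1..n}" "j' \<in> {1..m}" and e: "\<beta> (i, j) = \<beta> (i', j')"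
    then have "\<beta> (i', j') \<in> C (\<beta> (i, j))"
      using refl[of "\<beta> (i, j)"] C_\<beta>[OF ij(1,2)] by simp
    then have "i = i'"
      using i_eq[OF ij] by simp
    moreover from this have "k (g i) j = k (g i) j'"
      using e by (simp add: \<beta>_def)
    then have "j = j'"
      using bij_betw_imp_inj_on[OF k[OF gC[OF ij(1)]]] ij by (auto simp: inj_on_eq_iff)
    ultimately show "i = i' \<and> j = j'"
      by blast
  qed
  moreover have "\<beta> ` ({1..n} \<times> {1..m}) = V"
  proof (intro equalityI subsetI)
    fix P assume P: "P \<in> V"
    then obtain i where i: "i \<in> {1..n}" "g i = C P"
      using bij_betw_imp_surj_on[OF g] by (metis imageE imageI)
    obtain j where j: "j \<in> {1..m}" "P = k (g i) j"
      using bij_betw_imp_surj_on[OF k[OF gC[OF i(1)]]] refl[OF P] i(2) by (metis imageE)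
    have "P = \<beta> (i, j)"
      using j by (simp add: \<beta>_def)
    then show "P \<in> \<beta> ` ({1..n} \<times> {1..m})"
      using i(1) j(1) by blast
  qed (use C_\<beta> in auto)
  ultimately have "bij_betw \<beta> ({1..n} \<times> {1..m}) V"
    by (simp add: bij_betw_def)
  then show ?thesis
    using i_eq by blast
qed

lemma carrier_wreath_sym:
  "carrier (wreath_sym (sym_group m) n) =
    (\<Pi>\<^sub>E i\<in>{1..n}. {p. p permutes {1..m}}) \<times> {p. p permutes {1..n}}"
  by (simp add: wreath_sym_def semidirect_product_def sym_group_def)

lemma mult_wreath_sym:
  "(f, \<pi>) \<otimes>\<^bsub>wreath_sym (sym_group m) n\<^esub> (g, \<rho>) = (\<lambda>i\<in>{1..n}. f i \<circ> g (inv' \<pi> i), \<pi> \<circ> \<rho>)"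
  by (auto simp: wreath_sym_def semidirect_product_def sym_group_def fun_eq_iff)

text \<open>
  The pair \<open>(f, \<pi>)\<close> acts by \<open>\<beta> (i, j) \<mapsto> \<beta> (\<pi> i, f (\<pi> i) j)\<close>: first \<open>\<pi>\<close> moves the parts, then \<open>f\<close> permutes
  each part.  The index \<open>\<pi> i\<close> instead of \<open>i\<close> in \<open>f\<close> matches the twist by \<open>inv \<pi>\<close> in the product of
  the wreath product.  Conversely an automorphism preserves non-adjacency, hence permutes the parts.
\<close>

lemma graph_AutGroup_complete_multipartite:
  fixes \<beta> :: "nat \<times> nat \<Rightarrow> 'v"
  assumes \<beta>: "bij_betw \<beta> ({1..n} \<times> {1..m}) V" and m: "m > 0"
    and E: "\<And>i j i' j'. i \<in> {1..n} \<Longrightarrow> j \<in> {1..m} \<Longrightarrow> i' \<in> {1..n} \<Longrightarrow> j' \<in> {1..m} \<Longrightarrow>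
      {\<beta> (i, j), \<beta> (i', j')} \<in> E \<longleftrightarrow> i \<noteq> i'"
  shows "graph_AutGroup (V, E) \<cong> wreath_sym (sym_group m) n"
proof (rule is_iso_if_bij_hom)
  let ?W = "wreath_sym (sym_group m) n" and ?G = "graph_AutGroup (V, E)"
  let ?I = "{1..n}" and ?J = "{1..m}"
  define \<gamma> where "\<gamma> = inv_into (?I \<times> ?J) \<beta>"
  define act :: "(nat \<Rightarrow> nat \<Rightarrow> nat) \<times> (nat \<Rightarrow> nat) \<Rightarrow> nat \<times> nat \<Rightarrow> 'v"
    where "act = (\<lambda>(f, \<pi>) (i, j). \<beta> (\<pi> i, f (\<pi> i) j))"
  define \<Phi> where "\<Phi> = (\<lambda>x. \<lambda>P\<in>V. act x (\<gamma> P))"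
  have \<beta>V: "\<beta> (i, j) \<in> V" if "i \<in> ?I" "j \<in> ?J" for i j
    using bij_betw_apply[OF \<beta>] that by auto
  have \<beta>_eq: "\<beta> (i, j) = \<beta> (i', j') \<longleftrightarrow> i = i' \<and> j = j'"
    if "i \<in> ?I" "j \<in> ?J" "i' \<in> ?I" "j' \<in> ?J" for i j i' j'
    using inj_on_eq_iff[OF bij_betw_imp_inj_on[OF \<beta>], of "(i, j)" "(i', j')"] that by auto
  have V_cases: "\<exists>i\<in>?I. \<exists>j\<in>?J. P = \<beta> (i, j)" if "P \<in> V" for P
  proof -
    have "P \<in> \<beta> ` (?I \<times> ?J)"
      using that bij_betw_imp_surj_on[OF \<beta>] by simp
    then show ?thesis
      by blast
  qed
  have \<Phi>_\<beta>: "\<Phi> (f, \<pi>) (\<beta> (i, j)) = \<beta> (\<pi> i, f (\<pi> i) j)" if "i \<in> ?I" "j \<in> ?J" for f \<pi> i j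
    using \<beta>V[OF that] bij_betw_inv_into_left[OF \<beta>, of "(i, j)"] that by (simp add: \<Phi>_def \<gamma>_def act_def)
  have perm: "\<pi> i \<in> ?I" "f (\<pi> i) j \<in> ?J" "inv' \<pi> i \<in> ?I"
    if "(f, \<pi>) \<in> carrier ?W" "i \<in> ?I" "j \<in> ?J" for f \<pi> i j
  proof -
    have \<pi>: "\<pi> permutes ?I" and f: "\<And>k. k \<in> ?I \<Longrightarrow> f k permutes ?J"
      using that(1) by (auto simp: carrier_wreath_sym PiE_iff)
    show "\<pi> i \<in> ?I" "inv' \<pi> i \<in> ?I"
      using \<pi> permutes_inv[OF \<pi>] that(2) permutes_in_image by metis+
    then show "f (\<pi> i) j \<in> ?J"
      using f that(3) permutes_in_image by metis
  qed
  have finV: "finite V"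
    using bij_betw_finite[OF \<beta>] by simp
  have carrier_G: "f \<in> carrier ?G \<longleftrightarrow> f \<in> extensional V \<and> bij_betw f V V \<and>
      (\<forall>u\<in>V. \<forall>v\<in>V. {f u, f v} \<in> E \<longleftrightarrow> {u, v} \<in> E)" for f
    by (auto simp: graph_AutGroup_def Bij_def)
  have mult_G: "f \<otimes>\<^bsub>?G\<^esub> g = compose V f g" if "f \<in> carrier ?G" "g \<in> carrier ?G" for f g
    using that by (simp add: graph_AutGroup_def BijGroup_def)
  have mem: "\<Phi> x \<in> carrier ?G" if x: "x \<in> carrier ?W" for x
  proof -
    obtain f \<pi> where x_eq: "x = (f, \<pi>)"
      by (cases x)
    then have W: "(f, \<pi>) \<in> carrier ?W"
      using x by simp
    have inj\<pi>: "\<pi> i = \<pi> i' \<longleftrightarrow> i = i'" for i i'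
      using W by (auto simp: carrier_wreath_sym dest: permutes_inj injD)
    have injf: "f i j = f i j' \<longleftrightarrow> j = j'" if "i \<in> ?I" for i j j'
    proof -
      have "f i permutes ?J"
        using W that by (auto simp: carrier_wreath_sym PiE_iff)
      then show ?thesis
        by (simp add: permutes_inj inj_eq)
    qed
    have "\<Phi> x ` V \<subseteq> V"
    proof
      fix Q assume "Q \<in> \<Phi> x ` V"
      then obtain P where "P \<in> V" "Q = \<Phi> x P"
        by blast
      then obtain i j where "i \<in> ?I" "j \<in> ?J" "Q = \<Phi> (f, \<pi>) (\<beta> (i, j))"
        using V_cases x_eq by blast
      then show "Q \<in> V"
        using \<Phi>_\<beta> \<beta>V perm[OF W] by simp
    qed
    moreover have "inj_on (\<Phi> x) V"
    proof (rule inj_onI)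
      fix P Q assume PQ: "P \<in> V" "Q \<in> V" "\<Phi> x P = \<Phi> x Q"
      obtain i j where P: "i \<in> ?I" "j \<in> ?J" "P = \<beta> (i, j)"
        using V_cases[OF PQ(1)] by blast
      obtain i' j' where Q: "i' \<in> ?I" "j' \<in> ?J" "Q = \<beta> (i', j')"
        using V_cases[OF PQ(2)] by blast
      have "\<beta> (\<pi> i, f (\<pi> i) j) = \<beta> (\<pi> i', f (\<pi> i') j')"
        using PQ(3) \<Phi>_\<beta>[OF P(1,2)] \<Phi>_\<beta>[OF Q(1,2)] by (simp add: x_eq P(3) Q(3))
      then have "\<pi> i = \<pi> i'" "f (\<pi> i) j = f (\<pi> i') j'"
        using \<beta>_eq[OF perm(1,2)[OF W P(1,2)] perm(1,2)[OF W Q(1,2)]] by auto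
      then show "P = Q"
        using P Q inj\<pi> injf perm(1)[OF W P(1,2)] by simp
    qed
    ultimately have "bij_betw (\<Phi> x) V V"
      using finV by (intro bij_betw_finite_endo)
    moreover have "{\<Phi> x P, \<Phi> x Q} \<in> E \<longleftrightarrow> {P, Q} \<in> E" if PQ: "P \<in> V" "Q \<in> V" for P Q
    proof -
      obtain i j where P: "i \<in> ?I" "j \<in> ?J" "P = \<beta> (i, j)"
        using V_cases[OF PQ(1)] by blast
      obtain i' j' where Q: "i' \<in> ?I" "j' \<in> ?J" "Q = \<beta> (i', j')"
        using V_cases[OF PQ(2)] by blast
      show ?thesis
        unfolding x_eq P(3) Q(3) \<Phi>_\<beta>[OF P(1,2)] \<Phi>_\<beta>[OF Q(1,2)] E[OF P(1,2) Q(1,2)]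
          E[OF perm(1,2)[OF W P(1,2)] perm(1,2)[OF W Q(1,2)]] inj\<pi> by (rule refl)
    qed
    ultimately show ?thesis
      by (simp add: carrier_G \<Phi>_def)
  qed
  have closed: "x \<otimes>\<^bsub>?W\<^esub> y \<in> carrier ?W" if xy: "x \<in> carrier ?W" "y \<in> carrier ?W" for x y
  proof -
    obtain f \<pi> g \<rho> where eq: "x = (f, \<pi>)" "y = (g, \<rho>)"
      by (cases x, cases y)
    have \<pi>: "\<pi> permutes ?I" "\<rho> permutes ?I" and fg: "\<And>i. i \<in> ?I \<Longrightarrow> f i permutes ?J"
        "\<And>i. i \<in> ?I \<Longrightarrow> g i permutes ?J"
      using xy by (auto simp: eq carrier_wreath_sym PiE_iff)
    have "f i \<circ> g (inv' \<pi> i) permutes ?J" if "i \<in> ?I" for i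
    proof -
      have "inv' \<pi> i \<in> ?I"
        using permutes_in_image[OF permutes_inv[OF \<pi>(1)]] that by blast
      then show ?thesis
        using permutes_compose fg that by blast
    qed
    then show ?thesis
      using permutes_compose[OF \<pi>(2,1)] unfolding eq mult_wreath_sym carrier_wreath_sym by auto
  qed
  then show "\<And>x y. x \<in> carrier ?W \<Longrightarrow> y \<in> carrier ?W \<Longrightarrow> x \<otimes>\<^bsub>?W\<^esub> y \<in> carrier ?W" .
  have "\<Phi> (x \<otimes>\<^bsub>?W\<^esub> y) = \<Phi> x \<otimes>\<^bsub>?G\<^esub> \<Phi> y" if xy: "x \<in> carrier ?W" "y \<in> carrier ?W" for x y
  proof (rule extensionalityI[of _ V])
    show "\<Phi> (x \<otimes>\<^bsub>?W\<^esub> y) \<in> extensional V" "\<Phi> x \<otimes>\<^bsub>?G\<^esub> \<Phi> y \<in> extensional V"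
      by (simp_all add: \<Phi>_def mult_G[OF mem[OF xy(1)] mem[OF xy(2)], unfolded \<Phi>_def])
    fix P assume P: "P \<in> V"
    then obtain i j where ij: "i \<in> ?I" "j \<in> ?J" "P = \<beta> (i, j)"
      using V_cases by blast
    obtain f \<pi> g \<rho> where eq: "x = (f, \<pi>)" "y = (g, \<rho>)"
      by (cases x, cases y)
    have W: "(f, \<pi>) \<in> carrier ?W" "(g, \<rho>) \<in> carrier ?W"
      using xy by (simp_all add: eq)
    have \<rho>: "\<rho> i \<in> ?I" "g (\<rho> i) j \<in> ?J"
      using perm[OF W(2) ij(1,2)] by auto
    have \<pi>: "\<pi> permutes ?I"
      using W(1) by (simp add: carrier_wreath_sym)
    have "\<pi> (\<rho> i) \<in> ?I"
      using perm(1)[OF W(1) \<rho>] .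
    then have "\<Phi> (x \<otimes>\<^bsub>?W\<^esub> y) P = \<beta> (\<pi> (\<rho> i), f (\<pi> (\<rho> i)) (g (\<rho> i) j))"
      using permutes_inverses(2)[OF \<pi>] unfolding eq mult_wreath_sym ij(3) \<Phi>_\<beta>[OF ij(1,2)] by simp
    also have "\<dots> = \<Phi> x (\<Phi> y P)"
      unfolding eq ij(3) \<Phi>_\<beta>[OF ij(1,2)] \<Phi>_\<beta>[OF \<rho>] ..
    also have "\<dots> = (\<Phi> x \<otimes>\<^bsub>?G\<^esub> \<Phi> y) P"
      unfolding mult_G[OF mem[OF xy(1)] mem[OF xy(2)]] using P by (simp add: compose_def)
    finally show "\<Phi> (x \<otimes>\<^bsub>?W\<^esub> y) P = (\<Phi> x \<otimes>\<^bsub>?G\<^esub> \<Phi> y) P" .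
  qed
  then show "\<Phi> \<in> hom ?W ?G"
    using mem by (simp add: hom_def)
  show "bij_betw \<Phi> (carrier ?W) (carrier ?G)"
  proof (rule bij_betw_imageI)
    show "inj_on \<Phi> (carrier ?W)"
    proof (rule inj_onI)
      fix x y assume xy: "x \<in> carrier ?W" "y \<in> carrier ?W" "\<Phi> x = \<Phi> y"
      obtain f \<pi> g \<rho> where eq: "x = (f, \<pi>)" "y = (g, \<rho>)"
        by (cases x, cases y)
      have W: "(f, \<pi>) \<in> carrier ?W" "(g, \<rho>) \<in> carrier ?W"
        using xy by (simp_all add: eq)
      have perms: "\<pi> permutes ?I" "\<rho> permutes ?I" "\<And>i. i \<in> ?I \<Longrightarrow> f i permutes ?J"
          "\<And>i. i \<in> ?I \<Longrightarrow> g i permutes ?J"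
        "f \<in> extensional ?I" "g \<in> extensional ?I"
        using W by (auto simp: carrier_wreath_sym PiE_iff)
      have *: "\<pi> i = \<rho> i \<and> f (\<pi> i) j = g (\<rho> i) j" if ij: "i \<in> ?I" "j \<in> ?J" for i j
      proof -
        have "\<beta> (\<pi> i, f (\<pi> i) j) = \<beta> (\<rho> i, g (\<rho> i) j)"
          using xy(3) \<Phi>_\<beta>[OF ij, of f \<pi>] \<Phi>_\<beta>[OF ij, of g \<rho>] by (simp add: eq)
        then show ?thesis
          using \<beta>_eq[OF perm(1,2)[OF W(1) ij] perm(1,2)[OF W(2) ij]] by blast
      qed
      have "\<pi> = \<rho>"
      proof
        fix i
        show "\<pi> i = \<rho> i"
          using *[of i 1] m permutes_not_in[OF perms(1)] permutes_not_in[OF perms(2)]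
            by (cases "i \<in> ?I") auto
      qed
      moreover have "f = g"
      proof (rule extensionalityI[OF perms(5,6)])
        fix i assume i: "i \<in> ?I"
        have inv: "inv' \<pi> i \<in> ?I" "\<pi> (inv' \<pi> i) = i"
          using permutes_in_image[OF permutes_inv[OF perms(1)]] i
            permutes_inverses(1)[OF perms(1)] by auto
        show "f i = g i"
        proof
          fix j
          show "f i j = g i j"
            using *[OF inv(1), of j] inv(2) \<open>\<pi> = \<rho>\<close> permutes_not_in[OF perms(3)[OF i]]
              permutes_not_in[OF perms(4)[OF i]] by (cases "j \<in> ?J") auto
        qed
      qed
      ultimately show "x = y"
        by (simp add: eq)
    qed
    show "\<Phi> ` carrier ?W = carrier ?G"
    proof (intro equalityI subsetI)
      fix \<phi> assume "\<phi> \<in> carrier ?G"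
      then have ext: "\<phi> \<in> extensional V" and bij: "bij_betw \<phi> V V"
        and adj: "\<And>u v. u \<in> V \<Longrightarrow> v \<in> V \<Longrightarrow> {\<phi> u, \<phi> v} \<in> E \<longleftrightarrow> {u, v} \<in> E"
        unfolding carrier_G by auto
      have "\<exists>a b. a \<in> ?I \<and> b \<in> ?J \<and> \<phi> (\<beta> (i, j)) = \<beta> (a, b)" if "i \<in> ?I" "j \<in> ?J" for i j
        using V_cases[OF bij_betw_apply[OF bij \<beta>V[OF that]]] by blast
      then obtain a b where ab: "\<And>i j. i \<in> ?I \<Longrightarrow> j \<in> ?J \<Longrightarrow> a i j \<in> ?I \<and> b i j \<in> ?J \<and>
          \<phi> (\<beta> (i, j)) = \<beta> (a i j, b i j)"
        by metis
      have a_eq: "a i j = a i' j' \<longleftrightarrow> i = i'" if ij: "i \<in> ?I" "j \<in> ?J" "i' \<in> ?I" "j' \<in> ?J" for i j i' j'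
        using adj[OF \<beta>V[OF ij(1,2)] \<beta>V[OF ij(3,4)]] E[OF ij] ab[OF ij(1,2)] ab[OF ij(3,4)]
          E[of "a i j" "b i j" "a i' j'" "b i' j'"] by auto
      have one: "1 \<in> ?J"
        using m by simp
      define \<pi> where "\<pi> = (\<lambda>i. if i \<in> ?I then a i 1 else i)"
      have \<pi>: "\<pi> permutes ?I"
      proof (rule bij_imp_permutes)
        show "bij_betw \<pi> ?I ?I"
          using ab one a_eq by (intro bij_betw_finite_endo) (auto simp: \<pi>_def inj_on_def)
      qed (auto simp: \<pi>_def)
      define f where "f = (\<lambda>i\<in>?I. \<lambda>j. if j \<in> ?J then b (inv' \<pi> i) j else j)"
      have inv: "inv' \<pi> i \<in> ?I" if "i \<in> ?I" for i
        using permutes_in_image[OF permutes_inv[OF \<pi>]] that by blast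
      have f: "f i permutes ?J" if i: "i \<in> ?I" for i
      proof (rule bij_imp_permutes)
        show "bij_betw (f i) ?J ?J"
        proof (rule bij_betw_finite_endo)
          show "f i ` ?J \<subseteq> ?J"
            using ab inv[OF i] i by (auto simp: f_def)
          show "inj_on (f i) ?J"
          proof (rule inj_onI)
            fix j j' assume j: "j \<in> ?J" "j' \<in> ?J" and "f i j = f i j'"
            then have "b (inv' \<pi> i) j = b (inv' \<pi> i) j'"
              using i by (simp add: f_def)
            moreover have "a (inv' \<pi> i) j = a (inv' \<pi> i) j'"
              using a_eq inv[OF i] j by blast
            ultimately have "\<phi> (\<beta> (inv' \<pi> i, j)) = \<phi> (\<beta> (inv' \<pi> i, j'))"
              using ab[OF inv[OF i] j(1)] ab[OF inv[OF i] j(2)] by simp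
            then show "j = j'"
              using inj_on_eq_iff[OF bij_betw_imp_inj_on[OF bij]] \<beta>V \<beta>_eq inv[OF i] j by simp
          qed
        qed simp
      qed (use i in \<open>auto simp: f_def\<close>)
      have "(f, \<pi>) \<in> carrier ?W"
        using f \<pi> by (auto simp: carrier_wreath_sym f_def)
      moreover have "\<Phi> (f, \<pi>) = \<phi>"
      proof (rule extensionalityI[OF _ ext])
        fix P assume "P \<in> V"
        then obtain i j where ij: "i \<in> ?I" "j \<in> ?J" "P = \<beta> (i, j)"
          using V_cases by blast
        have \<pi>i: "\<pi> i = a i j"
          using ij one a_eq by (simp add: \<pi>_def)
        have "f (\<pi> i) j = b i j"
          using permutes_in_image[OF \<pi>] permutes_inverses(2)[OF \<pi>] ij by (simp add: f_def)
        then show "\<Phi> (f, \<pi>) P = \<phi> P"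
          using ab[OF ij(1,2)] \<pi>i unfolding ij(3) \<Phi>_\<beta>[OF ij(1,2)] by simp
      qed (simp add: \<Phi>_def)
      ultimately show "\<phi> \<in> \<Phi> ` carrier ?W"
        by blast
    qed (use mem in blast)
  qed
qed

context hermitian_plane
begin

section \<open>The case of the field with four elements\<close>

lemma binary_fixed:
  assumes "q = 2" "bar c = c"
  shows "c = 0 \<or> c = 1"
proof -
  have "card {0, 1 :: 'a} = q"
    using assms(1) by simp
  have "{0, 1} = {c. bar c = c}"
  proof (rule card_seteq)
    show "card {c. bar c = c} \<le> card {0, 1 :: 'a}"
      unfolding \<open>card {0, 1} = q\<close> by (rule card_fixed)
  qed auto
  then show ?thesis
    using assms(2) by blast
qed

lemma binary_norm:
  assumes "q = 2"
  shows "c * bar c = (if c = 0 then 0 else 1)"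
  using binary_fixed[OF assms, of "c * bar c"] by (auto simp: mult.commute)

lemma binary_h_self: "q = 2 \<Longrightarrow> h u u \<noteq> 0 \<Longrightarrow> h u u = 1"
  using binary_fixed[OF _ bar_h, of u] by blast

lemma binary_two: "q = 2 \<Longrightarrow> (1::'a) + 1 = 0"
  using binary_fixed[of "1 + 1"] by (metis add_cancel_left_left bar_1 bar_add one_neq_zero)

lemma binary_adj_iff:
  assumes q: "q = 2" and nz: "h u u \<noteq> 0" "h v v \<noteq> 0"
  shows "adj (pt u) (pt v) \<longleftrightarrow> pt u \<noteq> pt v \<and> h u v \<noteq> 0"
proof -
  have "gram_zero u v \<longleftrightarrow> h u v * bar (h u v) = 1"
    unfolding gram_zero_def bar_h binary_h_self[OF q nz(1)] binary_h_self[OF q nz(2)] by simp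
  also have "\<dots> \<longleftrightarrow> h u v \<noteq> 0"
    unfolding binary_norm[OF q] by simp
  finally show ?thesis
    using adj_pt_iff[OF nz] by simp
qed

lemma binary_norm_comb:
  assumes q: "q = 2" and nz: "h r r \<noteq> 0" "h s s \<noteq> 0" "h t t \<noteq> 0"
    and o: "h r s = 0" "h r t = 0" "h s t = 0"
  shows "h (a *s r + b *s s + c *s t) (a *s r + b *s s + c *s t) = a * bar a + b * bar b + c * bar c"
proof -
  have "h s r = 0" "h t r = 0" "h t s = 0"
    using o h_eq_0_sym by blast+
  then show ?thesis
    using o by (simp add: binary_h_self[OF q nz(1)] binary_h_self[OF q nz(2)] binary_h_self[OF q nz(3)] mult.commute)
qed

text \<open>
  A combination of \<open>s\<close> and \<open>t\<close> with two non-zero coefficients has norm \<open>1 + 1 = 0\<close>, so \<open>pt s\<close> and \<open>pt t\<close> are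
  the only vertices orthogonal to \<open>r\<close>.
\<close>

lemma binary_class:
  assumes q: "q = 2" and nz: "h r r \<noteq> 0" "h s s \<noteq> 0" "h t t \<noteq> 0"
    and o: "h r s = 0" "h r t = 0" "h s t = 0"
  shows "{Q \<in> verts. \<not> adj (pt r) Q} = {pt r, pt s, pt t}"
proof (intro equalityI subsetI)
  fix Q assume "Q \<in> {Q \<in> verts. \<not> adj (pt r) Q}"
  then obtain u where u: "Q = pt u" "h u u \<noteq> 0" "\<not> adj (pt r) (pt u)"
    by (auto simp: verts_eq)
  show "Q \<in> {pt r, pt s, pt t}"
  proof (cases "pt r = pt u")
    case False
    then have "h u r = 0"
      using binary_adj_iff[OF q nz(1) u(2)] u(3) h_eq_0_sym by blast
    then have "u = 0 *s r + (h u s / h s s) *s s + (h u t / h t t) *s t"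
      using orthogonal_basis_expansion[OF nz o, of u] by simp
    then obtain b c where bc: "u = 0 *s r + b *s s + c *s t"
      by blast
    then have "h u u = b * bar b + c * bar c"
      using binary_norm_comb[OF q nz o, of 0 b c] by simp
    then have "b = 0 \<or> c = 0"
      using u(2) binary_two[OF q] unfolding binary_norm[OF q] by (auto split: if_splits)
    then have "u = b *s s \<or> u = c *s t"
      using bc by auto
    then show ?thesis
      using pt_eqI[OF nonisotropic_ne_0[OF u(2)]] u(1) by blast
  qed (use u in simp)
next
  fix Q assume "Q \<in> {pt r, pt s, pt t}"
  then show "Q \<in> {Q \<in> verts. \<not> adj (pt r) Q}"
    using binary_adj_iff[OF q] nz o by auto
qed

text \<open>
  In an orthogonal basis the norm of a vector is the parity of the number of its non-zero coordinates.
  So the vertices are the three basis points and the nine points with three non-zero coordinates.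
\<close>

lemma binary_card_verts:
  assumes q: "q = 2"
  shows "card verts = 4 * 3"
proof -
  obtain x :: "'a ^ 3" where "x \<noteq> 0"
    using exists_orthogonal by blast
  then obtain r where r: "h r r \<noteq> 0"
    by (cases "h x x = 0") (use tangent_complement in blast)+
  obtain s t where st: "h s s \<noteq> 0" "h t t \<noteq> 0" and o: "h r s = 0" "h r t = 0" "h s t = 0"
    using exists_orthogonal_basis[OF r] by blast
  note nz = r st
  have sym: "h s r = 0" "h t r = 0" "h t s = 0"
    using o h_eq_0_sym by blast+
  let ?c = "\<lambda>b c. 1 *s r + b *s s + c *s t"
  let ?N = "UNIV - {0 :: 'a}"
  have norm: "h (?c b c) (?c b c) \<noteq> 0" if "b \<noteq> 0" "c \<noteq> 0" for b c
    unfolding binary_norm_comb[OF q nz o] binary_norm[OF q] using that binary_two[OF q] by simp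
  let ?A = "{pt r, pt s, pt t}" and ?B = "(\<lambda>(b, c). pt (?c b c)) ` (?N \<times> ?N)"
  have V: "verts = ?A \<union> ?B"
  proof (intro equalityI subsetI)
    fix Q assume "Q \<in> verts"
    then obtain u where u: "Q = pt u" "h u u \<noteq> 0"
      by (auto simp: verts_eq)
    obtain a b c where abc: "u = a *s r + b *s s + c *s t"
      using orthogonal_basis_expansion[OF nz o, of u] by blast
    show "Q \<in> ?A \<union> ?B"
    proof (cases "a \<noteq> 0 \<and> b \<noteq> 0 \<and> c \<noteq> 0")
      case True
      then have "u = a *s ?c (b / a) (c / a)"
        by (simp add: abc vec.scale_right_distrib)
      then have "Q = pt (?c (b / a) (c / a))"
        using u(1) True by (metis pt_scale)
      then have "Q \<in> ?B"
        using True by (intro image_eqI[of _ _ "(b / a, c / a)"]) auto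
      then show ?thesis
        by blast
    next
      case False
      have "h u u = a * bar a + b * bar b + c * bar c"
        unfolding abc by (rule binary_norm_comb[OF q nz o])
      then have "(b = 0 \<and> c = 0) \<or> (a = 0 \<and> c = 0) \<or> (a = 0 \<and> b = 0)"
        using False u(2) binary_two[OF q] unfolding binary_norm[OF q] by (auto split: if_splits)
      then have "u = a *s r \<or> u = b *s s \<or> u = c *s t"
        using abc by auto
      then have "Q \<in> ?A"
        using pt_eqI[OF nonisotropic_ne_0[OF u(2)]] u(1) by blast
      then show ?thesis
        by blast
    qed
  next
    fix Q assume "Q \<in> ?A \<union> ?B"
    then consider "Q \<in> ?A" | "Q \<in> ?B"
      by blast
    then show "Q \<in> verts"
    proof cases
      case 1
      then show ?thesis
        using pt_in_verts nz by blast
    next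
      case 2
      then obtain b c where "b \<noteq> 0" "c \<noteq> 0" "Q = pt (?c b c)"
        by blast
      then show ?thesis
        using pt_in_verts[OF norm] by blast
    qed
  qed
  have disj: "?A \<inter> ?B = {}"
  proof -
    have "pt w \<noteq> pt (?c b c)" if bc: "b \<noteq> 0" "c \<noteq> 0" and w: "w \<in> {r, s, t}" for w b c
    proof
      assume "pt w = pt (?c b c)"
      then obtain k where k: "k \<noteq> 0" "?c b c = k *s w"
        using pt_eq_iff[of "?c b c" w] nonisotropic_ne_0[OF norm[OF bc]] by metis
      have "h (?c b c) r = k * h w r" "h (?c b c) s = k * h w s" "h (?c b c) t = k * h w t"
        unfolding k(2) by simp_all
      then show False
        using w nz o sym bc by auto
    qed
    note ne = this
    show ?thesis
    proof (rule equals0I)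
      fix Q assume "Q \<in> ?A \<inter> ?B"
      then have "Q \<in> ?A" "Q \<in> ?B"
        by blast+
      obtain b c where "b \<noteq> 0" "c \<noteq> 0" "Q = pt (?c b c)"
        using \<open>Q \<in> ?B\<close> by blast
      then show False
        using ne[of b c] \<open>Q \<in> ?A\<close> by blast
    qed
  qed
  have card_A: "card ?A = 3"
    using orthogonal_nonisotropic_ne[OF o(1) nz(1)] orthogonal_nonisotropic_ne[OF o(2) nz(1)]
      orthogonal_nonisotropic_ne[OF o(3) nz(2)] nz nonisotropic_ne_0 by auto
  have card_B: "card ?B = 9"
  proof -
    have "inj_on (\<lambda>(b, c). pt (?c b c)) (?N \<times> ?N)"
    proof (rule inj_onI)
      fix z z' assume zz: "z \<in> ?N \<times> ?N"
        "(\<lambda>(b, c). pt (?c b c)) z = (\<lambda>(b, c). pt (?c b c)) z'"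
      obtain b c b' c' where z: "z = (b, c)" "z' = (b', c')"
        by (cases z, cases z')
      have ne: "b \<noteq> 0" "c \<noteq> 0" and eq: "pt (?c b c) = pt (?c b' c')"
        using zz unfolding z by auto
      obtain k where k: "?c b c = k *s ?c b' c'"
        using eq pt_eq_iff[OF nonisotropic_ne_0[OF norm[OF ne]]] by blast
      have "h (?c b c) r = k * h (?c b' c') r" "h (?c b c) s = k * h (?c b' c') s"
        "h (?c b c) t = k * h (?c b' c') t"
        unfolding k by simp_all
      then show "z = z'"
        using nz o sym by (simp add: z)
    qed
    then have "card ?B = card (?N \<times> ?N)"
      by (rule card_image)
    also have "card ?N = 3"
      by (simp add: card_Diff_singleton card_field q)
    then have "card (?N \<times> ?N) = 9"
      by (simp add: card_cartesian_product)
    finally show ?thesis .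
  qed
  have "card verts = card ?A + card ?B"
    unfolding V by (rule card_Un_disjoint[OF _ _ disj]) simp_all
  then show ?thesis
    unfolding card_A card_B by simp
qed

theorem graph_AutGroup_binary:
  assumes q: "q = 2"
  shows "graph_AutGroup (NU3 h) \<cong> wreath_sym (sym_group 3) 4"
proof -
  let ?C = "\<lambda>P. {Q \<in> verts. \<not> adj P Q}"
  have class_basis: "\<exists>r s t. P = pt r \<and> ?C (pt r) = {pt r, pt s, pt t} \<and> ?C (pt s) = {pt r, pt s, pt t} \<and>
      ?C (pt t) = {pt r, pt s, pt t} \<and> card {pt r, pt s, pt t} = 3" if "P \<in> verts" for P
  proof -
    obtain r where r: "P = pt r" "h r r \<noteq> 0"
      using \<open>P \<in> verts\<close> unfolding verts_eq by blast
    obtain s t where st: "h s s \<noteq> 0" "h t t \<noteq> 0" and o: "h r s = 0" "h r t = 0" "h s t = 0"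
      using exists_orthogonal_basis[OF r(2)] by blast
    have sym: "h s r = 0" "h t r = 0" "h t s = 0"
      using o h_eq_0_sym by blast+
    have "card {pt r, pt s, pt t} = 3"
      using orthogonal_nonisotropic_ne[OF o(1) r(2)] orthogonal_nonisotropic_ne[OF o(2) r(2)]
        orthogonal_nonisotropic_ne[OF o(3) st(1)] st nonisotropic_ne_0 by auto
    moreover have "?C (pt r) = {pt r, pt s, pt t}"
      by (rule binary_class[OF q r(2) st o])
    moreover have "?C (pt s) = {pt r, pt s, pt t}"
      unfolding binary_class[OF q st(1) r(2) st(2) sym(1) o(3) o(2)] by (rule insert_commute)
    moreover have "?C (pt t) = {pt r, pt s, pt t}"
      unfolding binary_class[OF q st(2) r(2) st(1) sym(2) sym(3) o(1)] by blast
    ultimately show ?thesis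
      using r(1) by (intro exI conjI)
  qed
  have "\<exists>\<beta> :: nat \<times> nat \<Rightarrow> _. bij_betw \<beta> ({1..4} \<times> {1..3}) verts \<and>
    (\<forall>i\<in>{1..4}. \<forall>j\<in>{1..3}. \<forall>i'\<in>{1..4}. \<forall>j'\<in>{1..3}. \<beta> (i', j') \<in> ?C (\<beta> (i, j)) \<longleftrightarrow> i = i')"
  proof (rule exists_class_coordinates)
    show "P \<in> ?C P" if "P \<in> verts" for P
      using that adj_iff_line by auto
    show "?C Q = ?C P" if P: "P \<in> verts" and Q: "Q \<in> ?C P" for P Q
    proof -
      from class_basis[OF P] obtain r s t where b: "P = pt r" "?C (pt r) = {pt r, pt s, pt t}"
        "?C (pt s) = {pt r, pt s, pt t}" "?C (pt t) = {pt r, pt s, pt t}"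
        by (elim exE conjE)
      have "Q \<in> {pt r, pt s, pt t}"
        using Q unfolding b(1,2) .
      then consider "Q = pt r" | "Q = pt s" | "Q = pt t"
        by blast
      then show ?thesis
        by cases (simp_all only: b)
    qed
    show "card (?C P) = 3" if P: "P \<in> verts" for P
    proof -
      from class_basis[OF P] obtain r s t where b: "P = pt r" "?C (pt r) = {pt r, pt s, pt t}"
        "card {pt r, pt s, pt t} = 3"
        by (elim exE conjE)
      then show ?thesis
        by (simp only: b)
    qed
  qed (use binary_card_verts[OF q] in auto)
  then obtain \<beta> :: "nat \<times> nat \<Rightarrow> ('a ^ 3) set" where \<beta>: "bij_betw \<beta> ({1..4} \<times> {1..3}) verts"
    "\<forall>i\<in>{1..4}. \<forall>j\<in>{1..3}. \<forall>i'\<in>{1..4}. \<forall>j'\<in>{1..3}. \<beta> (i', j') \<in> ?C (\<beta> (i, j)) \<longleftrightarrow> i = i'"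
    by (elim exE conjE)
  have "graph_AutGroup (verts, snd (NU3 h)) \<cong> wreath_sym (sym_group 3) 4"
  proof (rule graph_AutGroup_complete_multipartite[OF \<beta>(1)])
    fix i j i' j' :: nat
    assume ij: "i \<in> {1..4}" "j \<in> {1..3}" "i' \<in> {1..4}" "j' \<in> {1..3}"
    have "\<beta> (i', j') \<in> verts"
      using bij_betw_apply[OF \<beta>(1), of "(i', j')"] ij by auto
    then show "{\<beta> (i, j), \<beta> (i', j')} \<in> snd (NU3 h) \<longleftrightarrow> i \<noteq> i'"
      using bspec[OF bspec[OF bspec[OF bspec[OF \<beta>(2) ij(1)] ij(2)] ij(3)] ij(4)] by (auto simp: adj_def)
  qed simp
  moreover have "NU3 h = (verts, snd (NU3 h))"
    by (simp add: NU3_def verts_def Let_def)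
  ultimately show ?thesis
    by simp
qed

end

section \<open>The automorphism group of \<open>NU(3, q\<^sup>2)\<close>\<close>

theorem theorem1p1:
  fixes q :: nat and h :: "'a::{field,finite} ^ 3 \<Rightarrow> 'a ^ 3 \<Rightarrow> 'a"
  assumes "primepow q"
    and "CARD('a) = q ^ 2"
    and "nondegenerate_hermitian_form q h"
  shows "(q \<noteq> 2 \<longrightarrow> graph_AutGroup (NU3 h) \<cong> PGammaU h) \<and>
         (q = 2 \<longrightarrow> graph_AutGroup (NU3 h) \<cong> wreath_sym (sym_group 3) 4)"
proof -
  interpret hermitian_plane q h
    using assms by unfold_locales
  show ?thesis
    using graph_AutGroup_iso_PGammaU graph_AutGroup_binary by blast
qed

end
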